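(* For all $r>\frac14$, the kernel $\ker i_{4,r}^*\subseteq H^*(\mathrm{Conf}_4)$ contains the classes of all six $3$-edge ordered forests on $\{1,2,3,4\}$ and, for each $3$-edge ordered forest $G$ with edges $e_1,e_2,e_3$ ordered by their terminal endpoints, the signed sum of its three $2$-edge ordered subforests $$d\theta^{\wedge\{e_2,e_3\}}-d\theta^{\wedge\{e_1,e_3\}}+d\theta^{\wedge\{e_1,e_2\}}.$$ These twelve elements of $\ker i_{4,r}^*$ are linearly independent.
   Context: $D^2$ is the closed unit disk in $\mathbb{R}^2$. $\mathrm{Conf}_n$ is the space of ordered $n$-tuples $(x_1,\ldots,x_n)$ of distinct points of $D^2$, and $\mathrm{Conf}_{n,r}\subseteq\mathrm{Conf}_n$ is the subspace of those tuples for which the open disks of radius $r$ centered at $x_1,\ldots,x_n$ are pairwise disjoint and contained in $D^2$. $i_{n,r}:\mathrm{Conf}_{n,r}\to\mathrm{Conf}_n$ is the inclusion, and $i_{n,r}^*$ is the induced map on integral singular cohomology. An ordered forest is a directed graph $G$ on $\{1,\ldots,n\}$ in which every edge $i\to j$ has $i<j$ and every vertex has in-degree at most $1$. For such $G$, list its edges in increasing order of their terminal endpoints; the angle map $\alpha_G:\mathrm{Conf}_n\to(S^1)^{|E(G)|}$ records $\frac{x_j-x_i}{|x_j-x_i|}$ for each edge $i\to j$ in that order, and $d\theta^{\wedge G}=\alpha_G^*(d\theta_1\wedge\cdots\wedge d\theta_{|E(G)|})$, where $S^1=\mathbb{R}/\mathbb{Z}$ and $d\theta$ is the generator of $H^1(S^1)$.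 For a set of edges, $d\theta^{\wedge\{\cdot\}}$ means the class of the forest with those edges. (By a theorem of Arnol'd, the classes $d\theta^{\wedge G}$ over all ordered forests $G$ on $n$ vertices form a free basis of $H^*(\mathrm{Conf}_n)$.) *)

theory Defs
  imports "HOL-Homology.Homology"
begin

section \<open>Integral singular cohomology\<close>

text \<open>A singular \<open>p\<close>-cochain is an integer-valued function on the singular \<open>p\<close>-simplices, that is,
  the same thing as a homomorphism from \<^const>\<open>chain_group\<close> to the integers.
  As in HOL-Algebra, all groups are written multiplicatively.\<close>

type_synonym 'a cochain = "((nat \<Rightarrow> real) \<Rightarrow> 'a) \<Rightarrow> int"

definition cochain_group :: "nat \<Rightarrow> 'a topology \<Rightarrow> 'a cochain monoid" where
  "cochain_group p X = product_group (singular_simplex_set p X) (\<lambda>_. integer_group)"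

definition cochain_eval :: "'a cochain \<Rightarrow> 'a chain \<Rightarrow> int" where
  "cochain_eval a c = (\<Sum>\<sigma>\<in>Poly_Mapping.keys c. Poly_Mapping.lookup c \<sigma> * a \<sigma>)"

definition coboundary :: "nat \<Rightarrow> 'a topology \<Rightarrow> 'a cochain \<Rightarrow> 'a cochain" where
  "coboundary p X a =
     (\<lambda>\<sigma>\<in>singular_simplex_set (Suc p) X. cochain_eval a (chain_boundary (Suc p) (frag_of \<sigma>)))"

definition cocycle_group :: "nat \<Rightarrow> 'a topology \<Rightarrow> 'a cochain monoid" where
  "cocycle_group p X = subgroup_generated (cochain_group p X)
     (kernel (cochain_group p X) (cochain_group (Suc p) X) (coboundary p X))"

definition coboundary_set :: "nat \<Rightarrow> 'a topology \<Rightarrow> 'a cochain set" where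
  "coboundary_set p X =
     (case p of 0 \<Rightarrow> {\<one>\<^bsub>cochain_group 0 X\<^esub>}
      | Suc q \<Rightarrow> coboundary q X ` carrier (cochain_group q X))"

definition cohomology_group :: "nat \<Rightarrow> 'a topology \<Rightarrow> 'a cochain set monoid" where
  "cohomology_group p X = cocycle_group p X Mod coboundary_set p X"

definition cohomology_class :: "nat \<Rightarrow> 'a topology \<Rightarrow> 'a cochain \<Rightarrow> 'a cochain set" where
  "cohomology_class p X a = coboundary_set p X #>\<^bsub>cocycle_group p X\<^esub> a"

text \<open>Operations on classes are unions over all representatives; as the operations respect
  cohomology, all cosets in such a union coincide.\<close>

definition cochain_pullback ::
    "nat \<Rightarrow> 'a topology \<Rightarrow> ('a \<Rightarrow> 'b) \<Rightarrow> 'b cochain \<Rightarrow> 'a cochain" where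
  "cochain_pullback p X f a = (\<lambda>\<sigma>\<in>singular_simplex_set p X. a (simplex_map p f \<sigma>))"

definition cohomology_pullback ::
    "nat \<Rightarrow> 'a topology \<Rightarrow> ('a \<Rightarrow> 'b) \<Rightarrow> 'b cochain set \<Rightarrow> 'a cochain set" where
  "cohomology_pullback p X f A = (\<Union>a\<in>A. cohomology_class p X (cochain_pullback p X f a))"

definition front_face :: "nat \<Rightarrow> ((nat \<Rightarrow> real) \<Rightarrow> 'a) \<Rightarrow> (nat \<Rightarrow> real) \<Rightarrow> 'a" where
  "front_face p \<sigma> = restrict \<sigma> (standard_simplex p)"

definition back_face :: "nat \<Rightarrow> nat \<Rightarrow> ((nat \<Rightarrow> real) \<Rightarrow> 'a) \<Rightarrow> (nat \<Rightarrow> real) \<Rightarrow> 'a" where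
  "back_face p q \<sigma> = (\<lambda>x\<in>standard_simplex q. \<sigma> (\<lambda>i. if i < p then 0 else x (i - p)))"

definition cup_cochain ::
    "nat \<Rightarrow> nat \<Rightarrow> 'a topology \<Rightarrow> 'a cochain \<Rightarrow> 'a cochain \<Rightarrow> 'a cochain" where
  "cup_cochain p q X a b =
     (\<lambda>\<sigma>\<in>singular_simplex_set (p + q) X. a (front_face p \<sigma>) * b (back_face p q \<sigma>))"

definition cup ::
    "nat \<Rightarrow> nat \<Rightarrow> 'a topology \<Rightarrow> 'a cochain set \<Rightarrow> 'a cochain set \<Rightarrow> 'a cochain set" where
  "cup p q X A B = (\<Union>a\<in>A. \<Union>b\<in>B. cohomology_class (p + q) X (cup_cochain p q X a b))"

definition cohomology_unit :: "'a topology \<Rightarrow> 'a cochain set" where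
  "cohomology_unit X = cohomology_class 0 X (\<lambda>\<sigma>\<in>singular_simplex_set 0 X. 1)"

text \<open>The cup product of a list of classes of degree one.\<close>

primrec wedge :: "'a topology \<Rightarrow> 'a cochain set list \<Rightarrow> 'a cochain set" where
  "wedge X [] = cohomology_unit X"
| "wedge X (A # As) = cup 1 (length As) X A (wedge X As)"

text \<open>The total cohomology group, the direct sum over all degrees.\<close>

definition total_cohomology :: "'a topology \<Rightarrow> (nat \<Rightarrow> 'a cochain set) monoid" where
  "total_cohomology X = sum_group UNIV (\<lambda>p. cohomology_group p X)"

definition homogeneous :: "nat \<Rightarrow> 'a topology \<Rightarrow> 'a cochain set \<Rightarrow> nat \<Rightarrow> 'a cochain set" where
  "homogeneous p X A = (\<lambda>q. if q = p then A else \<one>\<^bsub>cohomology_group q X\<^esub>)"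

definition total_pullback ::
    "'a topology \<Rightarrow> ('a \<Rightarrow> 'b) \<Rightarrow> (nat \<Rightarrow> 'b cochain set) \<Rightarrow> nat \<Rightarrow> 'a cochain set" where
  "total_pullback X f c = (\<lambda>p. cohomology_pullback p X f (c p))"

definition int_independent :: "('a, 'b) monoid_scheme \<Rightarrow> 'i set \<Rightarrow> ('i \<Rightarrow> 'a) \<Rightarrow> bool" where
  "int_independent G I f \<longleftrightarrow>
     (\<forall>J c. finite J \<longrightarrow> J \<subseteq> I \<longrightarrow> finprod G (\<lambda>i. f i [^]\<^bsub>G\<^esub> (c i :: int)) J = \<one>\<^bsub>G\<^esub>
        \<longrightarrow> (\<forall>i\<in>J. c i = 0))"


section \<open>Configuration spaces\<close>

text \<open>The plane is the type \<^typ>\<open>complex\<close>; configurations are extensional functions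
  on the index set \<open>{1..n}\<close>.\<close>

definition Conf :: "nat \<Rightarrow> (nat \<Rightarrow> complex) topology" where
  "Conf n = subtopology (product_topology (\<lambda>_. top_of_set (cball 0 1)) {1..n})
     {x. inj_on x {1..n}}"

definition disk_Conf :: "nat \<Rightarrow> real \<Rightarrow> (nat \<Rightarrow> complex) topology" where
  "disk_Conf n r = subtopology (Conf n)
     {x. disjoint_family_on (\<lambda>i. ball (x i) r) {1..n} \<and> (\<forall>i\<in>{1..n}. ball (x i) r \<subseteq> cball 0 1)}"


section \<open>Ordered forests and their classes\<close>

text \<open>A forest is given by its set of edges, the vertex set being \<open>{1..n}\<close>.\<close>

definition ordered_forest :: "nat \<Rightarrow> (nat \<times> nat) set \<Rightarrow> bool" where
  "ordered_forest n G \<longleftrightarrow>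
     G \<subseteq> {1..n} \<times> {1..n} \<and> (\<forall>(i, j)\<in>G. i < j) \<and> (\<forall>j. card {i. (i, j) \<in> G} \<le> 1)"

definition edge_list :: "(nat \<times> nat) set \<Rightarrow> (nat \<times> nat) list" where
  "edge_list G = sorted_key_list_of_set snd G"

text \<open>The quotient \<open>\<real>/\<int>\<close> is identified with the unit circle by \<open>t \<mapsto> exp (2\<pi>it)\<close>.\<close>

definition circle :: "complex topology" where
  "circle = top_of_set (sphere 0 1)"

definition circle_power :: "nat \<Rightarrow> (nat \<Rightarrow> complex) topology" where
  "circle_power k = product_topology (\<lambda>_. circle) {..<k}"

definition circle_generator :: "complex cochain set \<Rightarrow> bool" where
  "circle_generator d\<theta> \<longleftrightarrow>
     d\<theta> \<in> carrier (cohomology_group 1 circle) \<and>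
     subgroup_generated (cohomology_group 1 circle) {d\<theta>} = cohomology_group 1 circle"

definition torus_class :: "complex cochain set \<Rightarrow> nat \<Rightarrow> (nat \<Rightarrow> complex) cochain set" where
  "torus_class d\<theta> k = wedge (circle_power k)
     (map (\<lambda>m. cohomology_pullback 1 (circle_power k) (\<lambda>t. t m) d\<theta>) [0..<k])"

definition angle_map :: "(nat \<times> nat) set \<Rightarrow> (nat \<Rightarrow> complex) \<Rightarrow> nat \<Rightarrow> complex" where
  "angle_map G x = (\<lambda>m\<in>{..<card G}. case edge_list G ! m of
     (i, j) \<Rightarrow> (x j - x i) / of_real (norm (x j - x i)))"

definition forest_class ::
    "complex cochain set \<Rightarrow> nat \<Rightarrow> (nat \<times> nat) set \<Rightarrow> nat \<Rightarrow> (nat \<Rightarrow> complex) cochain set" where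
  "forest_class d\<theta> n G = homogeneous (card G) (Conf n)
     (cohomology_pullback (card G) (Conf n) (angle_map G) (torus_class d\<theta> (card G)))"

text \<open>For a forest with exactly three edges.\<close>

definition subforest_sum ::
    "complex cochain set \<Rightarrow> nat \<Rightarrow> (nat \<times> nat) set \<Rightarrow> nat \<Rightarrow> (nat \<Rightarrow> complex) cochain set" where
  "subforest_sum d\<theta> n G = (let e1 = edge_list G ! 0; e2 = edge_list G ! 1; e3 = edge_list G ! 2 in
     forest_class d\<theta> n {e2, e3}
       \<otimes>\<^bsub>total_cohomology (Conf n)\<^esub> inv\<^bsub>total_cohomology (Conf n)\<^esub> forest_class d\<theta> n {e1, e3}
       \<otimes>\<^bsub>total_cohomology (Conf n)\<^esub> forest_class d\<theta> n {e1, e2})"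

end

theory Submission
  imports Defs "HOL-Analysis.Further_Topology"
begin

text \<open>For a three-edge forest with edges \<open>e1, e2, e3\<close> write \<open>a, b, c\<close> for the pullbacks of the generator of
the circle along the three angles \<open>u, v, w\<close> of the edges. Such a forest is a tree whose first edge
is \<open>1 \<rightarrow> 2\<close>; its class is \<open>a \<union> b \<union> c\<close>, and its signed sum of two-edge subforests is
\<open>b \<union> c - a \<union> c + a \<union> b\<close>.

Both classes die on the disk configurations because four disks of radius larger than \<open>1/4\<close> do not
fit side by side along a line. If the three angles of the tree were equal, all four centers would be
collinear, so \<open>u = v = w\<close> never happens (\<open>no_collinear_disks\<close>). The square of a class of
degree one is zero (\<open>is_coboundary_cup_self\<close>), hence the signed sum equals
\<open>(b - a) \<union> (c - b)\<close>. This is the pullback of the top class of the two-dimensional torus along the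
map \<open>(v/u, w/v)\<close>, which misses the point \<open>(1, 1)\<close>, and the top class vanishes on the complement of
a point (\<open>cup_winding_coboundary\<close>). Multiplying the signed sum by \<open>a\<close> from the left leaves
\<open>a \<union> b \<union> c\<close>, so the class of the tree dies as well.

The vanishing on the punctured torus is proved on cochains. The generator is, up to a nonzero
factor, represented by the cocycle \<open>wind\<close> that counts the passages of a path through the point
\<open>1\<close> (\<open>circle_generator_wind\<close>). With this representative the cup product along a pair of functions
that are never both \<open>1\<close> is zero on every simplex on which one of the functions avoids \<open>1\<close>. Simplices
become this small under iterated barycentric subdivision, and a cocycle that vanishes on small
simplices is a coboundary (\<open>is_coboundary_if_vanishes_on_small\<close>).

For independence, each tree has a planetary torus: vertex \<open>2\<close> circles around vertex \<open>1\<close>, vertex \<open>3\<close>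
around its parent on a smaller circle, and vertex \<open>4\<close> around its parent on a still smaller one.
The value of \<open>a \<union> b \<union> c\<close> on the fundamental cycle of this torus is the determinant of the matrix
of winding numbers of the three angles along the three orbits. The matrix is lower triangular, and
its diagonal entries are \<open>1\<close> exactly when the parents in the torus are those in the tree
(\<open>torus_eval_forest\<close>). So the six tori are dual to the six classes of degree three. Since \<open>a\<close> is the
same class for all trees and \<open>a\<close> times the signed sum of a tree is the class of that tree, the
functionals that first multiply by \<open>a\<close> are dual to the six sums of degree two.\<close>

section \<open>Integer cochains\<close>

text \<open>Evaluation is the universal extension to the free abelian group, with values in the free group on one
generator, so it inherits linearity from \<^const>\<open>frag_extend\<close>.\<close>

lemma cochain_eval_extend:
  "cochain_eval a c = Poly_Mapping.lookup (frag_extend (\<lambda>\<sigma>. frag_cmul (a \<sigma>) (frag_of ())) c) ()"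
  by (simp add: cochain_eval_def frag_extend_def Poly_Mapping.lookup_sum)

lemma cochain_eval_0 [simp]: "cochain_eval a 0 = 0"
  by (simp add: cochain_eval_extend)

lemma cochain_eval_of [simp]: "cochain_eval a (frag_of \<sigma>) = a \<sigma>"
  by (simp add: cochain_eval_extend)

lemma cochain_eval_add: "cochain_eval a (c + d) = cochain_eval a c + cochain_eval a d"
  by (simp add: cochain_eval_extend frag_extend_add lookup_add)

lemma cochain_eval_diff: "cochain_eval a (c - d) = cochain_eval a c - cochain_eval a d"
  by (simp add: cochain_eval_extend frag_extend_diff lookup_minus)

lemma cochain_eval_cmul: "cochain_eval a (frag_cmul k c) = k * cochain_eval a c"
  by (simp add: cochain_eval_extend frag_extend_cmul)

lemma cochain_eval_sum: "cochain_eval a (sum f I) = (\<Sum>i\<in>I. cochain_eval a (f i))"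
  by (induction I rule: infinite_finite_induct) (simp_all add: cochain_eval_add)

lemma cochain_eval_eq_0:
  "(\<And>\<sigma>. \<sigma> \<in> Poly_Mapping.keys c \<Longrightarrow> a \<sigma> = 0) \<Longrightarrow> cochain_eval a c = 0"
  by (simp add: cochain_eval_def)

text \<open>The coboundary as a total function on all maps out of the simplex, without truncation to the singular
simplices of a fixed space. Cocycles, coboundaries and products can then be computed pointwise, and
spaces enter only as side conditions.\<close>

definition delta :: "nat \<Rightarrow> 'a cochain \<Rightarrow> 'a cochain" where
  "delta p a \<sigma> = (\<Sum>k\<le>Suc p. (-1) ^ k * a (singular_face (Suc p) k \<sigma>))"

lemma eval_boundary_of: "cochain_eval a (chain_boundary (Suc p) (frag_of \<sigma>)) = delta p a \<sigma>"
  by (simp only: chain_boundary_of delta_def cochain_eval_sum cochain_eval_cmul cochain_eval_of nat.distinct if_False)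

lemma eval_boundary: "cochain_eval a (chain_boundary (Suc p) c) = cochain_eval (delta p a) c"
proof (induction c rule: frag_induction[OF subset_UNIV])
  case 2 then show ?case by (simp add: eval_boundary_of)
qed (auto simp: chain_boundary_diff cochain_eval_diff)

lemma delta_add: "delta p (\<lambda>\<sigma>. a \<sigma> + b \<sigma>) \<sigma> = delta p a \<sigma> + delta p b \<sigma>"
  by (simp add: delta_def sum.distrib ring_distribs del: sum.atMost_Suc)

lemma delta_cmul: "delta p (\<lambda>\<sigma>. k * a \<sigma>) \<sigma> = k * delta p a \<sigma>"
  by (simp add: delta_def sum_distrib_left mult.left_commute del: sum.atMost_Suc)

lemma delta_diff: "delta p (\<lambda>\<sigma>. a \<sigma> - b \<sigma>) \<sigma> = delta p a \<sigma> - delta p b \<sigma>"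
  by (simp add: delta_def sum_subtractf ring_distribs del: sum.atMost_Suc)

lemma delta_cong:
  assumes "singular_simplex (Suc p) X \<sigma>" "\<And>\<tau>. singular_simplex p X \<tau> \<Longrightarrow> a \<tau> = b \<tau>"
  shows "delta p a \<sigma> = delta p b \<sigma>"
  unfolding delta_def using singular_simplex_singular_face[OF assms(1)] assms(2)
  by (intro sum.cong) auto

lemma delta_delta:
  assumes "singular_simplex (Suc (Suc p)) X \<sigma>"
  shows "delta (Suc p) (delta p a) \<sigma> = 0"
proof -
  have "delta (Suc p) (delta p a) \<sigma>
      = cochain_eval a (chain_boundary (Suc p) (chain_boundary (Suc (Suc p)) (frag_of \<sigma>)))"
    by (simp only: eval_boundary eval_boundary_of[symmetric])
  also have "\<dots> = 0"
    using chain_boundary_boundary_alt[of "Suc p" X "frag_of \<sigma>"] assms by (simp add: singular_chain_of)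
  finally show ?thesis .
qed

definition is_cocycle :: "nat \<Rightarrow> 'a topology \<Rightarrow> 'a cochain \<Rightarrow> bool" where
  "is_cocycle p X a \<longleftrightarrow> (\<forall>\<sigma>. singular_simplex (Suc p) X \<sigma> \<longrightarrow> delta p a \<sigma> = 0)"

text \<open>In degree \<open>0\<close> only cochains that vanish on the points of the space are coboundaries. The condition is on
the singular simplices of the space, so it is a property of the truncated cochain.\<close>

definition is_coboundary :: "nat \<Rightarrow> 'a topology \<Rightarrow> 'a cochain \<Rightarrow> bool" where
  "is_coboundary p X a \<longleftrightarrow>
     (case p of 0 \<Rightarrow> (\<forall>\<sigma>. singular_simplex 0 X \<sigma> \<longrightarrow> a \<sigma> = 0)
      | Suc q \<Rightarrow> \<exists>b. \<forall>\<sigma>. singular_simplex p X \<sigma> \<longrightarrow> a \<sigma> = delta q b \<sigma>)"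

lemma is_coboundary_Suc:
  "is_coboundary (Suc q) X a \<longleftrightarrow> (\<exists>b. \<forall>\<sigma>. singular_simplex (Suc q) X \<sigma> \<longrightarrow> a \<sigma> = delta q b \<sigma>)"
  by (simp add: is_coboundary_def)

lemma is_coboundaryI:
  "(\<And>\<sigma>. singular_simplex (Suc q) X \<sigma> \<Longrightarrow> a \<sigma> = delta q b \<sigma>) \<Longrightarrow> is_coboundary (Suc q) X a"
  by (auto simp: is_coboundary_Suc)

lemma is_coboundary_zero: "(\<And>\<sigma>. singular_simplex p X \<sigma> \<Longrightarrow> a \<sigma> = 0) \<Longrightarrow> is_coboundary p X a"
  by (cases p) (auto simp: is_coboundary_def delta_def intro!: exI[where x="\<lambda>_. 0"])

lemma is_coboundary_add:
  assumes "is_coboundary p X a" "is_coboundary p X b"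
  shows "is_coboundary p X (\<lambda>\<sigma>. a \<sigma> + b \<sigma>)"
proof (cases p)
  case (Suc q)
  then obtain f g where "\<And>\<sigma>. singular_simplex p X \<sigma> \<Longrightarrow> a \<sigma> = delta q f \<sigma>" "\<And>\<sigma>. singular_simplex p X \<sigma> \<Longrightarrow> b \<sigma> = delta q g \<sigma>"
    using assms by (auto simp: is_coboundary_Suc)
  then show ?thesis unfolding Suc
    by (intro is_coboundaryI[where b="\<lambda>\<sigma>. f \<sigma> + g \<sigma>"]) (simp add: delta_add)
qed (use assms in \<open>simp add: is_coboundary_def\<close>)

lemma is_coboundary_cmul:
  assumes "is_coboundary p X a"
  shows "is_coboundary p X (\<lambda>\<sigma>. k * a \<sigma>)"
proof (cases p)
  case (Suc q)
  then obtain f where "\<And>\<sigma>. singular_simplex p X \<sigma> \<Longrightarrow> a \<sigma> = delta q f \<sigma>"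
    using assms by (auto simp: is_coboundary_Suc)
  then show ?thesis unfolding Suc
    by (intro is_coboundaryI[where b="\<lambda>\<sigma>. k * f \<sigma>"]) (simp add: delta_cmul)
qed (use assms in \<open>simp add: is_coboundary_def\<close>)

lemma is_coboundary_diff:
  assumes "is_coboundary p X a" "is_coboundary p X b"
  shows "is_coboundary p X (\<lambda>\<sigma>. a \<sigma> - b \<sigma>)"
  using is_coboundary_add[OF assms(1) is_coboundary_cmul[OF assms(2), of "-1"]] by simp

lemma is_coboundary_cong:
  assumes "is_coboundary p X a" "\<And>\<sigma>. singular_simplex p X \<sigma> \<Longrightarrow> a \<sigma> = b \<sigma>"
  shows "is_coboundary p X b"
  using assms by (cases p) (auto simp: is_coboundary_def)

lemma is_cocycle_cong:
  assumes "is_cocycle p X a" "\<And>\<sigma>. singular_simplex p X \<sigma> \<Longrightarrow> a \<sigma> = b \<sigma>"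
  shows "is_cocycle p X b"
  using assms delta_cong[of p X] unfolding is_cocycle_def by metis

lemma is_coboundary_imp_cocycle:
  assumes "is_coboundary p X a" shows "is_cocycle p X a"
proof (cases p)
  case 0
  then have "\<And>\<sigma>. singular_simplex 0 X \<sigma> \<Longrightarrow> a \<sigma> = 0" using assms by (auto simp: is_coboundary_def)
  then have "is_cocycle 0 X a" using is_cocycle_cong[of 0 X "\<lambda>_. 0" a]
    by (simp add: is_cocycle_def delta_def)
  then show ?thesis using 0 by simp
next
  case (Suc q)
  then obtain f where f: "\<And>\<sigma>. singular_simplex p X \<sigma> \<Longrightarrow> a \<sigma> = delta q f \<sigma>"
    using assms by (auto simp: is_coboundary_Suc)
  have "is_cocycle p X (delta q f)" unfolding is_cocycle_def Suc using delta_delta by blast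
  then show ?thesis by (rule is_cocycle_cong) (simp add: f)
qed

lemma is_cocycle_add: "is_cocycle p X a \<Longrightarrow> is_cocycle p X b \<Longrightarrow> is_cocycle p X (\<lambda>\<sigma>. a \<sigma> + b \<sigma>)"
  by (simp add: is_cocycle_def delta_add)

lemma is_cocycle_diff: "is_cocycle p X a \<Longrightarrow> is_cocycle p X b \<Longrightarrow> is_cocycle p X (\<lambda>\<sigma>. a \<sigma> - b \<sigma>)"
  by (simp add: is_cocycle_def delta_diff)

lemma is_cocycle_cmul: "is_cocycle p X a \<Longrightarrow> is_cocycle p X (\<lambda>\<sigma>. k * a \<sigma>)"
  by (simp add: is_cocycle_def delta_cmul)

lemma is_cocycle_boundary:
  assumes "is_cocycle p X a" "singular_chain (Suc p) X c"
  shows "cochain_eval a (chain_boundary (Suc p) c) = 0"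
  using assms unfolding eval_boundary
  by (intro cochain_eval_eq_0) (auto simp: singular_chain_def is_cocycle_def)

section \<open>Cohomology classes of cocycles\<close>

lemma group_cochain_group: "group (cochain_group p X)"
  by (simp add: cochain_group_def)

lemma comm_group_cochain_group: "comm_group (cochain_group p X)"
  by (rule group.group_comm_groupI[OF group_cochain_group]) (auto simp: cochain_group_def add.commute)

lemma carrier_cochain_group: "carrier (cochain_group p X) = extensional (singular_simplex_set p X)"
  by (auto simp: cochain_group_def PiE_def)

lemma mult_cochain_group: "a \<otimes>\<^bsub>cochain_group p X\<^esub> b = (\<lambda>\<sigma>\<in>singular_simplex_set p X. a \<sigma> + b \<sigma>)"
  by (simp add: cochain_group_def)

lemma one_cochain_group: "\<one>\<^bsub>cochain_group p X\<^esub> = (\<lambda>\<sigma>\<in>singular_simplex_set p X. 0)"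
  by (simp add: cochain_group_def)

lemma coboundary_eq: "coboundary p X a = restrict (delta p a) (singular_simplex_set (Suc p) X)"
  by (simp add: coboundary_def eval_boundary_of)

lemma coboundary_hom: "coboundary p X \<in> hom (cochain_group p X) (cochain_group (Suc p) X)"
proof (rule homI)
  fix a b :: "'a cochain"
  show "coboundary p X (a \<otimes>\<^bsub>cochain_group p X\<^esub> b) = coboundary p X a \<otimes>\<^bsub>cochain_group (Suc p) X\<^esub> coboundary p X b"
    unfolding coboundary_eq mult_cochain_group
    by (rule restrict_ext) (auto simp: delta_add[symmetric] intro: delta_cong)
qed (auto simp: carrier_cochain_group coboundary_eq)

lemma group_hom_coboundary: "group_hom (cochain_group p X) (cochain_group (Suc p) X) (coboundary p X)"
  by (simp add: group_hom_def group_hom_axioms_def group_cochain_group coboundary_hom)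

text \<open>The kernel of the coboundary is already a subgroup, so generating a subgroup from it adds nothing.\<close>

lemma carrier_cocycle_group:
  "carrier (cocycle_group p X) = {a \<in> extensional (singular_simplex_set p X). is_cocycle p X a}"
proof -
  interpret group_hom "cochain_group p X" "cochain_group (Suc p) X" "coboundary p X"
    by (rule group_hom_coboundary)
  have "carrier (cocycle_group p X) = kernel (cochain_group p X) (cochain_group (Suc p) X) (coboundary p X)"
    unfolding cocycle_group_def using subgroup_kernel by (rule subgroup.carrier_subgroup_generated_subgroup)
  also have "\<dots> = {a \<in> extensional (singular_simplex_set p X). is_cocycle p X a}"
    by (auto simp: kernel_def carrier_cochain_group coboundary_eq one_cochain_group is_cocycle_def
        restrict_def fun_eq_iff)
  finally show ?thesis .
qed

lemma mult_cocycle_group: "a \<otimes>\<^bsub>cocycle_group p X\<^esub> b = (\<lambda>\<sigma>\<in>singular_simplex_set p X. a \<sigma> + b \<sigma>)"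
  by (simp add: cocycle_group_def mult_cochain_group)

lemma comm_group_cocycle_group: "comm_group (cocycle_group p X)"
  unfolding cocycle_group_def
  by (rule group.abelian_subgroup_generated[OF group_cochain_group comm_group_cochain_group])

lemma coboundary_set_eq:
  "coboundary_set p X = {a \<in> extensional (singular_simplex_set p X). is_coboundary p X a}"
proof (cases p)
  case 0
  then show ?thesis
    by (auto simp: coboundary_set_def one_cochain_group is_coboundary_def extensional_def restrict_def fun_eq_iff)
next
  case (Suc q)
  have "a \<in> coboundary q X ` carrier (cochain_group q X)"
    if a: "a \<in> extensional (singular_simplex_set p X)" "\<And>\<sigma>. singular_simplex p X \<sigma> \<Longrightarrow> a \<sigma> = delta q b \<sigma>" for a b
  proof
    show "restrict b (singular_simplex_set q X) \<in> carrier (cochain_group q X)"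
      by (simp add: carrier_cochain_group)
    have "a \<sigma> = delta q (restrict b (singular_simplex_set q X)) \<sigma>" if "singular_simplex p X \<sigma>" for \<sigma>
      unfolding a(2)[OF that] by (rule delta_cong) (use that Suc in auto)
    then show "a = coboundary q X (restrict b (singular_simplex_set q X))"
      using a(1) Suc by (auto simp: coboundary_eq fun_eq_iff extensional_def)
  qed
  then show ?thesis
    using Suc by (auto simp: coboundary_set_def is_coboundary_Suc coboundary_eq)
qed

lemma subgroup_coboundary_set: "subgroup (coboundary_set p X) (cocycle_group p X)"
proof -
  interpret G: comm_group "cocycle_group p X" by (rule comm_group_cocycle_group)
  show ?thesis
  proof (rule G.subgroupI)
    show "coboundary_set p X \<subseteq> carrier (cocycle_group p X)"
      by (auto simp: coboundary_set_eq carrier_cocycle_group is_coboundary_imp_cocycle)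
    have "(\<lambda>\<sigma>\<in>singular_simplex_set p X. 0) \<in> coboundary_set p X"
      by (auto simp: coboundary_set_eq intro: is_coboundary_zero)
    then show "coboundary_set p X \<noteq> {}" by auto
    fix a assume a: "a \<in> coboundary_set p X"
    define b where "b = (\<lambda>\<sigma>\<in>singular_simplex_set p X. - a \<sigma>)"
    have b: "b \<in> coboundary_set p X"
      using a is_coboundary_cong[OF is_coboundary_cmul[of p X a "-1"], of b]
      by (auto simp: coboundary_set_eq b_def)
    have "inv\<^bsub>cocycle_group p X\<^esub> a = b"
    proof (rule G.inv_equality)
      show "b \<otimes>\<^bsub>cocycle_group p X\<^esub> a = \<one>\<^bsub>cocycle_group p X\<^esub>"
        by (auto simp: cocycle_group_def mult_cochain_group one_cochain_group b_def)
    qed (use a b in \<open>auto simp: coboundary_set_eq carrier_cocycle_group is_coboundary_imp_cocycle\<close>)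
    then show "inv\<^bsub>cocycle_group p X\<^esub> a \<in> coboundary_set p X" using b by simp
  next
    fix a b assume "a \<in> coboundary_set p X" "b \<in> coboundary_set p X"
    then show "a \<otimes>\<^bsub>cocycle_group p X\<^esub> b \<in> coboundary_set p X"
      by (auto simp: mult_cocycle_group coboundary_set_eq intro: is_coboundary_cong[OF is_coboundary_add])
  qed
qed

lemma normal_coboundary_set: "coboundary_set p X \<lhd> cocycle_group p X"
  by (simp add: comm_group.subgroup_imp_normal comm_group_cocycle_group subgroup_coboundary_set)

lemma group_cohomology_group: "group (cohomology_group p X)"
  unfolding cohomology_group_def by (rule normal.factorgroup_is_group[OF normal_coboundary_set])

lemma comm_group_cohomology_group: "comm_group (cohomology_group p X)"
  unfolding cohomology_group_def
  by (rule comm_group.abelian_FactGroup[OF comm_group_cocycle_group subgroup_coboundary_set])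

text \<open>The group operation truncates to the singular simplices. Therefore the coset of an arbitrary function
makes sense and depends only on the truncation of that function.\<close>

lemma cohomology_class_eq:
  "cohomology_class p X a =
     {b \<in> extensional (singular_simplex_set p X). is_coboundary p X (\<lambda>\<sigma>. b \<sigma> - a \<sigma>)}"
proof -
  have "b \<in> cohomology_class p X a"
    if b: "b \<in> extensional (singular_simplex_set p X)" "is_coboundary p X (\<lambda>\<sigma>. b \<sigma> - a \<sigma>)" for b
  proof -
    define h where "h = (\<lambda>\<sigma>\<in>singular_simplex_set p X. b \<sigma> - a \<sigma>)"
    have "h \<in> coboundary_set p X"
      using b(2) by (auto simp: coboundary_set_eq h_def intro: is_coboundary_cong)
    moreover have "b = h \<otimes>\<^bsub>cocycle_group p X\<^esub> a"
      using b(1) by (auto simp: mult_cocycle_group h_def extensional_def fun_eq_iff)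
    ultimately show ?thesis unfolding cohomology_class_def r_coset_def by auto
  qed
  then show ?thesis
    by (auto simp: cohomology_class_def r_coset_def mult_cocycle_group coboundary_set_eq
        intro: is_coboundary_cong)
qed

lemma cohomology_class_eqI:
  assumes "is_coboundary p X (\<lambda>\<sigma>. a \<sigma> - b \<sigma>)"
  shows "cohomology_class p X a = cohomology_class p X b"
proof -
  have "is_coboundary p X (\<lambda>\<sigma>. c \<sigma> - b \<sigma>)" if "is_coboundary p X (\<lambda>\<sigma>. c \<sigma> - a \<sigma>)" for c
    using is_coboundary_add[OF that assms] by simp
  moreover have "is_coboundary p X (\<lambda>\<sigma>. c \<sigma> - a \<sigma>)" if "is_coboundary p X (\<lambda>\<sigma>. c \<sigma> - b \<sigma>)" for c
    using is_coboundary_diff[OF that assms] by simp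
  ultimately show ?thesis unfolding cohomology_class_eq by auto
qed

lemma restrict_in_cohomology_class:
  "restrict a (singular_simplex_set p X) \<in> cohomology_class p X a"
  by (auto simp: cohomology_class_eq intro: is_coboundary_zero)

lemma cohomology_class_eq_iff:
  "cohomology_class p X a = cohomology_class p X b \<longleftrightarrow> is_coboundary p X (\<lambda>\<sigma>. a \<sigma> - b \<sigma>)"
proof
  assume "cohomology_class p X a = cohomology_class p X b"
  then have "restrict a (singular_simplex_set p X) \<in> cohomology_class p X b"
    using restrict_in_cohomology_class by blast
  then show "is_coboundary p X (\<lambda>\<sigma>. a \<sigma> - b \<sigma>)"
    by (auto simp: cohomology_class_eq intro: is_coboundary_cong)
qed (rule cohomology_class_eqI)

lemma cohomology_class_restrict:
  "cohomology_class p X (restrict a (singular_simplex_set p X)) = cohomology_class p X a"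
  by (rule cohomology_class_eqI) (auto intro: is_coboundary_zero)

lemma carrier_cohomology_group:
  "carrier (cohomology_group p X) = {cohomology_class p X a | a. is_cocycle p X a}"
proof -
  have "carrier (cohomology_group p X) = cohomology_class p X ` carrier (cocycle_group p X)"
    unfolding cohomology_group_def carrier_FactGroup cohomology_class_def ..
  also have "\<dots> = {cohomology_class p X a | a. is_cocycle p X a}"
  proof -
    have "cohomology_class p X a \<in> cohomology_class p X ` carrier (cocycle_group p X)" if "is_cocycle p X a" for a
    proof
      show "restrict a (singular_simplex_set p X) \<in> carrier (cocycle_group p X)"
        using that by (auto simp: carrier_cocycle_group intro: is_cocycle_cong)
    qed (simp add: cohomology_class_restrict)
    then show ?thesis by (auto simp: carrier_cocycle_group)
  qed
  finally show ?thesis .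
qed

lemma cohomology_class_closed [intro]:
  "is_cocycle p X a \<Longrightarrow> cohomology_class p X a \<in> carrier (cohomology_group p X)"
  by (auto simp: carrier_cohomology_group)

lemma one_cohomology_group: "\<one>\<^bsub>cohomology_group p X\<^esub> = cohomology_class p X (\<lambda>_. 0)"
  by (simp add: cohomology_group_def cohomology_class_eq coboundary_set_eq)

lemma cohomology_class_eq_one_iff:
  "cohomology_class p X a = \<one>\<^bsub>cohomology_group p X\<^esub> \<longleftrightarrow> is_coboundary p X a"
  by (simp add: one_cohomology_group cohomology_class_eq_iff)

lemma mult_cohomology_group:
  assumes "is_cocycle p X a" "is_cocycle p X b"
  shows "cohomology_class p X a \<otimes>\<^bsub>cohomology_group p X\<^esub> cohomology_class p X b
    = cohomology_class p X (\<lambda>\<sigma>. a \<sigma> + b \<sigma>)"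
proof -
  let ?r = "\<lambda>a. restrict a (singular_simplex_set p X)"
  interpret normal "coboundary_set p X" "cocycle_group p X" by (rule normal_coboundary_set)
  have "?r c \<in> carrier (cocycle_group p X)" if "is_cocycle p X c" for c
    using that by (auto simp: carrier_cocycle_group intro: is_cocycle_cong)
  then have "cohomology_class p X (?r a) \<otimes>\<^bsub>cohomology_group p X\<^esub> cohomology_class p X (?r b)
      = cohomology_class p X (?r a \<otimes>\<^bsub>cocycle_group p X\<^esub> ?r b)"
    unfolding cohomology_group_def cohomology_class_def using assms by (simp add: rcos_sum)
  also have "\<dots> = cohomology_class p X (\<lambda>\<sigma>. a \<sigma> + b \<sigma>)"
    by (rule cohomology_class_eqI) (auto simp: mult_cocycle_group intro: is_coboundary_zero)
  finally show ?thesis by (simp add: cohomology_class_restrict)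
qed

lemma inv_cohomology_group:
  assumes "is_cocycle p X a"
  shows "inv\<^bsub>cohomology_group p X\<^esub> cohomology_class p X a = cohomology_class p X (\<lambda>\<sigma>. - a \<sigma>)"
proof -
  have b: "is_cocycle p X (\<lambda>\<sigma>. - a \<sigma>)" using is_cocycle_cmul[OF assms, of "-1"] by simp
  show ?thesis
    by (rule group.inv_equality[OF group_cohomology_group])
      (use assms b in \<open>auto simp: mult_cohomology_group one_cohomology_group\<close>)
qed

section \<open>Pullbacks\<close>

lemma simplical_face_in_Suc: "\<lbrakk>k \<le> Suc n; x \<in> standard_simplex n\<rbrakk> \<Longrightarrow> simplical_face k x \<in> standard_simplex (Suc n)"
  using simplical_face_in_standard_simplex[of "Suc n" k x] by simp

lemma delta_pullback:
  "delta p (\<lambda>\<sigma>. a (simplex_map p f \<sigma>)) \<sigma> = delta p a (simplex_map (Suc p) f \<sigma>)"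
  unfolding delta_def
  by (intro sum.cong refl) (simp add: singular_face_def simplex_map_def simplical_face_in_standard_simplex o_def simplical_face_in_Suc cong: restrict_cong)

lemma is_cocycle_pullback:
  assumes "continuous_map X Y f" "is_cocycle p Y a"
  shows "is_cocycle p X (\<lambda>\<sigma>. a (simplex_map p f \<sigma>))"
  using assms by (auto simp: is_cocycle_def delta_pullback singular_simplex_simplex_map)

lemma is_coboundary_pullback:
  assumes "continuous_map X Y f" "is_coboundary p Y a"
  shows "is_coboundary p X (\<lambda>\<sigma>. a (simplex_map p f \<sigma>))"
proof (cases p)
  case 0
  then show ?thesis using assms
    by (auto simp: is_coboundary_def singular_simplex_simplex_map)
next
  case (Suc q)
  then obtain b where b: "\<And>\<sigma>. singular_simplex p Y \<sigma> \<Longrightarrow> a \<sigma> = delta q b \<sigma>"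
    using assms by (auto simp: is_coboundary_Suc)
  show ?thesis unfolding Suc
    by (rule is_coboundaryI[where b="\<lambda>\<sigma>. b (simplex_map q f \<sigma>)"])
       (use assms(1) b Suc in \<open>simp add: delta_pullback singular_simplex_simplex_map\<close>)
qed

text \<open>The union over all representatives is a union of equal cosets, as pullbacks preserve coboundaries.\<close>

lemma cohomology_pullback_class:
  assumes "continuous_map X Y f"
  shows "cohomology_pullback p X f (cohomology_class p Y a)
    = cohomology_class p X (\<lambda>\<sigma>. a (simplex_map p f \<sigma>))"
proof -
  have eq: "cohomology_class p X (cochain_pullback p X f b) = cohomology_class p X (\<lambda>\<sigma>. a (simplex_map p f \<sigma>))"
    if "b \<in> cohomology_class p Y a" for b
    unfolding cochain_pullback_def cohomology_class_restrict
    using is_coboundary_pullback[OF assms, of p "\<lambda>\<sigma>. b \<sigma> - a \<sigma>"] that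
    by (intro cohomology_class_eqI) (simp add: cohomology_class_eq)
  show ?thesis
    unfolding cohomology_pullback_def using eq restrict_in_cohomology_class by blast
qed

section \<open>Cup products\<close>

text \<open>The cup product on total functions; it is truncated to the singular simplices only when a class is
formed.\<close>

definition raw_cup :: "nat \<Rightarrow> nat \<Rightarrow> 'a cochain \<Rightarrow> 'a cochain \<Rightarrow> 'a cochain" where
  "raw_cup p q a b \<sigma> = a (front_face p \<sigma>) * b (back_face p q \<sigma>)"

lemma cup_cochain_eq: "cup_cochain p q X a b = restrict (raw_cup p q a b) (singular_simplex_set (p + q) X)"
  by (simp add: cup_cochain_def raw_cup_def fun_eq_iff restrict_def)

lemma front_face_simplex:
  assumes "singular_simplex (p + q) X \<sigma>"
  shows "singular_simplex p X (front_face p \<sigma>)"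
proof -
  have "standard_simplex p \<subseteq> standard_simplex (p + q)" by (rule standard_simplex_mono) simp
  then have "continuous_map (subtopology (powertop_real UNIV) (standard_simplex p)) X \<sigma>"
    using assms unfolding singular_simplex_def by (meson continuous_map_from_subtopology_mono)
  then have "continuous_map (subtopology (powertop_real UNIV) (standard_simplex p)) X (front_face p \<sigma>)"
    unfolding front_face_def by (rule continuous_map_eq) auto
  then show ?thesis by (simp add: singular_simplex_def front_face_def)
qed

lemma shift_in_simplex:
  assumes "x \<in> standard_simplex q"
  shows "(\<lambda>i. if i < p then 0 else x (i - p)) \<in> standard_simplex (p + q)"
proof -
  have "(\<Sum>i\<le>p + q. if i < p then 0 else x (i - p)) = (\<Sum>i\<in>{p..p+q}. x (i - p))"
    by (rule sum.mono_neutral_cong_right) auto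
  also have "\<dots> = (\<Sum>i\<le>q. x i)"
    by (rule sum.reindex_bij_witness[where i="\<lambda>i. i + p" and j="\<lambda>i. i - p"]) auto
  finally show ?thesis using assms by (auto simp: standard_simplex_def)
qed

lemma back_face_simplex:
  assumes "singular_simplex (p + q) X \<sigma>"
  shows "singular_simplex q X (back_face p q \<sigma>)"
proof -
  let ?PT = "powertop_real UNIV"
  have "continuous_map (subtopology ?PT (standard_simplex q)) (subtopology ?PT (standard_simplex (p + q)))
          (\<lambda>x i. if i < p then 0 else x (i - p))"
    unfolding continuous_map_in_subtopology continuous_map_componentwise_UNIV
  proof (intro conjI allI)
    fix i
    show "continuous_map (subtopology ?PT (standard_simplex q)) euclideanreal (\<lambda>x. if i < p then 0 else x (i - p))"
      by (cases "i < p") (auto intro!: continuous_map_from_subtopology continuous_map_product_projection)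
  qed (use shift_in_simplex in auto)
  from continuous_map_compose[OF this] 
  have "continuous_map (subtopology ?PT (standard_simplex q)) X (back_face p q \<sigma>)"
    using assms unfolding singular_simplex_def back_face_def
    by (force intro: continuous_map_eq)
  then show ?thesis by (simp add: singular_simplex_def back_face_def)
qed

lemma raw_cup_cong:
  assumes "singular_simplex (p + q) X \<sigma>"
    and "\<And>\<sigma>. singular_simplex p X \<sigma> \<Longrightarrow> a \<sigma> = a' \<sigma>" "\<And>\<sigma>. singular_simplex q X \<sigma> \<Longrightarrow> b \<sigma> = b' \<sigma>"
  shows "raw_cup p q a b \<sigma> = raw_cup p q a' b' \<sigma>"
  unfolding raw_cup_def using assms front_face_simplex back_face_simplex by metis

lemma in_standard_simplex_mono: "\<lbrakk>x \<in> standard_simplex p; p \<le> q\<rbrakk> \<Longrightarrow> x \<in> standard_simplex q"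
  using standard_simplex_mono by blast

lemma front_face_lower:
  assumes "k \<le> p"
  shows "front_face p (singular_face (Suc (p + q)) k \<sigma>) = singular_face (Suc p) k (front_face (Suc p) \<sigma>)"
  using assms by (auto simp: front_face_def singular_face_def fun_eq_iff restrict_def simplical_face_in_Suc in_standard_simplex_mono)

lemma front_face_upper:
  assumes "p < k"
  shows "front_face p (singular_face (Suc (p + q)) k \<sigma>) = front_face p \<sigma>"
proof
  fix x :: "nat \<Rightarrow> real"
  have "simplical_face k x = x" if "x \<in> standard_simplex p"
    using that assms by (auto simp: simplical_face_def standard_simplex_def fun_eq_iff)
  then show "front_face p (singular_face (Suc (p + q)) k \<sigma>) x = front_face p \<sigma> x"
    by (auto simp: front_face_def singular_face_def restrict_def in_standard_simplex_mono)
qed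

lemma back_face_lower:
  assumes "k \<le> p"
  shows "back_face p q (singular_face (Suc (p + q)) k \<sigma>) = back_face (Suc p) q \<sigma>"
proof
  fix x :: "nat \<Rightarrow> real"
  have "simplical_face k (\<lambda>i. if i < p then 0 else x (i - p)) = (\<lambda>i. if i < Suc p then 0 else x (i - Suc p))"
    using assms by (auto simp: simplical_face_def fun_eq_iff)
  then show "back_face p q (singular_face (Suc (p + q)) k \<sigma>) x = back_face (Suc p) q \<sigma> x"
    by (auto simp: back_face_def singular_face_def restrict_def shift_in_simplex)
qed

lemma back_face_upper:
  assumes "k \<le> Suc q"
  shows "back_face p q (singular_face (Suc (p + q)) (p + k) \<sigma>) = singular_face (Suc q) k (back_face p (Suc q) \<sigma>)"
proof
  fix x :: "nat \<Rightarrow> real"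
  have "simplical_face (p + k) (\<lambda>i. if i < p then 0 else x (i - p)) =
     (\<lambda>i. if i < p then 0 else simplical_face k x (i - p))"
    by (auto simp: simplical_face_def fun_eq_iff)
  then show "back_face p q (singular_face (Suc (p + q)) (p + k) \<sigma>) x
      = singular_face (Suc q) k (back_face p (Suc q) \<sigma>) x"
    using assms by (auto simp: back_face_def singular_face_def restrict_def shift_in_simplex simplical_face_in_Suc)
qed

lemma front_face_last: "singular_face (Suc p) (Suc p) (front_face (Suc p) \<sigma>) = front_face p \<sigma>"
proof
  fix x :: "nat \<Rightarrow> real"
  have "simplical_face (Suc p) x = x" if "x \<in> standard_simplex p"
    using that by (auto simp: simplical_face_def standard_simplex_def fun_eq_iff)
  then show "singular_face (Suc p) (Suc p) (front_face (Suc p) \<sigma>) x = front_face p \<sigma> x"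
    by (auto simp: front_face_def singular_face_def restrict_def in_standard_simplex_mono)
qed

lemma back_face_first: "singular_face (Suc q) 0 (back_face p (Suc q) \<sigma>) = back_face (Suc p) q \<sigma>"
  using back_face_upper[of 0 q p \<sigma>] back_face_lower[of p p q \<sigma>] by simp

text \<open>The Leibniz rule. The faces of a simplex fall into those of its front part and those of its back part;
the two sums on the right each have one more term, for the face between the two parts, and these terms
cancel.\<close>

lemma delta_raw_cup:
  "delta (p + q) (raw_cup p q a b) \<sigma> = raw_cup (Suc p) q (delta p a) b \<sigma> + (-1) ^ p * raw_cup p (Suc q) a (delta q b) \<sigma>"
proof -
  let ?t = "\<lambda>k. (-1) ^ k * (a (front_face p (singular_face (Suc (p + q)) k \<sigma>)) *
      b (back_face p q (singular_face (Suc (p + q)) k \<sigma>)))"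
  let ?A = "\<lambda>k. a (singular_face (Suc p) k (front_face (Suc p) \<sigma>))"
  let ?B = "\<lambda>k. b (singular_face (Suc q) k (back_face p (Suc q) \<sigma>))"
  let ?a = "a (front_face p \<sigma>)" and ?b = "b (back_face (Suc p) q \<sigma>)"
  have "delta (p + q) (raw_cup p q a b) \<sigma> = sum ?t {..Suc (p + q)}"
    by (simp add: delta_def raw_cup_def)
  also have "{..Suc (p + q)} = {..p} \<union> {Suc p..Suc (p + q)}" by auto
  also have "sum ?t \<dots> = sum ?t {..p} + sum ?t {Suc p..Suc (p + q)}"
    by (rule sum.union_disjoint) auto
  also have "sum ?t {..p} = (\<Sum>k\<le>p. (-1) ^ k * ?A k) * ?b"
    by (simp add: sum_distrib_right front_face_lower back_face_lower mult.assoc)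
  also have "\<dots> = (delta p a (front_face (Suc p) \<sigma>) - (-1) ^ Suc p * ?a) * ?b"
    by (simp add: delta_def front_face_last)
  also have "sum ?t {Suc p..Suc (p + q)} = (\<Sum>k\<in>{1..Suc q}. ?t (p + k))"
    by (rule sum.reindex_bij_witness[where i="\<lambda>i. p + i" and j="\<lambda>i. i - p"]) auto
  also have "\<dots> = (\<Sum>k\<in>{1..Suc q}. (-1) ^ p * ?a * ((-1) ^ k * ?B k))"
    by (intro sum.cong refl) (simp add: front_face_upper back_face_upper power_add)
  also have "\<dots> = (-1) ^ p * ?a * (\<Sum>k\<in>{1..Suc q}. (-1) ^ k * ?B k)"
    by (simp only: sum_distrib_left)
  also have "(\<Sum>k\<in>{1..Suc q}. (-1) ^ k * ?B k) = delta q b (back_face p (Suc q) \<sigma>) - ?b"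
  proof -
    have "{..Suc q} = insert 0 {1..Suc q}" by auto
    then show ?thesis unfolding delta_def by (simp add: back_face_first del: sum.atMost_Suc sum.cl_ivl_Suc)
  qed
  finally show ?thesis
    unfolding raw_cup_def[of "Suc p"] raw_cup_def[of p "Suc q"] by (simp add: algebra_simps)
qed

text \<open>Associativity holds for cochains, not only up to coboundaries, since both sides multiply the values on
the same three consecutive faces.\<close>

lemma raw_cup_assoc:
  "raw_cup p (q + r) a (raw_cup q r b c) \<sigma> = raw_cup (p + q) r (raw_cup p q a b) c \<sigma>"
proof -
  have 1: "front_face p (front_face (p + q) \<sigma>) = front_face p \<sigma>"
    by (auto simp: front_face_def fun_eq_iff restrict_def in_standard_simplex_mono)
  have 2: "back_face p q (front_face (p + q) \<sigma>) = front_face q (back_face p (q + r) \<sigma>)"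
    by (auto simp: front_face_def back_face_def fun_eq_iff restrict_def in_standard_simplex_mono shift_in_simplex)
  have 3: "back_face q r (back_face p (q + r) \<sigma>) = back_face (p + q) r \<sigma>"
  proof
    fix x :: "nat \<Rightarrow> real"
    have "(\<lambda>i. if i < p then 0 else if i - p < q then 0 else x (i - p - q)) = (\<lambda>i. if i < p + q then 0 else x (i - (p + q)))"
      by (auto simp: fun_eq_iff)
    then show "back_face q r (back_face p (q + r) \<sigma>) x = back_face (p + q) r \<sigma> x"
      by (auto simp: back_face_def restrict_def shift_in_simplex)
  qed
  show ?thesis unfolding raw_cup_def 1 2 3 by (simp add: mult.assoc)
qed

lemma raw_cup_simplex_map:
  "raw_cup p q a b (simplex_map (p + q) f \<sigma>) = raw_cup p q (\<lambda>\<tau>. a (simplex_map p f \<tau>)) (\<lambda>\<tau>. b (simplex_map q f \<tau>)) \<sigma>"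
proof -
  have 1: "front_face p (simplex_map (p + q) f \<sigma>) = simplex_map p f (front_face p \<sigma>)"
    by (auto simp: front_face_def simplex_map_def fun_eq_iff restrict_def in_standard_simplex_mono)
  have 2: "back_face p q (simplex_map (p + q) f \<sigma>) = simplex_map q f (back_face p q \<sigma>)"
    by (auto simp: back_face_def simplex_map_def fun_eq_iff restrict_def shift_in_simplex)
  show ?thesis unfolding raw_cup_def 1 2 ..
qed

lemma is_cocycle_raw_cup:
  assumes a: "is_cocycle p X a" and b: "is_cocycle q X b"
  shows "is_cocycle (p + q) X (raw_cup p q a b)"
  unfolding is_cocycle_def
proof (intro allI impI)
  fix \<sigma> assume s: "singular_simplex (Suc (p + q)) X \<sigma>"
  have "delta p a (front_face (Suc p) \<sigma>) = 0" "delta q b (back_face p (Suc q) \<sigma>) = 0"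
    using a b front_face_simplex[of "Suc p" q X \<sigma>] back_face_simplex[of p "Suc q" X \<sigma>] s
    by (auto simp: is_cocycle_def)
  then show "delta (p + q) (raw_cup p q a b) \<sigma> = 0" by (simp add: delta_raw_cup) (simp add: raw_cup_def)
qed

lemma is_coboundary_raw_cup_left:
  assumes a: "is_coboundary p X a" and b: "is_cocycle q X b"
  shows "is_coboundary (p + q) X (raw_cup p q a b)"
proof (cases p)
  case 0
  then show ?thesis using a front_face_simplex[of p q X]
    by (intro is_coboundary_zero) (simp add: is_coboundary_def raw_cup_def)
next
  case (Suc r)
  then obtain h where h: "\<And>\<sigma>. singular_simplex p X \<sigma> \<Longrightarrow> a \<sigma> = delta r h \<sigma>"
    using a by (auto simp: is_coboundary_Suc)
  have "raw_cup p q a b \<sigma> = delta (r + q) (raw_cup r q h b) \<sigma>" if s: "singular_simplex (Suc (r + q)) X \<sigma>" for \<sigma>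
  proof -
    have "delta q b (back_face r (Suc q) \<sigma>) = 0"
      using b back_face_simplex[of r "Suc q" X \<sigma>] s by (simp add: is_cocycle_def)
    moreover have "a (front_face p \<sigma>) = delta r h (front_face p \<sigma>)"
      using h front_face_simplex[of p q X \<sigma>] s Suc by simp
    ultimately show ?thesis using Suc by (simp add: delta_raw_cup) (simp add: raw_cup_def)
  qed
  then have "is_coboundary (Suc (r + q)) X (raw_cup p q a b)" by (rule is_coboundaryI)
  then show ?thesis using Suc by simp
qed

lemma is_coboundary_raw_cup_right:
  assumes a: "is_cocycle p X a" and b: "is_coboundary q X b"
  shows "is_coboundary (p + q) X (raw_cup p q a b)"
proof (cases q)
  case 0
  then show ?thesis using b back_face_simplex[of p q X]
    by (intro is_coboundary_zero) (simp add: is_coboundary_def raw_cup_def)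
next
  case (Suc r)
  then obtain h where h: "\<And>\<sigma>. singular_simplex q X \<sigma> \<Longrightarrow> b \<sigma> = delta r h \<sigma>"
    using b by (auto simp: is_coboundary_Suc)
  have "raw_cup p q a b \<sigma> = delta (p + r) (\<lambda>\<tau>. (-1) ^ p * raw_cup p r a h \<tau>) \<sigma>"
    if s: "singular_simplex (Suc (p + r)) X \<sigma>" for \<sigma>
  proof -
    have "delta p a (front_face (Suc p) \<sigma>) = 0"
      using a front_face_simplex[of "Suc p" r X \<sigma>] s by (simp add: is_cocycle_def)
    moreover have "b (back_face p q \<sigma>) = delta r h (back_face p q \<sigma>)"
      using h back_face_simplex[of p q X \<sigma>] s Suc by simp
    ultimately show ?thesis using Suc
      by (simp add: delta_cmul delta_raw_cup) (simp add: raw_cup_def flip: mult.assoc power_add)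
  qed
  then have "is_coboundary (Suc (p + r)) X (raw_cup p q a b)" by (rule is_coboundaryI)
  then show ?thesis using Suc by simp
qed

lemma is_coboundary_raw_cup_cong:
  assumes "is_cocycle p X a" "is_cocycle q X b'"
    and "is_coboundary p X (\<lambda>\<sigma>. a \<sigma> - a' \<sigma>)" "is_coboundary q X (\<lambda>\<sigma>. b \<sigma> - b' \<sigma>)"
  shows "is_coboundary (p + q) X (\<lambda>\<sigma>. raw_cup p q a b \<sigma> - raw_cup p q a' b' \<sigma>)"
  using is_coboundary_add[OF is_coboundary_raw_cup_right[OF assms(1,4)] is_coboundary_raw_cup_left[OF assms(3,2)]]
  by (simp add: raw_cup_def algebra_simps)

text \<open>As for pullbacks, the union over representatives is a union of equal cosets, by the Leibniz rule.\<close>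

lemma cup_class:
  assumes a: "is_cocycle p X a" and b: "is_cocycle q X b"
  shows "cup p q X (cohomology_class p X a) (cohomology_class q X b) = cohomology_class (p + q) X (raw_cup p q a b)"
proof -
  have eq: "cohomology_class (p + q) X (cup_cochain p q X a' b') = cohomology_class (p + q) X (raw_cup p q a b)"
    if a': "a' \<in> cohomology_class p X a" and b': "b' \<in> cohomology_class q X b" for a' b'
  proof -
    have 1: "is_coboundary p X (\<lambda>\<sigma>. a' \<sigma> - a \<sigma>)" using a' by (simp add: cohomology_class_eq)
    have 2: "is_coboundary q X (\<lambda>\<sigma>. b' \<sigma> - b \<sigma>)" using b' by (simp add: cohomology_class_eq)
    have "is_cocycle p X a'" using is_cocycle_add[OF is_coboundary_imp_cocycle[OF 1] a] by simp
    then show ?thesis unfolding cup_cochain_eq cohomology_class_restrict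
      by (intro cohomology_class_eqI is_coboundary_raw_cup_cong 1 2 b)
  qed
  have "cup p q X (cohomology_class p X a) (cohomology_class q X b)
      = (\<Union>a'\<in>cohomology_class p X a. \<Union>b'\<in>cohomology_class q X b. cohomology_class (p + q) X (raw_cup p q a b))"
    unfolding cup_def by (intro SUP_cong refl eq)
  also have "\<dots> = cohomology_class (p + q) X (raw_cup p q a b)"
    using restrict_in_cohomology_class[of a p X] restrict_in_cohomology_class[of b q X] by blast
  finally show ?thesis .
qed

text \<open>The cochain of an iterated product, nested to the right like \<^const>\<open>wedge\<close>.\<close>

primrec cup_list :: "'a cochain list \<Rightarrow> 'a cochain" where
  "cup_list [] = (\<lambda>_. 1)"
| "cup_list (a # as) = raw_cup 1 (length as) a (cup_list as)"

lemma is_cocycle_one: "is_cocycle 0 X (\<lambda>_. 1)"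
  by (simp add: is_cocycle_def delta_def)

lemma is_cocycle_cup_list:
  "(\<And>a. a \<in> set as \<Longrightarrow> is_cocycle 1 X a) \<Longrightarrow> is_cocycle (length as) X (cup_list as)"
proof (induction as)
  case (Cons a as)
  then show ?case using is_cocycle_raw_cup[of 1 X a "length as" "cup_list as"] by simp
qed (simp add: is_cocycle_one)

lemma wedge_classes:
  "(\<And>a. a \<in> set as \<Longrightarrow> is_cocycle 1 X a) \<Longrightarrow>
    wedge X (map (cohomology_class 1 X) as) = cohomology_class (length as) X (cup_list as)"
proof (induction as)
  case Nil
  then show ?case by (simp add: cohomology_unit_def cohomology_class_restrict)
next
  case (Cons a as)
  then show ?case using cup_class[of 1 X a "length as" "cup_list as"] is_cocycle_cup_list[of as X] by simp
qed

lemma cup_list_simplex_map: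
  "cup_list as (simplex_map (length as) f \<sigma>) = cup_list (map (\<lambda>a \<tau>. a (simplex_map 1 f \<tau>)) as) \<sigma>"
proof (induction as arbitrary: \<sigma>)
  case (Cons a as)
  then show ?case using raw_cup_simplex_map[of 1 "length as" a "cup_list as" f \<sigma>] by simp
qed simp

lemma delta_1: "delta 1 a \<sigma> = a (singular_face 2 0 \<sigma>) - a (singular_face 2 1 \<sigma>) + a (singular_face 2 2 \<sigma>)"
  by (simp add: delta_def numeral_2_eq_2)

lemma delta_0: "delta 0 a \<sigma> = a (singular_face 1 0 \<sigma>) - a (singular_face 1 1 \<sigma>)"
  by (simp add: delta_def)

lemma raw_cup_1_1: "raw_cup 1 1 a b \<sigma> = a (singular_face 2 2 \<sigma>) * b (singular_face 2 0 \<sigma>)"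
proof -
  have f: "front_face 1 \<sigma> = singular_face 2 2 \<sigma>"
  proof
    fix x :: "nat \<Rightarrow> real"
    have "simplical_face 2 x = x" if "x \<in> standard_simplex 1"
      using that by (auto simp: simplical_face_def standard_simplex_def fun_eq_iff)
    then show "front_face 1 \<sigma> x = singular_face 2 2 \<sigma> x"
      by (simp add: front_face_def singular_face_def restrict_def)
  qed
  have b: "back_face 1 1 \<sigma> = singular_face 2 0 \<sigma>"
  proof
    fix x :: "nat \<Rightarrow> real"
    have "(\<lambda>i. if i < 1 then 0 else x (i - 1)) = simplical_face 0 x"
      by (auto simp: simplical_face_def fun_eq_iff)
    then show "back_face 1 1 \<sigma> x = singular_face 2 0 \<sigma> x"
      unfolding back_face_def singular_face_def restrict_def by simp
  qed
  show ?thesis unfolding raw_cup_def f b ..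
qed

text \<open>A cocycle is additive along the edges of a triangle, and the product of the values on two of
them is the failure of the binomial coefficient \<open>k choose 2\<close> to be additive. So minus this coefficient, which is an integer, is a primitive
of the square.\<close>

lemma is_coboundary_cup_self:
  assumes "is_cocycle 1 X a"
  shows "is_coboundary 2 X (raw_cup 1 1 a a)"
proof -
  have "raw_cup 1 1 a a \<sigma> = delta 1 (\<lambda>\<tau>. - (a \<tau> * (a \<tau> - 1) div 2)) \<sigma>" if s: "singular_simplex (Suc 1) X \<sigma>" for \<sigma>
  proof -
    define m n where "m = a (singular_face 2 2 \<sigma>)" and "n = a (singular_face 2 0 \<sigma>)"
    have "delta 1 a \<sigma> = 0" using assms s unfolding is_cocycle_def by blast
    then have e: "a (singular_face 2 1 \<sigma>) = m + n" unfolding delta_1 m_def n_def by linarith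
    (* Doubling removes the integer division. *)
    have even: "2 * (k * (k - 1) div 2) = k * (k - 1)" for k :: int by simp
    have "2 * (m * n) = (m + n) * (m + n - 1) - m * (m - 1) - n * (n - 1)"
      by (simp add: algebra_simps)
    also have "\<dots> = 2 * ((m + n) * (m + n - 1) div 2) - 2 * (m * (m - 1) div 2) - 2 * (n * (n - 1) div 2)"
      unfolding even ..
    finally have "m * n = (m + n) * (m + n - 1) div 2 - m * (m - 1) div 2 - n * (n - 1) div 2" by linarith
    then show ?thesis unfolding delta_1 raw_cup_1_1 e by (simp add: m_def n_def)
  qed
  from is_coboundaryI[OF this] show ?thesis by (simp add: numeral_2_eq_2)
qed

section \<open>Cocycles vanishing on small simplices\<close>

lemma singular_chain_sd_power:
  "singular_chain p X c \<Longrightarrow> singular_chain p X ((singular_subdivision p ^^ n) c)"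
  by (induction n) (simp_all add: singular_chain_singular_subdivision)

lemma boundary_sd_power:
  assumes "singular_chain p X c"
  shows "chain_boundary p ((singular_subdivision p ^^ n) c)
    = (singular_subdivision (p - Suc 0) ^^ n) (chain_boundary p c)"
proof (induction n)
  case (Suc n)
  then show ?case
    using chain_boundary_singular_subdivision[OF singular_chain_sd_power[OF assms]] by simp
qed simp

text \<open>Let \<open>h\<close> be the chain homotopy from the identity to barycentric subdivision \<open>sd\<close>. For each \<open>i\<close>
the homotopy \<open>h \<circ> sd\<^sup>i\<close> connects \<open>sd\<^sup>i\<close> with \<open>sd\<^sup>i\<^sup>+\<^sup>1\<close>, so a telescoping sum of the
cochains \<open>w \<circ> h \<circ> sd\<^sup>i\<close> over all \<open>i\<close> is, up to sign, a primitive of \<open>w\<close>. The sum has only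
finitely many nonzero terms on each simplex: once the pieces of \<open>sd\<^sup>i\<close> are small, so are the pieces
produced by \<open>h\<close>, because \<open>h\<close> does not leave the subspace in which a chain lies.\<close>

lemma is_coboundary_if_vanishes_on_small:
  assumes w: "is_cocycle (Suc q) X w"
    and open_cover: "\<And>V. V \<in> \<C> \<Longrightarrow> openin X V" "topspace X \<subseteq> \<Union>\<C>"
    and small: "\<And>V \<sigma>. V \<in> \<C> \<Longrightarrow> singular_simplex (Suc q) (subtopology X V) \<sigma> \<Longrightarrow> w \<sigma> = 0"
  shows "is_coboundary (Suc q) X w"
proof -
  obtain h :: "nat \<Rightarrow> 'a chain \<Rightarrow> 'a chain" where h0: "\<And>p. h p 0 = 0"
    and hdiff: "\<And>p c1 c2. h p (c1 - c2) = h p c1 - h p c2"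
    and hchain: "\<And>p X c. singular_chain p X c \<Longrightarrow> singular_chain (Suc p) X (h p c)"
    and hbound: "\<And>p X c. singular_chain p X c \<Longrightarrow>
      chain_boundary (Suc p) (h p c) + h (p - Suc 0) (chain_boundary p c) = singular_subdivision p c - c"
    using chain_homotopic_singular_subdivision by blast
  define t where "t i c = cochain_eval w (h q ((singular_subdivision q ^^ i) c))" for i c
  have tdiff: "t i (c - d) = t i c - t i d" for i c d
    by (simp add: t_def singular_subdivision_power_diff hdiff cochain_eval_diff)
  have t0: "t i 0 = 0" for i by (simp add: t_def h0)
  have small_h: "cochain_eval w (h q c) = 0"
    if "Poly_Mapping.keys c \<subseteq> {f. \<exists>V\<in>\<C>. singular_simplex q (subtopology X V) f}" for c
    using that
  proof (induction c rule: frag_induction)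
    case (one f)
    then obtain V where V: "V \<in> \<C>" "singular_simplex q (subtopology X V) f" by auto
    then have "singular_chain (Suc q) (subtopology X V) (h q (frag_of f))"
      by (intro hchain) (simp add: singular_chain_of)
    then show ?case using small[OF V(1)] by (intro cochain_eval_eq_0) (auto simp: singular_chain_def)
  qed (simp_all add: h0 hdiff cochain_eval_diff)
  have keys_small: "\<exists>n. \<forall>m\<ge>n. Poly_Mapping.keys ((singular_subdivision p ^^ m) c)
      \<subseteq> {f. \<exists>V\<in>\<C>. singular_simplex p (subtopology X V) f}"
    if c: "singular_chain p X c" for p c
  proof -
    obtain n where n: "\<And>m f. \<lbrakk>n \<le> m; f \<in> Poly_Mapping.keys ((singular_subdivision p ^^ m) c)\<rbrakk>
        \<Longrightarrow> \<exists>V \<in> \<C>. f \<in> standard_simplex p \<rightarrow> V"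
      using sufficient_iterated_singular_subdivision_exists[OF open_cover c] by blast
    have "\<exists>V\<in>\<C>. singular_simplex p (subtopology X V) f"
      if m: "m \<ge> n" and f: "f \<in> Poly_Mapping.keys ((singular_subdivision p ^^ m) c)" for m f
    proof -
      have "singular_simplex p X f"
        using singular_chain_sd_power[OF c, of m] f unfolding singular_chain_def by blast
      moreover obtain V where "V \<in> \<C>" "f \<in> standard_simplex p \<rightarrow> V" using n[OF m f] by blast
      ultimately show ?thesis unfolding singular_simplex_subtopology by blast
    qed
    then show ?thesis by blast
  qed
  (* The sum over all \<open>i\<close>, made a finite sum by its support; on each simplex it agrees with
     every sufficiently long partial sum. *)
  define b where "b \<sigma> = - (\<Sum>i | t i (frag_of \<sigma>) \<noteq> 0. t i (frag_of \<sigma>))" for \<sigma>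
  have b: "\<exists>n. \<forall>N\<ge>n. cochain_eval b c = - (\<Sum>i<N. t i c)" if "singular_chain q X c" for c
    using that unfolding singular_chain_def
  proof (induction c rule: frag_induction)
    case (one f)
    then obtain n where n: "\<And>m. m \<ge> n \<Longrightarrow> Poly_Mapping.keys ((singular_subdivision q ^^ m) (frag_of f))
      \<subseteq> {f. \<exists>V\<in>\<C>. singular_simplex q (subtopology X V) f}"
      using keys_small[of q "frag_of f"] by (auto simp: singular_chain_of)
    have "cochain_eval b (frag_of f) = - (\<Sum>i<N. t i (frag_of f))" if N: "N \<ge> n" for N
    proof -
      have "t i (frag_of f) = 0" if "i \<notin> {..<N}" for i
        unfolding t_def using n[of i] that N by (intro small_h) auto
      then have "(\<Sum>i | t i (frag_of f) \<noteq> 0. t i (frag_of f)) = (\<Sum>i<N. t i (frag_of f))"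
        by (intro sum.mono_neutral_left) auto
      then show ?thesis by (simp add: b_def)
    qed
    then show ?case by blast
  next
    case (diff c d)
    then obtain m n where mn: "\<And>N. N \<ge> m \<Longrightarrow> cochain_eval b c = - (\<Sum>i<N. t i c)"
      "\<And>N. N \<ge> n \<Longrightarrow> cochain_eval b d = - (\<Sum>i<N. t i d)" by blast
    have "cochain_eval b (c - d) = - (\<Sum>i<N. t i (c - d))" if "N \<ge> max m n" for N
      using mn(1)[of N] mn(2)[of N] that by (simp add: cochain_eval_diff tdiff sum_subtractf)
    then show ?case by blast
  qed (simp add: t0)
  show ?thesis
  proof (rule is_coboundaryI[where b=b])
    fix \<tau> assume \<tau>: "singular_simplex (Suc q) X \<tau>"
    then have c: "singular_chain (Suc q) X (frag_of \<tau>)" by (simp add: singular_chain_of)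
    let ?sd = "\<lambda>i. (singular_subdivision (Suc q) ^^ i) (frag_of \<tau>)"
    have sd: "singular_chain (Suc q) X (?sd i)" for i by (rule singular_chain_sd_power[OF c])
    have step: "t i (chain_boundary (Suc q) (frag_of \<tau>)) = cochain_eval w (?sd (Suc i)) - cochain_eval w (?sd i)" for i
    proof -
      have "chain_boundary (Suc (Suc q)) (h (Suc q) (?sd i)) + h q (chain_boundary (Suc q) (?sd i))
          = ?sd (Suc i) - ?sd i"
        using hbound[OF sd[of i]] by simp
      from arg_cong[OF this, of "cochain_eval w"]
      have "cochain_eval w (h q (chain_boundary (Suc q) (?sd i))) = cochain_eval w (?sd (Suc i) - ?sd i)"
        unfolding cochain_eval_add using is_cocycle_boundary[OF w hchain[OF sd[of i]]] by linarith
      then show ?thesis using boundary_sd_power[OF c, of i] by (simp add: t_def cochain_eval_diff)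
    qed
    obtain n where n: "\<And>m. m \<ge> n \<Longrightarrow> Poly_Mapping.keys (?sd m)
      \<subseteq> {f. \<exists>V\<in>\<C>. singular_simplex (Suc q) (subtopology X V) f}"
      using keys_small[OF c] by blast
    obtain m where m: "\<And>N. N \<ge> m \<Longrightarrow>
        cochain_eval b (chain_boundary (Suc q) (frag_of \<tau>)) = - (\<Sum>i<N. t i (chain_boundary (Suc q) (frag_of \<tau>)))"
      using b[OF singular_chain_boundary_alt[OF c]] by blast
    define N where "N = max m n"
    have "delta q b \<tau> = - (\<Sum>i<N. t i (chain_boundary (Suc q) (frag_of \<tau>)))"
      using m[of N] by (simp add: eval_boundary_of N_def)
    also have "\<dots> = cochain_eval w (?sd 0) - cochain_eval w (?sd N)"
      unfolding step using sum_lessThan_telescope[of "\<lambda>i. cochain_eval w (?sd i)" N] by linarith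
    also have "cochain_eval w (?sd N) = 0"
      using n[of N] small by (intro cochain_eval_eq_0) (force simp: N_def)
    finally show "w \<tau> = delta q b \<tau>" by simp
  qed
qed

section \<open>The winding cocycle of the circle\<close>

(* Edges are 1-simplices; keeping the numeral avoids mixing it with its successor form. *)
declare One_nat_def [simp del]

definition turn :: "real \<Rightarrow> complex" where "turn x = cis (2 * pi * x)"

lemma turn_add: "turn (x + y) = turn x * turn y"
  by (simp add: turn_def cis_mult ring_distribs)

lemma turn_diff: "turn (x - y) = turn x / turn y"
  by (simp add: turn_def cis_divide ring_distribs)

lemma turn_of_int [simp]: "turn (of_int n) = 1"
  by (simp add: turn_def)

lemma turn_0 [simp]: "turn 0 = 1" and turn_1 [simp]: "turn 1 = 1"
  using turn_of_int[of 0] turn_of_int[of 1] by simp_all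

lemma norm_turn [simp]: "norm (turn x) = 1"
  by (simp add: turn_def)

lemma turn_nonzero [simp]: "turn x \<noteq> 0"
  by (simp add: turn_def)

lemma turn_eq_iff: "turn x = turn y \<longleftrightarrow> (\<exists>n. x = y + of_int n)"
proof
  assume "turn x = turn y"
  then have "turn (x - y) = 1" by (simp add: turn_diff)
  then have "sin (2 * pi * (x - y)) = 0 \<and> cos (2 * pi * (x - y)) = 1"
    by (simp add: turn_def complex_eq_iff)
  then obtain n :: int where "2 * pi * (x - y) = of_int n * 2 * pi"
    using cos_one_2pi_int by blast
  then have "2 * pi * (x - y) = 2 * pi * of_int n" by simp
  then have "x - y = of_int n" by simp
  then show "\<exists>n. x = y + of_int n" by (intro exI[of _ n]) simp
qed (auto simp: turn_add)

lemma exists_turn: "norm z = 1 \<Longrightarrow> \<exists>x. turn x = z"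
  using cis_Arg[of z] by (intro exI[of _ "Arg z / (2 * pi)"]) (force simp: turn_def sgn_eq)

lemma continuous_on_turn [continuous_intros]: "continuous_on S f \<Longrightarrow> continuous_on S (\<lambda>x. turn (f x))"
  unfolding turn_def cis_conv_exp by (intro continuous_intros)

text \<open>A continuous logarithm exists on contractible sets; the modulus is constantly \<open>1\<close>, so only its
imaginary part matters.\<close>

lemma continuous_lift:
  fixes f :: "'a::real_normed_vector \<Rightarrow> complex"
  assumes "convex S" "continuous_on S f" "\<And>x. x \<in> S \<Longrightarrow> norm (f x) = 1"
  obtains L where "continuous_on S L" "\<And>x. x \<in> S \<Longrightarrow> f x = turn (L x)"
proof -
  have "\<And>x. x \<in> S \<Longrightarrow> f x \<noteq> 0" using assms(3) by force
  then obtain g where g: "continuous_on S g" "\<And>x. x \<in> S \<Longrightarrow> f x = exp (g x)"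
    using continuous_logarithm_on_contractible[OF assms(2) convex_imp_contractible[OF assms(1)]] by blast
  have "f x = turn (Im (g x) / (2 * pi))" if "x \<in> S" for x
  proof -
    have "exp (Re (g x)) = 1" using assms(3)[OF that] g(2)[OF that] by simp
    then show ?thesis using g(2)[OF that] by (simp add: turn_def exp_eq_polar)
  qed
  moreover have "continuous_on S (\<lambda>x. Im (g x) / (2 * pi))"
    using g(1) by (intro continuous_intros) auto
  ultimately show ?thesis using that by blast
qed

definition edge_pt :: "real \<Rightarrow> nat \<Rightarrow> real" where
  "edge_pt t = (\<lambda>i. if i = 0 then 1 - t else if i = 1 then t else 0)"

lemma sum_atMost_1: "(\<Sum>i\<le>1. f i) = f 0 + f (1::nat)"
  by (simp add: One_nat_def)

lemma edge_pt_in [simp]: "t \<in> {0..1} \<Longrightarrow> edge_pt t \<in> standard_simplex 1"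
  by (auto simp: edge_pt_def standard_simplex_def sum_atMost_1)

lemma edge_pt_cover: "x \<in> standard_simplex 1 \<Longrightarrow> x 1 \<in> {0..1} \<and> x = edge_pt (x 1)"
  by (auto simp: edge_pt_def standard_simplex_def fun_eq_iff sum_atMost_1 algebra_simps)

lemma continuous_map_edge_pt:
  "continuous_map (top_of_set {0..1}) (subtopology (powertop_real UNIV) (standard_simplex 1)) edge_pt"
  unfolding continuous_map_in_subtopology continuous_map_componentwise_UNIV
proof (intro conjI allI)
  fix i
  show "continuous_map (top_of_set {0..1}) euclideanreal (\<lambda>t. edge_pt t i)"
    by (cases "i = 0"; cases "i = 1") (auto simp: edge_pt_def intro!: continuous_intros)
qed auto

definition is_lift :: "((nat \<Rightarrow> real) \<Rightarrow> complex) \<Rightarrow> (real \<Rightarrow> real) \<Rightarrow> bool" where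
  "is_lift \<sigma> L \<longleftrightarrow> continuous_on {0..1} L \<and> (\<forall>t\<in>{0..1}. \<sigma> (edge_pt t) = turn (L t))"

text \<open>Rounding down a lift to the line makes the cochain integer-valued: it counts, with signs, how often the
path passes through the point \<open>1\<close> of the circle. It is the coboundary of the rounding function on the
line, which does not descend to the circle.\<close>

definition wind :: "complex cochain" where
  "wind \<sigma> = (let L = SOME L. is_lift \<sigma> L in \<lfloor>L 1\<rfloor> - \<lfloor>L 0\<rfloor>)"

lemma is_lift_exists:
  assumes "singular_simplex 1 circle \<sigma>"
  obtains L where "is_lift \<sigma> L"
proof -
  have "continuous_map (top_of_set {0..1}) circle (\<sigma> \<circ> edge_pt)"
    using continuous_map_compose[OF continuous_map_edge_pt] assms unfolding singular_simplex_def by blast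
  then have "continuous_on {0..1} (\<sigma> \<circ> edge_pt)" "\<sigma> \<circ> edge_pt \<in> {0..1} \<rightarrow> sphere 0 1"
    by (auto simp: circle_def)
  then obtain L where L: "continuous_on {0..1} L" "\<And>x. x \<in> {0..1} \<Longrightarrow> (\<sigma> \<circ> edge_pt) x = turn (L x)"
    using continuous_lift[of "{0..1}" "\<sigma> \<circ> edge_pt"] by (auto simp: Pi_iff)
  have "is_lift \<sigma> L" unfolding is_lift_def using L unfolding o_apply by blast
  then show ?thesis by (rule that)
qed

text \<open>Two lifts differ by an integer that is constant by continuity, and rounding down commutes with adding
an integer.\<close>

lemma is_lift_unique:
  assumes "is_lift \<sigma> L" "is_lift \<sigma> M"
  shows "\<lfloor>L 1\<rfloor> - \<lfloor>L 0\<rfloor> = \<lfloor>M 1\<rfloor> - \<lfloor>M 0\<rfloor>"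
proof -
  have int: "\<exists>n. L t = M t + of_int n" if "t \<in> {0..1}" for t
    using assms that by (metis is_lift_def turn_eq_iff)
  have "(\<lambda>t. L t - M t) constant_on {0..1}"
  proof (rule continuous_discrete_range_constant)
    show "continuous_on {0..1} (\<lambda>t. L t - M t)" using assms by (auto simp: is_lift_def intro: continuous_on_diff)
    fix x :: real assume x: "x \<in> {0..1}"
    have "1 \<le> norm (L y - M y - (L x - M x))" if y: "y \<in> {0..1}" and ne: "L y - M y \<noteq> L x - M x" for y
    proof -
      obtain m n where mn: "L y = M y + of_int m" "L x = M x + of_int n" using int x y by blast
      then have "m \<noteq> n" using ne by auto
      then have "(1::real) \<le> \<bar>of_int (m - n)\<bar>" by linarith
      then show ?thesis using mn by simp
    qed
    then show "\<exists>e>0. \<forall>y. y \<in> {0..1} \<and> L y - M y \<noteq> L x - M x \<longrightarrow> e \<le> norm (L y - M y - (L x - M x))"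
      by (intro exI[of _ 1]) auto
  qed simp
  then obtain c where c: "\<And>t. t \<in> {0..1} \<Longrightarrow> L t - M t = c" unfolding constant_on_def by blast
  obtain n where "L 0 = M 0 + of_int n" using int[of 0] by auto
  moreover from this have "L 1 = M 1 + of_int n" using c[of 0] c[of 1] by simp
  ultimately show ?thesis by simp
qed

lemma wind_eq: "is_lift \<sigma> L \<Longrightarrow> wind \<sigma> = \<lfloor>L 1\<rfloor> - \<lfloor>L 0\<rfloor>"
  unfolding wind_def Let_def by (rule is_lift_unique[OF someI[of "is_lift \<sigma>"]])

text \<open>The standard 2-simplex as the image of a triangle in the complex plane: lifts are taken over convex sets
in normed spaces, and the function space that contains the standard simplices is not normed.\<close>

definition triangle_pt :: "complex \<Rightarrow> nat \<Rightarrow> real" where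
  "triangle_pt z = (\<lambda>i. if i = 0 then 1 - Re z - Im z else if i = 1 then Re z else if i = 2 then Im z else 0)"

text \<open>A triangle in the circle lifts to the line; restricted to the three edges, a single lift gives values
that telescope.\<close>

lemma is_cocycle_wind: "is_cocycle 1 circle wind"
  unfolding is_cocycle_def
proof (intro allI impI)
  fix \<tau> assume "singular_simplex (Suc 1) circle \<tau>"
  then have \<tau>: "continuous_map (subtopology (powertop_real UNIV) (standard_simplex 2)) circle \<tau>"
    by (simp add: singular_simplex_def numeral_2_eq_2)
  define T where "T = {z. 0 \<le> Re z} \<inter> {z. 0 \<le> Im z} \<inter> {z. Re z + Im z \<le> 1}"
  have "convex {z. Re z + Im z \<le> 1}"
    using convex_halfspace_le[of "Complex 1 1" 1] by (simp add: inner_complex_def)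
  then have "convex T"
    unfolding T_def by (simp add: convex_Int convex_halfspace_Re_ge convex_halfspace_Im_ge)
  have tri_in: "triangle_pt z \<in> standard_simplex 2" if "z \<in> T" for z
    using that by (auto simp: triangle_pt_def standard_simplex_def T_def numeral_2_eq_2)
  have "continuous_map (top_of_set T) (subtopology (powertop_real UNIV) (standard_simplex 2)) triangle_pt"
    unfolding continuous_map_in_subtopology continuous_map_componentwise_UNIV
  proof (intro conjI allI)
    fix i
    show "continuous_map (top_of_set T) euclideanreal (\<lambda>t. triangle_pt t i)"
      by (cases "i = 0"; cases "i = 1"; cases "i = 2") (auto simp: triangle_pt_def intro!: continuous_intros)
  qed (use tri_in in auto)
  from continuous_map_compose[OF this \<tau>]
  have "continuous_on T (\<tau> \<circ> triangle_pt)" "\<tau> \<circ> triangle_pt \<in> T \<rightarrow> sphere 0 1"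
    by (auto simp: circle_def)
  then obtain L where L: "continuous_on T L" "\<And>z. z \<in> T \<Longrightarrow> \<tau> (triangle_pt z) = turn (L z)"
    using continuous_lift[OF \<open>convex T\<close>, of "\<tau> \<circ> triangle_pt"] by (auto simp: Pi_iff)
  have lift: "is_lift (singular_face 2 k \<tau>) (L \<circ> \<gamma>)"
    if "\<And>t. t \<in> {0..1} \<Longrightarrow> \<gamma> t \<in> T" "continuous_on {0..1} \<gamma>"
      "\<And>t. triangle_pt (\<gamma> t) = simplical_face k (edge_pt t)" for k \<gamma>
    unfolding is_lift_def
  proof (intro conjI ballI)
    show "continuous_on {0..1} (L \<circ> \<gamma>)"
      using that by (intro continuous_on_compose) (auto intro: continuous_on_subset[OF L(1)])
    fix t :: real assume "t \<in> {0..1}"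
    then show "singular_face 2 k \<tau> (edge_pt t) = turn ((L \<circ> \<gamma>) t)"
      using L(2)[OF that(1)] by (simp add: singular_face_def that(3))
  qed
  have face: "triangle_pt (Complex (1 - t) t) = simplical_face 0 (edge_pt t)"
    "triangle_pt (Complex 0 t) = simplical_face 1 (edge_pt t)"
    "triangle_pt (Complex t 0) = simplical_face 2 (edge_pt t)" for t
    by (auto simp: triangle_pt_def simplical_face_def edge_pt_def fun_eq_iff)
  have cont: "continuous_on {0..1} (\<lambda>t. Complex (1 - t) t)" "continuous_on {0..1} (\<lambda>t. Complex 0 t)"
    "continuous_on {0..1} (\<lambda>t. Complex t 0)"
    unfolding Complex_eq by (intro continuous_intros)+
  have "wind (singular_face 2 0 \<tau>) = \<lfloor>L (Complex 0 1)\<rfloor> - \<lfloor>L (Complex 1 0)\<rfloor>"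
    "wind (singular_face 2 1 \<tau>) = \<lfloor>L (Complex 0 1)\<rfloor> - \<lfloor>L (Complex 0 0)\<rfloor>"
    "wind (singular_face 2 2 \<tau>) = \<lfloor>L (Complex 1 0)\<rfloor> - \<lfloor>L (Complex 0 0)\<rfloor>"
    using wind_eq[OF lift[OF _ cont(1) face(1)]] wind_eq[OF lift[OF _ cont(2) face(2)]]
      wind_eq[OF lift[OF _ cont(3) face(3)]]
    by (auto simp: T_def)
  then show "delta 1 wind \<tau> = 0" unfolding delta_1 by simp
qed

section \<open>Cocycles of the line and of the circle\<close>

definition segment_simplex :: "real \<Rightarrow> real \<Rightarrow> (nat \<Rightarrow> real) \<Rightarrow> real" where
  "segment_simplex x y = (\<lambda>z\<in>standard_simplex 1. x * z 0 + y * z 1)"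

lemma singular_simplex_segment [simp]: "singular_simplex 1 euclideanreal (segment_simplex x y)"
proof -
  have "continuous_map (subtopology (powertop_real UNIV) (standard_simplex 1)) euclideanreal (\<lambda>z. x * z 0 + y * z 1)"
    by (intro continuous_map_from_subtopology continuous_map_add continuous_map_real_mult_left
        continuous_map_product_projection) auto
  then show ?thesis
    by (auto simp: singular_simplex_def segment_simplex_def intro: continuous_map_eq)
qed

lemma endpoint_faces:
  "singular_face 1 0 \<rho> = (\<lambda>_\<in>standard_simplex 0. \<rho> (edge_pt 1))"
  "singular_face 1 1 \<rho> = (\<lambda>_\<in>standard_simplex 0. \<rho> (edge_pt 0))"
proof -
  have "simplical_face 0 x = edge_pt 1" "simplical_face 1 x = edge_pt 0" if "x \<in> standard_simplex 0" for x
    using that by (auto simp: standard_simplex_0 simplical_face_def edge_pt_def fun_eq_iff)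
  then show "singular_face 1 0 \<rho> = (\<lambda>_\<in>standard_simplex 0. \<rho> (edge_pt 1))"
    "singular_face 1 1 \<rho> = (\<lambda>_\<in>standard_simplex 0. \<rho> (edge_pt 0))"
    by (auto simp: singular_face_def cong: restrict_cong)
qed

lemma segment_endpoints [simp]:
  "segment_simplex x y (edge_pt 0) = x" "segment_simplex x y (edge_pt 1) = y"
  by (simp_all add: segment_simplex_def) (simp_all add: edge_pt_def)

lemma boundary_path:
  "chain_boundary 1 (frag_of \<rho>) = frag_of (\<lambda>_\<in>standard_simplex 0. \<rho> (edge_pt 1))
    - frag_of (\<lambda>_\<in>standard_simplex 0. \<rho> (edge_pt 0))"
  unfolding chain_boundary_of using endpoint_faces[of \<rho>] by (simp add: sum_atMost_1)

text \<open>All three faces of the constant triangle are the constant path.\<close>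

lemma cocycle_const:
  assumes "is_cocycle 1 X a" "x \<in> topspace X"
  shows "a (\<lambda>_\<in>standard_simplex 1. x) = 0"
proof -
  have "singular_simplex (Suc 1) X (\<lambda>_\<in>standard_simplex 2. x)"
    using assms(2) by (auto simp: singular_simplex_def numeral_2_eq_2 intro: continuous_map_eq[of _ _ "\<lambda>_. x"])
  then have "delta 1 a (\<lambda>_\<in>standard_simplex 2. x) = 0" using assms(1) by (simp add: is_cocycle_def)
  moreover have "singular_face 2 k (\<lambda>_\<in>standard_simplex 2. x) = (\<lambda>_\<in>standard_simplex 1. x)" if "k \<le> 2" for k
    using simplical_face_in_standard_simplex[of 2 k] that by (auto simp: singular_face_def)
  ultimately show ?thesis by (simp add: delta_1)
qed

text \<open>A path, closed up by the segments from \<open>0\<close> to its two ends, is a cycle. The contraction of the line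
makes it homologous to constant paths, on which a cocycle vanishes. So the values on segments from
\<open>0\<close> are a primitive.\<close>

lemma cocycle_of_line:
  assumes a: "is_cocycle 1 euclideanreal a"
  obtains f where "\<And>\<rho>. singular_simplex 1 euclideanreal \<rho> \<Longrightarrow> a \<rho> = f (\<rho> (edge_pt 1)) - f (\<rho> (edge_pt 0))"
proof
  fix \<rho> :: "(nat \<Rightarrow> real) \<Rightarrow> real" assume \<rho>: "singular_simplex 1 euclideanreal \<rho>"
  let ?s = "\<lambda>x. segment_simplex 0 x"
  define c where "c = frag_of \<rho> - frag_of (?s (\<rho> (edge_pt 1))) + frag_of (?s (\<rho> (edge_pt 0)))"
  have sc: "singular_chain 1 euclideanreal c"
    using \<rho> unfolding c_def
    by (intro singular_chain_add singular_chain_diff) (auto simp: singular_chain_of)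
  have cyc: "singular_relcycle 1 euclideanreal {} c"
    unfolding singular_cycle using sc
    by (simp add: c_def chain_boundary_add chain_boundary_diff boundary_path)
  have "homotopic_with (\<lambda>h. True) euclideanreal euclideanreal id (\<lambda>x::real. 0)"
    using homotopic_with_linear[of UNIV "id::real\<Rightarrow>real" "\<lambda>x. 0" UNIV] by simp
  then have hom: "homotopic_with (\<lambda>h. h \<in> {} \<rightarrow> {}) euclideanreal euclideanreal id (\<lambda>x::real. 0)"
    by (rule homotopic_with_mono) auto
  have "homologous_rel 1 euclideanreal {} (chain_map 1 id c) (chain_map 1 (\<lambda>x. 0) c)"
    by (rule homotopic_imp_homologous_rel_chain_maps[OF hom cyc])
  then obtain d where d: "singular_chain (Suc 1) euclideanreal d"
      "chain_boundary (Suc 1) d = chain_map 1 id c - chain_map 1 (\<lambda>x. 0) c"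
    unfolding homologous_rel_def singular_boundary by blast
  have "cochain_eval a (chain_map 1 (\<lambda>x. 0) c) = 0"
    using cocycle_const[OF a, of 0]
    by (simp add: c_def chain_map_add chain_map_diff cochain_eval_add cochain_eval_diff simplex_map_def o_def)
  moreover have "chain_map 1 id c = c" using chain_map_id_gen[OF sc] by simp
  ultimately have "cochain_eval a c = 0"
    using is_cocycle_boundary[OF a d(1)] d(2) by (simp add: cochain_eval_diff)
  then show "a \<rho> = a (?s (\<rho> (edge_pt 1))) - a (?s (\<rho> (edge_pt 0)))"
    by (simp add: c_def cochain_eval_add cochain_eval_diff)
qed

lemma continuous_map_turn: "continuous_map euclideanreal circle turn"
  using continuous_on_turn[of UNIV "\<lambda>x. x"]
  by (simp add: circle_def continuous_map_in_subtopology)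

lemma simplex_map_turn_lift:
  assumes \<sigma>: "singular_simplex 1 circle \<sigma>" and L: "is_lift \<sigma> L"
  obtains \<rho> where "singular_simplex 1 euclideanreal \<rho>" "simplex_map 1 turn \<rho> = \<sigma>"
    "\<rho> (edge_pt 0) = L 0" "\<rho> (edge_pt 1) = L 1"
proof
  define \<rho> where "\<rho> = (\<lambda>x\<in>standard_simplex 1. L (x 1))"
  have "continuous_map (subtopology (powertop_real UNIV) (standard_simplex 1)) (top_of_set {0..1}) (\<lambda>x. x 1)"
    using edge_pt_cover
    by (auto simp: continuous_map_in_subtopology intro!: continuous_map_from_subtopology continuous_map_product_projection)
  moreover have "continuous_map (top_of_set {0..1}) euclideanreal L" using L by (simp add: is_lift_def)
  ultimately have "continuous_map (subtopology (powertop_real UNIV) (standard_simplex 1)) euclideanreal (L \<circ> (\<lambda>x. x 1))"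
    by (rule continuous_map_compose)
  then show "singular_simplex 1 euclideanreal \<rho>"
    by (auto simp: singular_simplex_def \<rho>_def intro: continuous_map_eq)
  show "\<rho> (edge_pt 0) = L 0" "\<rho> (edge_pt 1) = L 1"
    by (simp_all add: \<rho>_def) (simp_all add: edge_pt_def)
  have "turn (L (x 1)) = \<sigma> x" if "x \<in> standard_simplex 1" for x
    using edge_pt_cover[OF that] L unfolding is_lift_def by metis
  then show "simplex_map 1 turn \<rho> = \<sigma>"
    using \<sigma> by (auto simp: simplex_map_def \<rho>_def singular_simplex_def extensional_def fun_eq_iff)
qed

lemma periodic_of_int:
  assumes "\<And>x. f (x + 1) = f x + (k::int)"
  shows "f (x + of_int n) = f (x::real) + n * k"
proof (induction n arbitrary: x rule: int_induct[where k=0])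
  case (step1 i)
  then show ?case using assms[of "x + of_int i"] by (simp add: algebra_simps)
next
  case (step2 i)
  then show ?case using assms[of "x + of_int (i - 1)"] by (simp add: algebra_simps)
qed simp

text \<open>Pulled back to the line the cocycle has a primitive \<open>f\<close>. Its pullback is invariant under the
translation by \<open>1\<close>, so \<open>f\<close> grows by a constant \<open>k\<close> over each period. The difference of \<open>f\<close> and \<open>k\<close>
times the rounding function is periodic, hence descends to the circle, where it is a primitive of the
difference of the cocycle and \<open>k\<close> times \<^const>\<open>wind\<close>.\<close>

lemma circle_cocycle:
  assumes a: "is_cocycle 1 circle a"
  obtains k where "is_coboundary 1 circle (\<lambda>\<sigma>. a \<sigma> - k * wind \<sigma>)"
proof -
  have "is_cocycle 1 euclideanreal (\<lambda>\<rho>. a (simplex_map 1 turn \<rho>))"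
    by (rule is_cocycle_pullback[OF continuous_map_turn a])
  then obtain f where f: "\<And>\<rho>. singular_simplex 1 euclideanreal \<rho> \<Longrightarrow>
      a (simplex_map 1 turn \<rho>) = f (\<rho> (edge_pt 1)) - f (\<rho> (edge_pt 0))"
    using cocycle_of_line by blast
  define k where "k = f 1 - f 0"
  (* Segments that differ by the translation by 1 have the same image in the circle. *)
  have step: "f (y + 1) - f (x + 1) = f y - f x" for x y
  proof -
    have "turn ((x + 1) * z 0 + (y + 1) * z 1) = turn (x * z 0 + y * z 1)"
      if "z \<in> standard_simplex 1" for z
    proof -
      have "z 0 + z 1 = 1" using that by (simp add: standard_simplex_def sum_atMost_1)
      then have "(x + 1) * z 0 + (y + 1) * z 1 = (x * z 0 + y * z 1) + 1" by (simp add: algebra_simps)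
      then show ?thesis by (simp only: turn_add turn_1 mult_1_right)
    qed
    then have "simplex_map 1 turn (segment_simplex (x + 1) (y + 1)) = simplex_map 1 turn (segment_simplex x y)"
      by (auto simp: simplex_map_def segment_simplex_def fun_eq_iff)
    then show ?thesis
      using f[of "segment_simplex (x + 1) (y + 1)"] f[of "segment_simplex x y"] by simp
  qed
  have "f (x + 1) = f x + k" for x using step[of x 0] by (simp add: k_def)
  then have per: "f (x + of_int n) = f x + n * k" for x n by (rule periodic_of_int)
  (* The periodic part of \<open>f\<close> as a function on the circle. *)
  define G where "G z = (let x = SOME x. turn x = z in f x - k * \<lfloor>x\<rfloor>)" for z
  have G: "G (turn x) = f x - k * \<lfloor>x\<rfloor>" for x
  proof -
    define y where "y = (SOME y. turn y = turn x)"
    have "turn y = turn x" unfolding y_def by (rule someI_ex) auto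
    then obtain n where "y = x + of_int n" using turn_eq_iff by blast
    moreover have "G (turn x) = f y - k * \<lfloor>y\<rfloor>" by (simp add: G_def y_def Let_def)
    ultimately show ?thesis using per by (simp add: algebra_simps)
  qed
  have "is_coboundary (Suc 0) circle (\<lambda>\<sigma>. a \<sigma> - k * wind \<sigma>)"
  proof (rule is_coboundaryI[where b="\<lambda>\<sigma>. G (\<sigma> (edge_pt 0))"])
    fix \<sigma> :: "(nat \<Rightarrow> real) \<Rightarrow> complex" assume "singular_simplex (Suc 0) circle \<sigma>"
    then have \<sigma>: "singular_simplex 1 circle \<sigma>" by (simp add: One_nat_def)
    obtain L where L: "is_lift \<sigma> L" using is_lift_exists[OF \<sigma>] .
    obtain \<rho> where \<rho>: "singular_simplex 1 euclideanreal \<rho>" "simplex_map 1 turn \<rho> = \<sigma>"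
      "\<rho> (edge_pt 0) = L 0" "\<rho> (edge_pt 1) = L 1" by (rule simplex_map_turn_lift[OF \<sigma> L])
    have e: "edge_pt 0 \<in> standard_simplex 0" by (simp add: standard_simplex_0 edge_pt_def fun_eq_iff)
    have "\<sigma> (edge_pt 0) = turn (L 0)" "\<sigma> (edge_pt 1) = turn (L 1)" using L by (auto simp: is_lift_def)
    then have "delta 0 (\<lambda>\<sigma>. G (\<sigma> (edge_pt 0))) \<sigma> = f (L 1) - k * \<lfloor>L 1\<rfloor> - (f (L 0) - k * \<lfloor>L 0\<rfloor>)"
      using e by (simp add: delta_0 endpoint_faces G)
    moreover have "a \<sigma> = f (L 1) - f (L 0)" using f[OF \<rho>(1)] \<rho> by simp
    ultimately show "a \<sigma> - k * wind \<sigma> = delta 0 (\<lambda>\<sigma>. G (\<sigma> (edge_pt 0))) \<sigma>"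
      unfolding wind_eq[OF L] by (simp add: right_diff_distrib)
  qed
  then show ?thesis using that by (simp add: One_nat_def)
qed

text \<open>The full turn is a loop on which \<^const>\<open>wind\<close> is \<open>1\<close>, while coboundaries vanish on loops.\<close>

lemma wind_not_coboundary: "\<not> is_coboundary 1 circle wind"
proof
  assume "is_coboundary 1 circle wind"
  then obtain b where b: "\<And>\<sigma>. singular_simplex 1 circle \<sigma> \<Longrightarrow> wind \<sigma> = delta 0 b \<sigma>"
    using is_coboundary_Suc[of 0 circle wind] by (auto simp: One_nat_def)
  let ?\<sigma> = "simplex_map 1 turn (segment_simplex 0 1)"
  have s: "singular_simplex 1 circle ?\<sigma>"
    by (rule singular_simplex_simplex_map[OF singular_simplex_segment continuous_map_turn])
  have pt: "?\<sigma> (edge_pt t) = turn t" if "t \<in> {0..1}" for t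
    using that by (simp add: simplex_map_def segment_simplex_def) (simp add: edge_pt_def)
  then have "is_lift ?\<sigma> (\<lambda>t. t)" by (simp add: is_lift_def)
  then have "wind ?\<sigma> = 1" using wind_eq by fastforce
  moreover have "delta 0 b ?\<sigma> = 0"
    using pt[of 0] pt[of 1] by (simp add: delta_0 endpoint_faces)
  ultimately show False using b[OF s] by simp
qed

text \<open>The factor cannot be zero: then the zero class would generate the cohomology of the circle, while the
class of \<^const>\<open>wind\<close> is not zero.\<close>

lemma circle_generator_wind:
  assumes "circle_generator d\<theta>"
  obtains k where "k \<noteq> 0" "d\<theta> = cohomology_class 1 circle (\<lambda>\<sigma>. k * wind \<sigma>)"
proof -
  interpret H: group "cohomology_group 1 circle" by (rule group_cohomology_group)
  have c: "d\<theta> \<in> carrier (cohomology_group 1 circle)"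
    and g: "subgroup_generated (cohomology_group 1 circle) {d\<theta>} = cohomology_group 1 circle"
    using assms by (auto simp: circle_generator_def)
  obtain a where a: "is_cocycle 1 circle a" "d\<theta> = cohomology_class 1 circle a"
    using c by (auto simp: carrier_cohomology_group)
  obtain k where "is_coboundary 1 circle (\<lambda>\<sigma>. a \<sigma> - k * wind \<sigma>)" by (rule circle_cocycle[OF a(1)])
  then have eq: "d\<theta> = cohomology_class 1 circle (\<lambda>\<sigma>. k * wind \<sigma>)"
    unfolding a(2) by (rule cohomology_class_eqI)
  have "k \<noteq> 0"
  proof
    assume "k = 0"
    then have "d\<theta> = \<one>\<^bsub>cohomology_group 1 circle\<^esub>" using eq by (simp add: one_cohomology_group)
    then have "carrier (cohomology_group 1 circle) = {\<one>\<^bsub>cohomology_group 1 circle\<^esub>}"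
      using H.carrier_subgroup_generated_by_singleton[OF c] unfolding g by simp
    then have "cohomology_class 1 circle wind = \<one>\<^bsub>cohomology_group 1 circle\<^esub>"
      using cohomology_class_closed[OF is_cocycle_wind] by blast
    then show False using wind_not_coboundary by (simp add: cohomology_class_eq_one_iff)
  qed
  then show ?thesis using eq that by blast
qed

section \<open>Winding of circle-valued functions\<close>

definition winding :: "('a \<Rightarrow> complex) \<Rightarrow> 'a cochain" where
  "winding u \<sigma> = wind (simplex_map 1 u \<sigma>)"

lemma is_cocycle_winding: "continuous_map X circle u \<Longrightarrow> is_cocycle 1 X (winding u)"
  unfolding winding_def by (rule is_cocycle_pullback[OF _ is_cocycle_wind])

lemma winding_eq:
  assumes "continuous_on {0..1} L" "\<And>t. t \<in> {0..1} \<Longrightarrow> u (\<sigma> (edge_pt t)) = turn (L t)"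
  shows "winding u \<sigma> = \<lfloor>L 1\<rfloor> - \<lfloor>L 0\<rfloor>"
proof -
  have "is_lift (simplex_map 1 u \<sigma>) L" using assms by (simp add: is_lift_def simplex_map_def)
  then show ?thesis unfolding winding_def by (rule wind_eq)
qed

lemma winding_lift:
  assumes "continuous_map X circle u" "singular_simplex 1 X \<sigma>"
  obtains L where "continuous_on {0..1} L" "\<And>t. t \<in> {0..1} \<Longrightarrow> u (\<sigma> (edge_pt t)) = turn (L t)"
proof -
  have "singular_simplex 1 circle (simplex_map 1 u \<sigma>)"
    by (rule singular_simplex_simplex_map[OF assms(2,1)])
  then obtain L where "is_lift (simplex_map 1 u \<sigma>) L" by (rule is_lift_exists)
  then have L: "continuous_on {0..1} L" "\<forall>t\<in>{0..1}. simplex_map 1 u \<sigma> (edge_pt t) = turn (L t)"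
    by (auto simp: is_lift_def)
  have "u (\<sigma> (edge_pt t)) = turn (L t)" if "t \<in> {0..1}" for t
    using L(2) that by (auto simp: simplex_map_def)
  with L(1) show ?thesis by (rule that)
qed

text \<open>The lift takes no integer value, so by the intermediate value theorem it stays between two consecutive
integers.\<close>

lemma winding_zero_if_avoids_1:
  assumes "continuous_map X circle u" "singular_simplex 1 X \<sigma>"
    and avoid: "\<And>x. x \<in> standard_simplex 1 \<Longrightarrow> u (\<sigma> x) \<noteq> 1"
  shows "winding u \<sigma> = 0"
proof -
  obtain L where L: "continuous_on {0..1} L" "\<And>t. t \<in> {0..1} \<Longrightarrow> u (\<sigma> (edge_pt t)) = turn (L t)"
    using winding_lift[OF assms(1,2)] by blast
  have no: "L t \<noteq> of_int n" if "t \<in> {0..1}" for t n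
    using L(2)[OF that] avoid[OF edge_pt_in[OF that]] by auto
  have "\<not> \<lfloor>L 0\<rfloor> < \<lfloor>L 1\<rfloor>"
  proof
    assume "\<lfloor>L 0\<rfloor> < \<lfloor>L 1\<rfloor>"
    then have "L 0 \<le> of_int \<lfloor>L 1\<rfloor>" by linarith
    then obtain t where "0 \<le> t" "t \<le> 1" "L t = of_int \<lfloor>L 1\<rfloor>"
      using IVT'[of L 0 "of_int \<lfloor>L 1\<rfloor>" 1] L(1) by auto
    then show False using no by auto
  qed
  moreover have "\<not> \<lfloor>L 1\<rfloor> < \<lfloor>L 0\<rfloor>"
  proof
    assume "\<lfloor>L 1\<rfloor> < \<lfloor>L 0\<rfloor>"
    then have "L 1 \<le> of_int \<lfloor>L 0\<rfloor>" by linarith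
    then obtain t where "0 \<le> t" "t \<le> 1" "L t = of_int \<lfloor>L 0\<rfloor>"
      using IVT2'[of L 1 "of_int \<lfloor>L 0\<rfloor>" 0] L(1) by auto
    then show False using no by auto
  qed
  ultimately show ?thesis using winding_eq[of L u \<sigma>, OF L] by simp
qed

text \<open>The top class of the torus vanishes on the complement of \<open>(1, 1)\<close>. On a triangle where one of the two
functions avoids \<open>1\<close>, the corresponding factor of the product is zero; these triangles are the small
ones for the cover by the two open sets where \<open>u\<close>, respectively \<open>v\<close>, differs from \<open>1\<close>.\<close>

lemma cup_winding_coboundary:
  assumes u: "continuous_map X circle u" and v: "continuous_map X circle v"
    and miss: "\<And>x. x \<in> topspace X \<Longrightarrow> \<not> (u x = 1 \<and> v x = 1)"
  shows "is_coboundary 2 X (raw_cup 1 1 (winding u) (winding v))"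
proof -
  define D where "D w = {x \<in> topspace X. w x \<noteq> (1::complex)}" for w
  have D: "openin X (D w)" if "continuous_map X circle w" for w
  proof -
    have "openin circle (sphere 0 1 - {1})" by (auto simp: circle_def openin_delete)
    from openin_continuous_map_preimage[OF that this] show ?thesis
      using continuous_map_image_subset_topspace[OF that]
      by (auto simp: D_def circle_def elim!: rev_iffD1[OF _ arg_cong[where f="openin X"]])
  qed
  have face: "winding w (singular_face 2 k \<sigma>) = 0"
    if "continuous_map X circle w" "singular_simplex (Suc 1) (subtopology X (D w)) \<sigma>" "k \<le> 2" for w k \<sigma>
  proof (rule winding_zero_if_avoids_1[OF that(1)])
    have s: "singular_simplex 1 (subtopology X (D w)) (singular_face 2 k \<sigma>)"
      using singular_simplex_singular_face[OF that(2), of k] that(3) by (simp add: numeral_2_eq_2 One_nat_def)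
    then show "singular_simplex 1 X (singular_face 2 k \<sigma>)"
      by (simp add: singular_simplex_subtopology)
    show "w (singular_face 2 k \<sigma> x) \<noteq> 1" if "x \<in> standard_simplex 1" for x
      using s that unfolding singular_simplex_subtopology D_def by blast
  qed
  have "is_cocycle 2 X (raw_cup 1 1 (winding u) (winding v))"
    using is_cocycle_raw_cup[OF is_cocycle_winding[OF u] is_cocycle_winding[OF v]] by simp
  then have "is_coboundary (Suc 1) X (raw_cup 1 1 (winding u) (winding v))"
  proof (intro is_coboundary_if_vanishes_on_small[where \<C>="{D u, D v}"])
    show "topspace X \<subseteq> \<Union> {D u, D v}" using miss by (auto simp: D_def)
    show "raw_cup 1 1 (winding u) (winding v) \<sigma> = 0"
      if "V \<in> {D u, D v}" "singular_simplex (Suc 1) (subtopology X V) \<sigma>" for V \<sigma>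
      using that face[OF u, of \<sigma> 2] face[OF v, of \<sigma> 0] unfolding raw_cup_1_1 by auto
  qed (use D u v in \<open>auto simp: numeral_2_eq_2 One_nat_def\<close>)
  then show ?thesis by (simp add: numeral_2_eq_2 One_nat_def)
qed

text \<open>A lift of the quotient is the difference of lifts. Rounding is not additive, but the defect
\<open>\<lfloor>x - y\<rfloor> - (\<lfloor>x\<rfloor> - \<lfloor>y\<rfloor>)\<close> does not change when integers are added to \<open>x\<close> and \<open>y\<close>, so it
is a function on the circle squared and provides a primitive.\<close>

lemma winding_divide:
  assumes u: "continuous_map X circle u" and v: "continuous_map X circle v"
  shows "is_coboundary 1 X (\<lambda>\<sigma>. winding (\<lambda>x. u x / v x) \<sigma> - (winding u \<sigma> - winding v \<sigma>))"
proof -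
  (* The rounding defect, computed from arbitrary lifts of the two points. *)
  define G where "G z w = (let x = SOME x. turn x = z; y = SOME y. turn y = w in \<lfloor>x - y\<rfloor> - (\<lfloor>x\<rfloor> - \<lfloor>y\<rfloor>))" for z w
  have G: "G (turn x) (turn y) = \<lfloor>x - y\<rfloor> - (\<lfloor>x\<rfloor> - \<lfloor>y\<rfloor>)" for x y
  proof -
    define x' where "x' = (SOME t. turn t = turn x)"
    define y' where "y' = (SOME t. turn t = turn y)"
    have "turn x' = turn x" unfolding x'_def by (rule someI_ex) auto
    then obtain m where m: "x' = x + of_int m" using turn_eq_iff by blast
    have "turn y' = turn y" unfolding y'_def by (rule someI_ex) auto
    then obtain n where n: "y' = y + of_int n" using turn_eq_iff by blast
    have "x' - y' = x - y + of_int (m - n)" using m n by simp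
    then have "\<lfloor>x' - y'\<rfloor> = \<lfloor>x - y\<rfloor> + (m - n)" by (simp only: floor_add_int)
    moreover have "G (turn x) (turn y) = \<lfloor>x' - y'\<rfloor> - (\<lfloor>x'\<rfloor> - \<lfloor>y'\<rfloor>)" by (simp add: G_def x'_def y'_def Let_def)
    ultimately show ?thesis using m n by simp
  qed
  have "is_coboundary (Suc 0) X (\<lambda>\<sigma>. winding (\<lambda>x. u x / v x) \<sigma> - (winding u \<sigma> - winding v \<sigma>))"
  proof (rule is_coboundaryI[where b="\<lambda>\<sigma>. G (u (\<sigma> (edge_pt 0))) (v (\<sigma> (edge_pt 0)))"])
    fix \<sigma> assume "singular_simplex (Suc 0) X \<sigma>"
    then have \<sigma>: "singular_simplex 1 X \<sigma>" by (simp add: One_nat_def)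
    obtain L where L: "continuous_on {0..1} L" "\<And>t. t \<in> {0..1} \<Longrightarrow> u (\<sigma> (edge_pt t)) = turn (L t)"
      using winding_lift[OF u \<sigma>] by blast
    obtain M where M: "continuous_on {0..1} M" "\<And>t. t \<in> {0..1} \<Longrightarrow> v (\<sigma> (edge_pt t)) = turn (M t)"
      using winding_lift[OF v \<sigma>] by blast
    have "winding (\<lambda>x. u x / v x) \<sigma> = \<lfloor>L 1 - M 1\<rfloor> - \<lfloor>L 0 - M 0\<rfloor>"
      by (rule winding_eq[of "\<lambda>t. L t - M t"]) (use L M in \<open>auto intro: continuous_on_diff simp: turn_diff\<close>)
    moreover have "winding u \<sigma> = \<lfloor>L 1\<rfloor> - \<lfloor>L 0\<rfloor>" by (rule winding_eq[of L u \<sigma>, OF L])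
    moreover have "winding v \<sigma> = \<lfloor>M 1\<rfloor> - \<lfloor>M 0\<rfloor>" by (rule winding_eq[of M v \<sigma>, OF M])
    moreover have e: "edge_pt 0 \<in> standard_simplex 0" by (simp add: standard_simplex_0 edge_pt_def fun_eq_iff)
    moreover have "u (\<sigma> (edge_pt 0)) = turn (L 0)" "u (\<sigma> (edge_pt 1)) = turn (L 1)"
      "v (\<sigma> (edge_pt 0)) = turn (M 0)" "v (\<sigma> (edge_pt 1)) = turn (M 1)" using L(2) M(2) by auto
    ultimately show "winding (\<lambda>x. u x / v x) \<sigma> - (winding u \<sigma> - winding v \<sigma>)
        = delta 0 (\<lambda>\<sigma>. G (u (\<sigma> (edge_pt 0))) (v (\<sigma> (edge_pt 0)))) \<sigma>"
      by (simp add: delta_0 endpoint_faces G)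
  qed
  then show ?thesis by (simp add: One_nat_def)
qed

section \<open>Integral functionals on cohomology\<close>

lemma hom_int_sum:
  assumes "comm_group G" "\<Phi> \<in> hom G integer_group" "finite J" "f \<in> J \<rightarrow> carrier G"
  shows "\<Phi> (finprod G (\<lambda>i. f i [^]\<^bsub>G\<^esub> (c i :: int)) J) = (\<Sum>i\<in>J. c i * \<Phi> (f i))"
  using assms(3,4)
proof (induction J)
  interpret G: comm_group G by fact
  interpret h: group_hom G integer_group \<Phi>
    using assms(2) by (simp add: group_hom_def group_hom_axioms_def G.group_axioms)
  {
    case empty
    then show ?case using h.hom_one by simp
  next
    case (insert i J)
    then have "\<Phi> (f i [^]\<^bsub>G\<^esub> c i) = c i * \<Phi> (f i)"
      using h.hom_int_pow[of "f i" "c i"] by simp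
    with insert show ?case by (simp add: G.finprod_insert Pi_iff)
  }
qed

text \<open>A functional that is nonzero on one member of the family and zero on the others isolates the
coefficient of that member.\<close>

lemma int_independent_if_dual:
  assumes "comm_group G" "f \<in> I \<rightarrow> carrier G"
    and "\<And>i. i \<in> I \<Longrightarrow> \<Phi> i \<in> hom G integer_group"
    and "\<And>i. i \<in> I \<Longrightarrow> \<Phi> i (f i) \<noteq> 0"
    and "\<And>i j. i \<in> I \<Longrightarrow> j \<in> I \<Longrightarrow> i \<noteq> j \<Longrightarrow> \<Phi> i (f j) = 0"
  shows "int_independent G I f"
  unfolding int_independent_def
proof (intro allI impI ballI)
  fix J c i
  assume J: "finite J" "J \<subseteq> I" "finprod G (\<lambda>i. f i [^]\<^bsub>G\<^esub> (c i :: int)) J = \<one>\<^bsub>G\<^esub>" and i: "i \<in> J"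
  interpret G: comm_group G by fact
  have iI: "i \<in> I" using i J by auto
  have "0 = \<Phi> i \<one>\<^bsub>G\<^esub>"
    using hom_one[OF assms(3)[OF iI]] G.group_axioms by simp
  also have "\<dots> = (\<Sum>j\<in>J. c j * \<Phi> i (f j))"
    unfolding J(3)[symmetric] by (rule hom_int_sum) (use assms J iI in auto)
  also have "\<dots> = (\<Sum>j\<in>{i}. c j * \<Phi> i (f j))"
    using J i iI assms(5)[OF iI] by (intro sum.mono_neutral_right) auto
  finally show "c i = 0" using assms(4)[OF iI] by simp
qed

text \<open>Additive functions on cochains that kill coboundaries descend to cohomology.\<close>

lemma cohomology_functional:
  fixes \<phi> :: "'a cochain \<Rightarrow> int"
  assumes add: "\<And>a b. \<phi> (\<lambda>\<sigma>. a \<sigma> + b \<sigma>) = \<phi> a + \<phi> b"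
    and zero: "\<And>a. is_coboundary p X a \<Longrightarrow> \<phi> a = 0"
  obtains \<Phi> where "\<Phi> \<in> hom (cohomology_group p X) integer_group"
    "\<And>a. is_cocycle p X a \<Longrightarrow> \<Phi> (cohomology_class p X a) = \<phi> a"
proof
  define \<Phi> where "\<Phi> A = \<phi> (SOME a. is_cocycle p X a \<and> A = cohomology_class p X a)" for A
  show eq: "\<Phi> (cohomology_class p X a) = \<phi> a" if a: "is_cocycle p X a" for a
  proof -
    define b where "b = (SOME b. is_cocycle p X b \<and> cohomology_class p X a = cohomology_class p X b)"
    have "is_cocycle p X b \<and> cohomology_class p X a = cohomology_class p X b"
      unfolding b_def by (rule someI[of _ a]) (use a in auto)
    then have "\<phi> (\<lambda>\<sigma>. a \<sigma> - b \<sigma>) = 0" using zero by (simp add: cohomology_class_eq_iff)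
    then have "\<phi> a = \<phi> b" using add[of "\<lambda>\<sigma>. a \<sigma> - b \<sigma>" b] by simp
    then show ?thesis by (simp add: \<Phi>_def b_def)
  qed
  show "\<Phi> \<in> hom (cohomology_group p X) integer_group"
  proof (rule homI)
    fix A B assume "A \<in> carrier (cohomology_group p X)" "B \<in> carrier (cohomology_group p X)"
    then obtain a b where "is_cocycle p X a" "A = cohomology_class p X a"
      "is_cocycle p X b" "B = cohomology_class p X b" by (auto simp: carrier_cohomology_group)
    then show "\<Phi> (A \<otimes>\<^bsub>cohomology_group p X\<^esub> B) = \<Phi> A \<otimes>\<^bsub>integer_group\<^esub> \<Phi> B"
      by (simp add: mult_cohomology_group eq is_cocycle_add add)
  qed simp
qed

lemma comm_group_total_cohomology: "comm_group (total_cohomology X)"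
proof -
  have g: "group (total_cohomology X)"
    unfolding total_cohomology_def by (intro sum_group group_cohomology_group)
  show ?thesis
  proof (rule group.group_comm_groupI[OF g])
    fix x y assume "x \<in> carrier (total_cohomology X)" "y \<in> carrier (total_cohomology X)"
    then have "x p \<in> carrier (cohomology_group p X)" "y p \<in> carrier (cohomology_group p X)" for p
      by (auto simp: total_cohomology_def carrier_sum_group group_cohomology_group)
    then show "x \<otimes>\<^bsub>total_cohomology X\<^esub> y = y \<otimes>\<^bsub>total_cohomology X\<^esub> x"
      by (simp add: total_cohomology_def comm_groupE(4)[OF comm_group_cohomology_group])
  qed
qed

lemma degree_projection_hom: "(\<lambda>x. x p) \<in> hom (total_cohomology X) (cohomology_group p X)"
  by (rule homI) (auto simp: total_cohomology_def carrier_sum_group group_cohomology_group)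

lemma homogeneous_closed:
  "A \<in> carrier (cohomology_group p X) \<Longrightarrow> homogeneous p X A \<in> carrier (total_cohomology X)"
  by (auto simp: total_cohomology_def carrier_sum_group group_cohomology_group homogeneous_def
      group.is_monoid monoid.one_closed intro: finite_subset[of _ "{p}"])

lemma homogeneous_hom: "homogeneous p X \<in> hom (cohomology_group p X) (total_cohomology X)"
  by (rule homI)
    (auto simp: homogeneous_closed, auto simp: total_cohomology_def homogeneous_def fun_eq_iff
      group_cohomology_group group.is_monoid monoid.l_one monoid.one_closed)

lemma total_pullback_homogeneous:
  assumes "continuous_map X Y f"
  shows "total_pullback X f (homogeneous p Y (cohomology_class p Y a))
    = homogeneous p X (cohomology_class p X (\<lambda>\<sigma>. a (simplex_map p f \<sigma>)))"
  by (auto simp: total_pullback_def homogeneous_def one_cohomology_group cohomology_pullback_class[OF assms] fun_eq_iff)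

lemma homogeneous_one: "homogeneous p X \<one>\<^bsub>cohomology_group p X\<^esub> = \<one>\<^bsub>total_cohomology X\<^esub>"
  by (auto simp: homogeneous_def total_cohomology_def fun_eq_iff)

section \<open>The fundamental cycle of the three-dimensional torus\<close>

definition torus_vertex :: "real \<Rightarrow> real \<Rightarrow> real \<Rightarrow> nat \<Rightarrow> real" where
  "torus_vertex x y z = (\<lambda>i. if i = 0 then x else if i = 1 then y else if i = 2 then z else 0)"

text \<open>The image under \<open>E\<close> of the affine tetrahedron with vertices \<open>p, q, r, s\<close>; \<open>E\<close> plays the role of a map
from the torus, given as a periodic map on the space of real sequences.\<close>

definition tetra :: "((nat \<Rightarrow> real) \<Rightarrow> 'a) \<Rightarrow> (nat \<Rightarrow> real) \<Rightarrow> (nat \<Rightarrow> real) \<Rightarrow> (nat \<Rightarrow> real) \<Rightarrow> (nat \<Rightarrow> real) \<Rightarrow> (nat \<Rightarrow> real) \<Rightarrow> 'a" where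
  "tetra E p q r s = simplex_map 3 E (oriented_simplex 3 (\<lambda>j. if j = 0 then p else if j = 1 then q else if j = 2 then r else s))"

definition tri :: "((nat \<Rightarrow> real) \<Rightarrow> 'a) \<Rightarrow> (nat \<Rightarrow> real) \<Rightarrow> (nat \<Rightarrow> real) \<Rightarrow> (nat \<Rightarrow> real) \<Rightarrow> (nat \<Rightarrow> real) \<Rightarrow> 'a" where
  "tri E p q r = simplex_map 2 E (oriented_simplex 2 (\<lambda>j. if j = 0 then p else if j = 1 then q else r))"

definition seg :: "((nat \<Rightarrow> real) \<Rightarrow> 'a) \<Rightarrow> (nat \<Rightarrow> real) \<Rightarrow> (nat \<Rightarrow> real) \<Rightarrow> (nat \<Rightarrow> real) \<Rightarrow> 'a" where
  "seg E p q = simplex_map 1 E (oriented_simplex 1 (\<lambda>j. if j = 0 then p else q))"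

lemma singular_simplex_tetra:
  assumes "continuous_map (powertop_real UNIV) X E"
  shows "singular_simplex 3 X (tetra E p q r s)"
  unfolding tetra_def
  by (rule singular_simplex_simplex_map[OF _ assms], rule simplicial_imp_singular_simplex[of _ UNIV, simplified])
     (simp add: simplicial_simplex_oriented_simplex)

lemma delta_2: "delta 2 a \<sigma> = a (singular_face 3 0 \<sigma>) - a (singular_face 3 1 \<sigma>)
    + a (singular_face 3 2 \<sigma>) - a (singular_face 3 3 \<sigma>)"
  by (simp add: delta_def numeral_3_eq_3 numeral_2_eq_2 One_nat_def)

lemma delta_tetra:
  "delta 2 b (tetra E p q r s) = b (tri E q r s) - b (tri E p r s) + b (tri E p q s) - b (tri E p q r)"
proof -
  let ?l = "\<lambda>j. if j = 0 then p else if j = 1 then q else if j = 2 then r else s"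
  have "delta 2 b (tetra E p q r s) = delta 2 (\<lambda>\<sigma>. b (simplex_map 2 E \<sigma>)) (oriented_simplex 3 ?l)"
    unfolding tetra_def using delta_pullback[of 2 b E] by (simp add: numeral_3_eq_3 numeral_2_eq_2)
  moreover have f: "singular_face 3 k (oriented_simplex 3 ?l)
      = oriented_simplex 2 (\<lambda>j. if j < k then ?l j else ?l (Suc j))" if "k \<le> 3" for k
    using singular_face_oriented_simplex[of 3 k ?l] that by simp
  have "singular_face 3 0 (oriented_simplex 3 ?l) = oriented_simplex 2 (\<lambda>j. if j = 0 then q else if j = 1 then r else s)"
    "singular_face 3 1 (oriented_simplex 3 ?l) = oriented_simplex 2 (\<lambda>j. if j = 0 then p else if j = 1 then r else s)"
    "singular_face 3 2 (oriented_simplex 3 ?l) = oriented_simplex 2 (\<lambda>j. if j = 0 then p else if j = 1 then q else s)"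
    "singular_face 3 3 (oriented_simplex 3 ?l) = oriented_simplex 2 (\<lambda>j. if j = 0 then p else if j = 1 then q else r)"
    by (subst f; force simp: oriented_simplex_eq)+
  ultimately show ?thesis by (simp add: delta_2 tri_def)
qed

text \<open>The barycentric coordinates sum to \<open>1\<close>, so moving all vertices by \<open>e\<close> moves every point of the triangle
by \<open>e\<close>.\<close>

lemma tri_translate:
  assumes "\<And>x. E (\<lambda>i. x i + e i) = E x"
    "p' = (\<lambda>i. p i + e i)" "q' = (\<lambda>i. q i + e i)" "r' = (\<lambda>i. r i + e i)"
  shows "tri E p' q' r' = tri E p q r"
proof -
  have "E (\<lambda>i. \<Sum>j\<le>2. (if j = 0 then p' else if j = 1 then q' else r') i * x j)
      = E (\<lambda>i. \<Sum>j\<le>2. (if j = 0 then p else if j = 1 then q else r) i * x j)"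
    if x: "x \<in> standard_simplex 2" for x
  proof -
    have "x 0 + x 1 + x 2 = 1" using x by (simp add: standard_simplex_def numeral_2_eq_2 One_nat_def)
    then have e: "e i = e i * (x 0 + x 1 + x 2)" for i by simp
    have "p' i * x 0 + q' i * x 1 + r' i * x 2 = p i * x 0 + q i * x 1 + r i * x 2 + e i" for i
      using e[of i] unfolding assms(2-4) distrib_left distrib_right by linarith
    then show ?thesis
      using assms(1)[of "\<lambda>i. p i * x 0 + q i * x 1 + r i * x 2"] by (simp add: numeral_2_eq_2 One_nat_def)
  qed
  then show ?thesis by (auto simp: tri_def simplex_map_def oriented_simplex_def fun_eq_iff)
qed

text \<open>Evaluation on the fundamental cycle of the torus: the cube is cut into six tetrahedra, one for each
order of walking along the three axes from one corner to the opposite one, with the sign of that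
permutation.\<close>

definition torus_eval :: "((nat \<Rightarrow> real) \<Rightarrow> 'a) \<Rightarrow> 'a cochain \<Rightarrow> int" where
  "torus_eval E w =
      w (tetra E (torus_vertex 0 0 0) (torus_vertex 1 0 0) (torus_vertex 1 1 0) (torus_vertex 1 1 1))
    - w (tetra E (torus_vertex 0 0 0) (torus_vertex 1 0 0) (torus_vertex 1 0 1) (torus_vertex 1 1 1))
    - w (tetra E (torus_vertex 0 0 0) (torus_vertex 0 1 0) (torus_vertex 1 1 0) (torus_vertex 1 1 1))
    + w (tetra E (torus_vertex 0 0 0) (torus_vertex 0 1 0) (torus_vertex 0 1 1) (torus_vertex 1 1 1))
    + w (tetra E (torus_vertex 0 0 0) (torus_vertex 0 0 1) (torus_vertex 1 0 1) (torus_vertex 1 1 1))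
    - w (tetra E (torus_vertex 0 0 0) (torus_vertex 0 0 1) (torus_vertex 0 1 1) (torus_vertex 1 1 1))"

lemma torus_eval_add: "torus_eval E (\<lambda>\<sigma>. a \<sigma> + b \<sigma>) = torus_eval E a + torus_eval E b"
  by (simp add: torus_eval_def)

lemma torus_eval_cmul: "torus_eval E (\<lambda>\<sigma>. k * a \<sigma>) = k * torus_eval E a"
  by (simp add: torus_eval_def algebra_simps)

text \<open>Interior triangles of the cube occur in two tetrahedra with opposite signs; triangles on the boundary
cancel against their translates on the opposite side.\<close>

lemma torus_eval_coboundary:
  assumes E: "continuous_map (powertop_real UNIV) X E"
    and per: "\<And>m x. m < 3 \<Longrightarrow> E (\<lambda>i. x i + (if i = m then 1 else 0)) = E x"
    and w: "is_coboundary 3 X w"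
  shows "torus_eval E w = 0"
proof -
  obtain b where b: "\<And>\<sigma>. singular_simplex 3 X \<sigma> \<Longrightarrow> w \<sigma> = delta 2 b \<sigma>"
    using w is_coboundary_Suc[of 2 X w] by auto
  have W: "w (tetra E p q r s) = b (tri E q r s) - b (tri E p r s) + b (tri E p q s) - b (tri E p q r)" for p q r s
    using b[OF singular_simplex_tetra[OF E]] by (simp only: delta_tetra)
  (* The faces of the cube in the three coordinate directions, each cut into two triangles. *)
  have x: "tri E (torus_vertex 1 0 0) (torus_vertex 1 1 0) (torus_vertex 1 1 1) = tri E (torus_vertex 0 0 0) (torus_vertex 0 1 0) (torus_vertex 0 1 1)"
    "tri E (torus_vertex 1 0 0) (torus_vertex 1 0 1) (torus_vertex 1 1 1) = tri E (torus_vertex 0 0 0) (torus_vertex 0 0 1) (torus_vertex 0 1 1)"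
    by (rule tri_translate[of E "\<lambda>i. if i = 0 then 1 else 0", OF per]; simp add: torus_vertex_def fun_eq_iff)+
  have y: "tri E (torus_vertex 0 1 0) (torus_vertex 1 1 0) (torus_vertex 1 1 1) = tri E (torus_vertex 0 0 0) (torus_vertex 1 0 0) (torus_vertex 1 0 1)"
    "tri E (torus_vertex 0 1 0) (torus_vertex 0 1 1) (torus_vertex 1 1 1) = tri E (torus_vertex 0 0 0) (torus_vertex 0 0 1) (torus_vertex 1 0 1)"
    by (rule tri_translate[of E "\<lambda>i. if i = 1 then 1 else 0", OF per]; simp add: torus_vertex_def fun_eq_iff)+
  have z: "tri E (torus_vertex 0 0 1) (torus_vertex 1 0 1) (torus_vertex 1 1 1) = tri E (torus_vertex 0 0 0) (torus_vertex 1 0 0) (torus_vertex 1 1 0)"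
    "tri E (torus_vertex 0 0 1) (torus_vertex 0 1 1) (torus_vertex 1 1 1) = tri E (torus_vertex 0 0 0) (torus_vertex 0 1 0) (torus_vertex 1 1 0)"
    by (rule tri_translate[of E "\<lambda>i. if i = 2 then 1 else 0", OF per]; simp add: torus_vertex_def fun_eq_iff)+
  show ?thesis unfolding torus_eval_def W x y z by (simp only: algebra_simps)
qed

lemma front_face_oriented_simplex: "front_face p (oriented_simplex (p + q) l) = oriented_simplex p l"
proof -
  have "(\<Sum>j\<le>p + q. l j i * x j) = (\<Sum>j\<le>p. l j i * x j)" if "x \<in> standard_simplex p" for i x
  proof (rule sum.mono_neutral_right)
    have "x j = 0" if "j > p" for j using \<open>x \<in> standard_simplex p\<close> that by (simp add: standard_simplex_def)
    then show "\<forall>j\<in>{..p + q} - {..p}. l j i * x j = 0" by auto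
  qed auto
  then show ?thesis
    by (auto simp: front_face_def oriented_simplex_def restrict_def in_standard_simplex_mono fun_eq_iff)
qed

lemma back_face_oriented_simplex: "back_face p q (oriented_simplex (p + q) l) = oriented_simplex q (\<lambda>j. l (p + j))"
proof -
  have "(\<Sum>j\<le>p + q. l j i * (if j < p then 0 else x (j - p))) = (\<Sum>j\<le>q. l (p + j) i * x j)" for i and x :: "nat \<Rightarrow> real"
  proof -
    have "(\<Sum>j\<le>p + q. l j i * (if j < p then 0 else x (j - p))) = (\<Sum>j\<in>{p..p+q}. l j i * x (j - p))"
      by (rule sum.mono_neutral_cong_right) auto
    also have "\<dots> = (\<Sum>j\<le>q. l (p + j) i * x j)"
      by (rule sum.reindex_bij_witness[where i="\<lambda>i. p + i" and j="\<lambda>i. i - p"]) auto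
    finally show ?thesis .
  qed
  then show ?thesis
    by (auto simp: back_face_def oriented_simplex_def restrict_def shift_in_simplex fun_eq_iff)
qed

text \<open>The product of three degree-one cochains sees only the path through the four vertices. On the six
tetrahedra of the torus this turns the evaluation into the expansion of a determinant of winding
numbers.\<close>

lemma cup3_tetra:
  "raw_cup 1 2 a (raw_cup 1 1 b c) (tetra E p q r s) = a (seg E p q) * b (seg E q r) * c (seg E r s)"
proof -
  let ?l = "\<lambda>j::nat. if j = 0 then p else if j = 1 then q else if j = 2 then r else s"
  have "raw_cup 1 2 a (raw_cup 1 1 b c) (tetra E p q r s)
     = raw_cup 1 2 (\<lambda>\<tau>. a (simplex_map 1 E \<tau>)) (raw_cup 1 1 (\<lambda>\<tau>. b (simplex_map 1 E \<tau>)) (\<lambda>\<tau>. c (simplex_map 1 E \<tau>)))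
        (oriented_simplex (1 + 2) ?l)"
  proof -
    have "(\<lambda>\<tau>. raw_cup 1 1 b c (simplex_map (1 + 1) E \<tau>)) = raw_cup 1 1 (\<lambda>\<tau>. b (simplex_map 1 E \<tau>)) (\<lambda>\<tau>. c (simplex_map 1 E \<tau>))"
      by (rule ext) (rule raw_cup_simplex_map)
    then show ?thesis
      using raw_cup_simplex_map[of 1 2 a "raw_cup 1 1 b c" E "oriented_simplex 3 ?l"] by (simp add: tetra_def)
  qed
  also have "\<dots> = a (simplex_map 1 E (oriented_simplex 1 ?l)) *
      raw_cup 1 1 (\<lambda>\<tau>. b (simplex_map 1 E \<tau>)) (\<lambda>\<tau>. c (simplex_map 1 E \<tau>)) (oriented_simplex (1 + 1) (\<lambda>j. ?l (1 + j)))"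
    unfolding raw_cup_def[of 1 2] front_face_oriented_simplex back_face_oriented_simplex by simp
  also have "\<dots> = a (simplex_map 1 E (oriented_simplex 1 ?l)) * (b (simplex_map 1 E (oriented_simplex 1 (\<lambda>j. ?l (1 + j))))
      * c (simplex_map 1 E (oriented_simplex 1 (\<lambda>j. ?l (1 + (1 + j))))))"
    unfolding raw_cup_def[of 1 1] front_face_oriented_simplex back_face_oriented_simplex by simp
  finally have "raw_cup 1 2 a (raw_cup 1 1 b c) (tetra E p q r s) = \<dots>" .
  moreover have "oriented_simplex 1 ?l = oriented_simplex 1 (\<lambda>j. if j = 0 then p else q)"
    "oriented_simplex 1 (\<lambda>j. ?l (1 + j)) = oriented_simplex 1 (\<lambda>j. if j = 0 then q else r)"
    "oriented_simplex 1 (\<lambda>j. ?l (1 + (1 + j))) = oriented_simplex 1 (\<lambda>j. if j = 0 then r else s)"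
    by (auto simp: oriented_simplex_eq)
  ultimately show ?thesis by (simp only: seg_def mult.assoc)
qed

lemma seg_edge_pt:
  assumes "t \<in> {0..1}"
  shows "seg E p q (edge_pt t) = E (\<lambda>i. p i * (1 - t) + q i * t)"
  using edge_pt_in[OF assms]
  by (simp add: seg_def simplex_map_def oriented_simplex_def sum_atMost_1) (simp add: edge_pt_def)

lemma winding_seg:
  assumes "continuous_on {0..1} L" "\<And>t. t \<in> {0..1} \<Longrightarrow> u (E (\<lambda>i. p i * (1 - t) + q i * t)) = turn (L t)"
  shows "winding u (seg E p q) = \<lfloor>L 1\<rfloor> - \<lfloor>L 0\<rfloor>"
  by (rule winding_eq[OF assms(1)]) (simp add: seg_edge_pt assms(2))

section \<open>Cohomology classes of forests\<close>

definition edge_angle :: "nat \<Rightarrow> nat \<Rightarrow> (nat \<Rightarrow> complex) \<Rightarrow> complex" where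
  "edge_angle i j x = (x j - x i) / of_real (norm (x j - x i))"

lemma topspace_Conf: "topspace (Conf n) = {x \<in> {1..n} \<rightarrow>\<^sub>E cball 0 1. inj_on x {1..n}}"
  by (auto simp: Conf_def)

lemma continuous_map_edge_angle:
  assumes "i \<in> {1..n}" "j \<in> {1..n}" "i \<noteq> j"
  shows "continuous_map (Conf n) circle (edge_angle i j)"
proof -
  have p: "continuous_map (Conf n) euclidean (\<lambda>x. x k)" if "k \<in> {1..n}" for k
  proof -
    have "continuous_map (Conf n) (top_of_set (cball 0 1)) (\<lambda>x. x k)"
      unfolding Conf_def by (intro continuous_map_from_subtopology continuous_map_product_projection that)
    then show ?thesis by (rule continuous_map_into_fulltopology)
  qed
  have "continuous_map (Conf n) (top_of_set (- {0})) (\<lambda>x. x j - x i)"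
    unfolding continuous_map_in_subtopology
  proof
    show "continuous_map (Conf n) euclidean (\<lambda>x. x j - x i)" by (intro continuous_map_diff p assms)
    show "(\<lambda>x. x j - x i) \<in> topspace (Conf n) \<rightarrow> - {0}"
      using assms inj_onD[of _ "{1..n}" j i] by (force simp: topspace_Conf)
  qed
  moreover have "continuous_map (top_of_set (- {0})) circle (\<lambda>z. z / of_real (norm z))"
    unfolding circle_def continuous_map_subtopology_eu
  proof
    show "continuous_on (- {0}) (\<lambda>z::complex. z / of_real (norm z))"
      by (intro continuous_intros) auto
  qed (auto simp: norm_divide)
  ultimately have "continuous_map (Conf n) circle ((\<lambda>z. z / of_real (norm z)) \<circ> (\<lambda>x. x j - x i))"
    by (rule continuous_map_compose)
  then show ?thesis by (simp add: o_def edge_angle_def[abs_def])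
qed

lemma (in linorder) sorted_key_list_of_set_idem:
  assumes "inj_on f (set xs)" "sorted (map f xs)" "distinct xs"
  shows "sorted_key_list_of_set f (set xs) = xs"
proof -
  interpret F: folding_insort_key "(\<le>)" "(<)" "set xs" f
    by unfold_locales (rule assms(1))
  show ?thesis using F.idem_if_sorted_distinct[of xs] assms by simp
qed

lemma edge_list_set:
  assumes "sorted_wrt (<) (map snd es)"
  shows "edge_list (set es) = es"
  using assms unfolding edge_list_def
  by (intro sorted_key_list_of_set_idem) (auto simp: strict_sorted_iff distinct_map)

text \<open>Cup products commute with pullbacks already for cochains, so the product on the torus becomes the
product of the cochains obtained from the angles of the individual edges.\<close>

lemma forest_class_eq:
  assumes sorted: "sorted_wrt (<) (map snd es)"
    and es: "\<And>i j. (i, j) \<in> set es \<Longrightarrow> i \<in> {1..n} \<and> j \<in> {1..n} \<and> i \<noteq> j"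
    and a: "is_cocycle 1 circle a"
  shows "forest_class (cohomology_class 1 circle a) n (set es) = homogeneous (length es) (Conf n)
    (cohomology_class (length es) (Conf n) (cup_list (map (\<lambda>(i, j) \<sigma>. a (simplex_map 1 (edge_angle i j) \<sigma>)) es)))"
proof -
  let ?k = "length es"
  have el: "edge_list (set es) = es" by (rule edge_list_set[OF sorted])
  have "distinct (map snd es)" using sorted by (simp add: strict_sorted_iff)
  then have card: "card (set es) = ?k" by (simp add: distinct_map distinct_card)
  have am: "angle_map (set es) x m = edge_angle (fst (es ! m)) (snd (es ! m)) x" if "m < ?k" for x m
    using that by (simp add: angle_map_def card el edge_angle_def split: prod.split)
  have edge: "fst (es ! m) \<in> {1..n} \<and> snd (es ! m) \<in> {1..n} \<and> fst (es ! m) \<noteq> snd (es ! m)" if "m < ?k" for m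
    using es[of "fst (es ! m)" "snd (es ! m)"] that by simp
  have cont: "continuous_map (Conf n) (circle_power ?k) (angle_map (set es))"
    unfolding circle_power_def continuous_map_componentwise
  proof (intro conjI ballI)
    fix m assume "m \<in> {..<?k}"
    then have m: "m < ?k" by simp
    have "continuous_map (Conf n) circle (edge_angle (fst (es ! m)) (snd (es ! m)))"
      using edge[OF m] by (intro continuous_map_edge_angle) auto
    then show "continuous_map (Conf n) circle (\<lambda>x. angle_map (set es) x m)" by (simp add: am[OF m])
  qed (auto simp: angle_map_def card)
  define b where "b m = (\<lambda>\<sigma>. a (simplex_map 1 (\<lambda>t. t m) \<sigma>))" for m :: nat
  have proj: "continuous_map (circle_power ?k) circle (\<lambda>t. t m)" if "m < ?k" for m
    unfolding circle_power_def using that by (intro continuous_map_product_projection) auto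
  have b: "is_cocycle 1 (circle_power ?k) (b m)" if "m < ?k" for m
    unfolding b_def by (rule is_cocycle_pullback[OF proj[OF that] a])
  have "torus_class (cohomology_class 1 circle a) ?k
      = wedge (circle_power ?k) (map (cohomology_class 1 (circle_power ?k)) (map b [0..<?k]))"
    unfolding torus_class_def map_map o_def b_def
    by (intro arg_cong[where f="wedge _"] map_cong refl cohomology_pullback_class proj) auto
  also have "\<dots> = cohomology_class ?k (circle_power ?k) (cup_list (map b [0..<?k]))"
    using wedge_classes[of "map b [0..<?k]" "circle_power ?k"] b by fastforce
  finally have "cohomology_pullback ?k (Conf n) (angle_map (set es)) (torus_class (cohomology_class 1 circle a) ?k)
      = cohomology_class ?k (Conf n) (\<lambda>\<sigma>. cup_list (map b [0..<?k]) (simplex_map ?k (angle_map (set es)) \<sigma>))"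
    by (simp add: cohomology_pullback_class[OF cont])
  also have "(\<lambda>\<sigma>. cup_list (map b [0..<?k]) (simplex_map ?k (angle_map (set es)) \<sigma>))
      = cup_list (map (\<lambda>(i, j) \<sigma>. a (simplex_map 1 (edge_angle i j) \<sigma>)) es)"
  proof
    fix \<sigma>
    have "cup_list (map b [0..<?k]) (simplex_map ?k (angle_map (set es)) \<sigma>)
        = cup_list (map (\<lambda>m \<tau>. b m (simplex_map 1 (angle_map (set es)) \<tau>)) [0..<?k]) \<sigma>"
      using cup_list_simplex_map[of "map b [0..<?k]" "angle_map (set es)" \<sigma>] by (simp add: o_def)
    also have "map (\<lambda>m \<tau>. b m (simplex_map 1 (angle_map (set es)) \<tau>)) [0..<?k]
        = map (\<lambda>(i, j) \<sigma>. a (simplex_map 1 (edge_angle i j) \<sigma>)) es"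
    proof (rule nth_equalityI)
      fix m assume "m < length (map (\<lambda>m \<tau>. b m (simplex_map 1 (angle_map (set es)) \<tau>)) [0..<?k])"
      then have m: "m < ?k" by simp
      have "simplex_map 1 (\<lambda>t. t m) (simplex_map 1 (angle_map (set es)) \<tau>)
          = simplex_map 1 (edge_angle (fst (es ! m)) (snd (es ! m))) \<tau>" for \<tau>
        by (auto simp: simplex_map_def am[OF m] fun_eq_iff)
      then show "map (\<lambda>m \<tau>. b m (simplex_map 1 (angle_map (set es)) \<tau>)) [0..<?k] ! m
          = map (\<lambda>(i, j) \<sigma>. a (simplex_map 1 (edge_angle i j) \<sigma>)) es ! m"
        using m by (simp add: b_def case_prod_beta)
    qed simp
    finally show "cup_list (map b [0..<?k]) (simplex_map ?k (angle_map (set es)) \<sigma>)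
        = cup_list (map (\<lambda>(i, j) \<sigma>. a (simplex_map 1 (edge_angle i j) \<sigma>)) es) \<sigma>" .
  qed
  finally show ?thesis by (simp add: forest_class_def card)
qed

lemma raw_cup_one: "singular_simplex p X \<sigma> \<Longrightarrow> raw_cup p 0 a (\<lambda>_. 1) \<sigma> = a \<sigma>"
  by (simp add: raw_cup_def front_face_def singular_simplex_def extensional_restrict)

lemma cup_list_2:
  assumes "singular_simplex 2 X \<sigma>"
  shows "cup_list [a, b] \<sigma> = raw_cup 1 1 a b \<sigma>"
proof -
  have "raw_cup 1 1 a (raw_cup 1 0 b (\<lambda>_. 1)) \<sigma> = raw_cup 1 1 a b \<sigma>"
    by (rule raw_cup_cong[of 1 1 X]) (use assms in \<open>simp_all add: raw_cup_one\<close>)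
  then show ?thesis by (simp add: One_nat_def)
qed

text \<open>The product with the unit at the end of the list is the identity, but only on functions that are
restricted to the standard simplex, that is, on singular simplices.\<close>

lemma cup_list_3:
  assumes "singular_simplex 3 X \<sigma>"
  shows "cup_list [a, b, c] \<sigma> = raw_cup 1 2 a (raw_cup 1 1 b c) \<sigma>"
proof -
  have "raw_cup 1 2 a (cup_list [b, c]) \<sigma> = raw_cup 1 2 a (raw_cup 1 1 b c) \<sigma>"
    by (rule raw_cup_cong[of 1 2 X]) (use assms in \<open>simp_all only: cup_list_2, simp\<close>)
  then show ?thesis by (simp add: One_nat_def numeral_2_eq_2)
qed

section \<open>Triples of angles that are never equal\<close>

text \<open>The cochain of the signed sum of the two-edge subforests, and up to the square of \<open>b\<close> the product of
\<open>b - a\<close> and \<open>c - b\<close>.\<close>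

definition alt_cup :: "'a cochain \<Rightarrow> 'a cochain \<Rightarrow> 'a cochain \<Rightarrow> 'a cochain" where
  "alt_cup a b c \<sigma> = raw_cup 1 1 b c \<sigma> - raw_cup 1 1 a c \<sigma> + raw_cup 1 1 a b \<sigma>"

lemma is_cocycle_alt_cup:
  assumes "is_cocycle 1 X a" "is_cocycle 1 X b" "is_cocycle 1 X c"
  shows "is_cocycle 2 X (alt_cup a b c)"
proof -
  have "is_cocycle 2 X (raw_cup 1 1 f g)" if "is_cocycle 1 X f" "is_cocycle 1 X g" for f g
    using is_cocycle_raw_cup[OF that] by simp
  then show ?thesis unfolding alt_cup_def[abs_def] using assms
    by (intro is_cocycle_add is_cocycle_diff) auto
qed

text \<open>The two other terms contain the square of \<open>a\<close>.\<close>

lemma cup_first_alt_cup: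
  assumes a: "is_cocycle 1 X a" and b: "is_cocycle 1 X b" and c: "is_cocycle 1 X c"
  shows "is_coboundary 3 X (\<lambda>\<sigma>. raw_cup 1 2 a (alt_cup a b c) \<sigma> - raw_cup 1 2 a (raw_cup 1 1 b c) \<sigma>)"
proof -
  have 1: "is_coboundary (2 + 1) X (raw_cup 2 1 (raw_cup 1 1 a a) f)" if "is_cocycle 1 X f" for f
    by (rule is_coboundary_raw_cup_left[OF is_coboundary_cup_self[OF a] that])
  have 2: "raw_cup 1 2 a (raw_cup 1 1 a f) \<sigma> = raw_cup 2 1 (raw_cup 1 1 a a) f \<sigma>" for f \<sigma>
    using raw_cup_assoc[of 1 1 1 a a f \<sigma>] by simp
  have "is_coboundary 3 X (\<lambda>\<sigma>. raw_cup 2 1 (raw_cup 1 1 a a) b \<sigma> - raw_cup 2 1 (raw_cup 1 1 a a) c \<sigma>)"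
    using 1[OF b] 1[OF c] by (simp add: is_coboundary_diff)
  moreover have "raw_cup 1 2 a (alt_cup a b c) \<sigma> - raw_cup 1 2 a (raw_cup 1 1 b c) \<sigma>
      = raw_cup 2 1 (raw_cup 1 1 a a) b \<sigma> - raw_cup 2 1 (raw_cup 1 1 a a) c \<sigma>" for \<sigma>
    unfolding 2[symmetric] unfolding alt_cup_def raw_cup_def[of 1 2] by (simp add: algebra_simps)
  ultimately show ?thesis by simp
qed

text \<open>The signed sum is the pullback of the top class of the torus along \<open>(v / u, w / v)\<close>, and this map
misses \<open>(1, 1)\<close>.\<close>

lemma alt_cup_winding_coboundary:
  assumes u: "continuous_map X circle u" and v: "continuous_map X circle v" and w: "continuous_map X circle w"
    and ne: "\<And>x. x \<in> topspace X \<Longrightarrow> \<not> (u x = v x \<and> v x = w x)"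
  shows "is_coboundary 2 X (alt_cup (winding u) (winding v) (winding w))"
proof -
  have quot: "continuous_map X circle (\<lambda>x. f x / g x)"
    if "continuous_map X circle f" "continuous_map X circle g" for f g
  proof -
    have "continuous_map X euclidean f" "continuous_map X euclidean g" "f \<in> topspace X \<rightarrow> sphere 0 1" "g \<in> topspace X \<rightarrow> sphere 0 1"
      using that by (auto simp: circle_def continuous_map_in_subtopology)
    then show ?thesis unfolding circle_def continuous_map_in_subtopology
      by (auto simp: Pi_iff norm_divide continuous_map_atin dest: norm_eq_zero[THEN iffD2] intro!: tendsto_divide)
  qed
  let ?p = "\<lambda>x. v x / u x" and ?q = "\<lambda>x. w x / v x"
  have p: "continuous_map X circle ?p" and q: "continuous_map X circle ?q" by (intro quot u v w)+
  have miss: "\<not> (?p x = 1 \<and> ?q x = 1)" if "x \<in> topspace X" for x using ne[OF that] by auto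
  have 1: "is_coboundary 2 X (raw_cup 1 1 (winding ?p) (winding ?q))"
    by (rule cup_winding_coboundary[OF p q miss])
  have 2: "is_coboundary (1 + 1) X (\<lambda>\<sigma>. raw_cup 1 1 (winding ?p) (winding ?q) \<sigma>
      - raw_cup 1 1 (\<lambda>\<sigma>. winding v \<sigma> - winding u \<sigma>) (\<lambda>\<sigma>. winding w \<sigma> - winding v \<sigma>) \<sigma>)"
    by (intro is_coboundary_raw_cup_cong winding_divide is_cocycle_winding is_cocycle_diff p u v w)
  have 3: "is_coboundary 2 X (raw_cup 1 1 (winding v) (winding v))"
    by (intro is_coboundary_cup_self is_cocycle_winding v)
  show ?thesis
    by (rule is_coboundary_cong[OF is_coboundary_add[OF is_coboundary_diff[OF 1 2[unfolded one_add_one]] 3]])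
      (simp add: alt_cup_def raw_cup_def algebra_simps)
qed

lemma cup3_winding_coboundary:
  assumes u: "continuous_map X circle u" and v: "continuous_map X circle v" and w: "continuous_map X circle w"
    and ne: "\<And>x. x \<in> topspace X \<Longrightarrow> \<not> (u x = v x \<and> v x = w x)"
  shows "is_coboundary 3 X (raw_cup 1 2 (winding u) (raw_cup 1 1 (winding v) (winding w)))"
proof -
  have "is_coboundary (1 + 2) X (raw_cup 1 2 (winding u) (alt_cup (winding u) (winding v) (winding w)))"
    by (intro is_coboundary_raw_cup_right is_cocycle_winding u alt_cup_winding_coboundary v w ne)
  then have 1: "is_coboundary 3 X (raw_cup 1 2 (winding u) (alt_cup (winding u) (winding v) (winding w)))" by simp
  show ?thesis
    by (rule is_coboundary_cong[OF is_coboundary_diff[OF 1 cup_first_alt_cup[OF is_cocycle_winding[OF u]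
          is_cocycle_winding[OF v] is_cocycle_winding[OF w]]]]) simp
qed

section \<open>Collinear disks\<close>

text \<open>In increasing order there are three gaps of size at least \<open>2 * r\<close>.\<close>

lemma four_separated_reals:
  fixes a b c d r :: real
  assumes "0 \<le> r" "2 * r \<le> \<bar>a - b\<bar>" "2 * r \<le> \<bar>a - c\<bar>" "2 * r \<le> \<bar>a - d\<bar>"
    "2 * r \<le> \<bar>b - c\<bar>" "2 * r \<le> \<bar>b - d\<bar>" "2 * r \<le> \<bar>c - d\<bar>"
    and "\<And>x y. x \<in> {a, b, c, d} \<Longrightarrow> y \<in> {a, b, c, d} \<Longrightarrow> \<bar>x - y\<bar> \<le> m"
  shows "6 * r \<le> m"
  using assms(1-7) assms(8)[of a b] assms(8)[of a c] assms(8)[of a d] assms(8)[of b c] assms(8)[of b d] assms(8)[of c d]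
  by (simp add: abs_if split: if_splits)

text \<open>If two centers were closer than \<open>2 * r\<close>, their midpoint would lie in both disks.\<close>

lemma disk_Conf_distances:
  assumes x: "x \<in> topspace (disk_Conf n r)" and r: "0 < r"
  shows "i \<in> {1..n} \<Longrightarrow> norm (x i) \<le> 1 - r"
    and "i \<in> {1..n} \<Longrightarrow> j \<in> {1..n} \<Longrightarrow> i \<noteq> j \<Longrightarrow> 2 * r \<le> norm (x i - x j)"
proof -
  have disj: "disjoint_family_on (\<lambda>i. ball (x i) r) {1..n}"
    and sub: "\<And>i. i \<in> {1..n} \<Longrightarrow> ball (x i) r \<subseteq> cball 0 1"
    using x by (auto simp: disk_Conf_def)
  show "norm (x i) \<le> 1 - r" if "i \<in> {1..n}"
    using sub[OF that] r by (simp add: ball_subset_cball_iff)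
  show "2 * r \<le> norm (x i - x j)" if "i \<in> {1..n}" "j \<in> {1..n}" "i \<noteq> j"
  proof (rule ccontr)
    assume "\<not> 2 * r \<le> norm (x i - x j)"
    then have "norm ((x i - x j) / 2) < r" by (simp add: norm_divide)
    then have "(x i + x j) / 2 \<in> ball (x i) r \<inter> ball (x j) r"
      by (auto simp: dist_norm field_simps norm_minus_commute)
    then show False using disj that unfolding disjoint_family_on_def by blast
  qed
qed

text \<open>The three edges form a tree, so equal angles put all four centers on one line. The outermost centers
would be at distance at least \<open>6 * r\<close>, but centers have distance at most \<open>1 - r\<close> from the origin;
this forces \<open>8 * r \<le> 2\<close>.\<close>

lemma no_collinear_disks:
  assumes r: "r > 1/4" and x: "x \<in> topspace (disk_Conf 4 r)"
    and p: "p3 \<in> {1, 2}" "p4 \<in> {1, 2, 3}"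
  shows "\<not> (edge_angle 1 2 x = edge_angle p3 3 x \<and> edge_angle p3 3 x = edge_angle p4 4 x)"
proof
  assume eq: "edge_angle 1 2 x = edge_angle p3 3 x \<and> edge_angle p3 3 x = edge_angle p4 4 x"
  define d where "d = edge_angle 1 2 x"
  have r0: "0 < r" using r by simp
  note dist = disk_Conf_distances[OF x r0]
  have step: "x j = x i + of_real (norm (x j - x i)) * d" if "edge_angle i j x = d" for i j
    using that by (cases "x j = x i") (auto simp: edge_angle_def)
  have "norm (x 1 - x 2) > 0" using dist(2)[of 1 2] r0 by auto
  then have d: "norm d = 1" by (auto simp: d_def edge_angle_def norm_divide norm_minus_commute)
  define L where "L = {x 1 + of_real s * d | s. True}"
  have Lstep: "x j \<in> L" if i: "x i \<in> L" and j: "edge_angle i j x = d" for i j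
  proof -
    obtain s where "x i = x 1 + of_real s * d" using i unfolding L_def by blast
    then have "x j = x 1 + of_real (s + norm (x j - x i)) * d"
      using step[OF j] by (simp add: distrib_right add.assoc)
    then show ?thesis unfolding L_def by blast
  qed
  have "x 1 = x 1 + of_real 0 * d" by simp
  then have 1: "x 1 \<in> L" unfolding L_def by blast
  have 2: "x 2 \<in> L" by (rule Lstep[OF 1]) (simp add: d_def)
  have 3: "x 3 \<in> L" by (rule Lstep[of p3]) (use p 1 2 eq d_def in auto)
  have 4: "x 4 \<in> L" by (rule Lstep[of p4]) (use p 1 2 3 eq d_def in auto)
  have "\<exists>s. x i = x 1 + of_real s * d" if "i \<in> {1..4}" for i
  proof -
    have "i = 1 \<or> i = 2 \<or> i = 3 \<or> i = 4" using that by auto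
    then show ?thesis using 1 2 3 4 unfolding L_def by blast
  qed
  then obtain s where s: "\<And>i. i \<in> {1..4} \<Longrightarrow> x i = x 1 + of_real (s i) * d" by metis
  have diff: "norm (x i - x j) = \<bar>s i - s j\<bar>" if "i \<in> {1..4}" "j \<in> {1..4}" for i j
  proof -
    have "x i - x j = of_real (s i - s j) * d"
      using s[OF that(1)] s[OF that(2)] by (simp add: left_diff_distrib)
    then show ?thesis by (simp only: norm_mult norm_of_real d mult_1_right)
  qed
  have sep: "2 * r \<le> \<bar>s i - s j\<bar>" if "i \<in> {1..4}" "j \<in> {1..4}" "i \<noteq> j" for i j
    using dist(2)[OF that] unfolding diff[OF that(1,2)] .
  have near: "\<bar>s i - s j\<bar> \<le> 2 - 2 * r" if "i \<in> {1..4}" "j \<in> {1..4}" for i j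
    using dist(1)[OF that(1)] dist(1)[OF that(2)] norm_triangle_ineq4[of "x i" "x j"]
    unfolding diff[OF that] by linarith
  have near': "\<bar>a - b\<bar> \<le> 2 - 2 * r" if a: "a \<in> {s 1, s 2, s 3, s 4}" and b: "b \<in> {s 1, s 2, s 3, s 4}" for a b
  proof -
    have "{1..4} = {1, 2, 3, 4::nat}" by auto
    then have "a \<in> s ` {1..4}" "b \<in> s ` {1..4}" using a b by simp_all
    then show ?thesis using near by blast
  qed
  have "6 * r \<le> 2 - 2 * r"
    by (rule four_separated_reals[OF less_imp_le[OF r0] sep sep sep sep sep sep near']) auto
  then show False using r by simp
qed

section \<open>Planetary tori\<close>

text \<open>The positions of the vertices \<open>1, 2, 3\<close> when \<open>p3\<close> is the parent of \<open>3\<close>. The radii \<open>1/2\<close>, \<open>1/8\<close> and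
\<open>1/32\<close> of the successive orbits decrease fast enough that no two vertices ever meet, and they sum to less
than \<open>1\<close>.\<close>

definition inner_planet :: "nat \<Rightarrow> (nat \<Rightarrow> real) \<Rightarrow> nat \<Rightarrow> complex" where
  "inner_planet p3 t i = (if i = 1 then 0 else if i = 2 then turn (t 0) / 2
     else (if p3 = 1 then 0 else turn (t 0) / 2) + turn (t 1) / 8)"

definition planets :: "nat \<Rightarrow> nat \<Rightarrow> (nat \<Rightarrow> real) \<Rightarrow> nat \<Rightarrow> complex" where
  "planets p3 p4 t = (\<lambda>i\<in>{1..4}. if i = 4 then inner_planet p3 t p4 + turn (t 2) / 32 else inner_planet p3 t i)"

lemma planets_simps:
  "planets p3 p4 t 1 = inner_planet p3 t 1" "planets p3 p4 t 2 = inner_planet p3 t 2"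
  "planets p3 p4 t 3 = inner_planet p3 t 3" "planets p3 p4 t 4 = inner_planet p3 t p4 + turn (t 2) / 32"
  by (simp_all add: planets_def)

lemma norm_inner_planet: "norm (inner_planet p3 t i) \<le> 5 / 8"
proof -
  have "norm (turn (t 0) / 2 + turn (t 1) / 8) \<le> norm (turn (t 0) / 2) + norm (turn (t 1) / 8)"
    by (rule norm_triangle_ineq)
  then show ?thesis by (auto simp: inner_planet_def norm_divide)
qed

lemma inner_planets_apart:
  assumes "i \<in> {1, 2, 3}" "j \<in> {1, 2, 3}" "i \<noteq> j"
  shows "norm (inner_planet p3 t i - inner_planet p3 t j) \<ge> 1 / 8"
proof -
  have a: "norm (turn x / 2 + turn y / 8) \<ge> 1 / 8" for x y
    using norm_diff_ineq[of "turn x / 2" "turn y / 8"] by (simp add: norm_divide)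
  have b: "norm (turn x / 2 - turn y / 8) \<ge> 1 / 8" for x y
    using norm_triangle_ineq2[of "turn x / 2" "turn y / 8"] by (simp add: norm_divide)
  have b': "norm (turn y / 8 - turn x / 2) \<ge> 1 / 8" for x y
    using b[of x y] by (simp add: norm_minus_commute)
  have a': "norm (- (turn x / 2) - turn y / 8) \<ge> 1 / 8" for x y
  proof -
    have "- (turn x / 2) - turn y / 8 = - (turn x / 2 + turn y / 8)" by simp
    then show ?thesis using a[of x y] by (simp only: norm_minus_cancel)
  qed
  show ?thesis using assms a b a' b' by (auto simp: inner_planet_def norm_divide)
qed

lemma planets_apart:
  assumes p4: "p4 \<in> {1, 2, 3}" and ij: "i \<in> {1..4}" "j \<in> {1..4}" "i \<noteq> j"
  shows "planets p3 p4 t i \<noteq> planets p3 p4 t j"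
proof -
  have outer: "inner_planet p3 t p4 + turn (t 2) / 32 \<noteq> inner_planet p3 t i" if "i \<in> {1, 2, 3}" for i
  proof
    assume "inner_planet p3 t p4 + turn (t 2) / 32 = inner_planet p3 t i"
    then have "norm (inner_planet p3 t i - inner_planet p3 t p4) = norm (turn (t 2) / 32)"
      by (metis add_diff_cancel_left')
    then have "norm (inner_planet p3 t i - inner_planet p3 t p4) = 1 / 32" by (simp add: norm_divide)
    then show False using inner_planets_apart[OF that p4, of p3 t] by (cases "i = p4") auto
  qed
  have inner: "inner_planet p3 t i \<noteq> inner_planet p3 t j" if "i \<in> {1, 2, 3}" "j \<in> {1, 2, 3}" "i \<noteq> j" for i j
    using inner_planets_apart[OF that, of p3 t] by auto
  have "i = 4 \<or> i \<in> {1, 2, 3}" "j = 4 \<or> j \<in> {1, 2, 3}" using ij by auto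
  then show ?thesis using ij(3) outer inner outer[THEN not_sym] by (auto simp: planets_simps)
qed

lemma continuous_map_turn_coordinate: "continuous_map (powertop_real UNIV) euclidean (\<lambda>t. turn (t m) / c)"
proof -
  have "continuous_map euclideanreal euclidean (\<lambda>x. turn x / c)"
    using continuous_on_turn[of UNIV "\<lambda>x. x"] by (cases "c = 0") (auto intro!: continuous_intros)
  from continuous_map_compose[OF continuous_map_product_projection[of m UNIV "\<lambda>_. euclideanreal"] this]
  show ?thesis by (simp add: o_def)
qed

lemma continuous_map_planets:
  assumes p4: "p4 \<in> {1, 2, 3}"
  shows "continuous_map (powertop_real UNIV) (Conf 4) (planets p3 p4)"
proof -
  have inner: "continuous_map (powertop_real UNIV) euclidean (\<lambda>t. inner_planet p3 t i)" for i
    using continuous_map_turn_coordinate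
    by (cases "p3 = 1") (auto simp: inner_planet_def intro!: continuous_map_add)
  have "continuous_map (powertop_real UNIV) (top_of_set (cball 0 1)) (\<lambda>t. planets p3 p4 t i)" if "i \<in> {1..4}" for i
    unfolding continuous_map_in_subtopology
  proof
    show "continuous_map (powertop_real UNIV) euclidean (\<lambda>t. planets p3 p4 t i)"
      using that inner by (cases "i = 4") (auto simp: planets_def intro!: continuous_map_add continuous_map_turn_coordinate)
    have "norm (inner_planet p3 t p4 + turn (t 2) / 32) \<le> 1" for t
      using norm_triangle_ineq[of "inner_planet p3 t p4" "turn (t 2) / 32"] norm_inner_planet[of p3 t p4]
      by (simp add: norm_divide)
    moreover have "norm (inner_planet p3 t i) \<le> 1" for t using norm_inner_planet[of p3 t i] by linarith
    ultimately show "(\<lambda>t. planets p3 p4 t i) \<in> topspace (powertop_real UNIV) \<rightarrow> cball 0 1"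
      using that by (auto simp: planets_def)
  qed
  then have "continuous_map (powertop_real UNIV) (product_topology (\<lambda>_. top_of_set (cball 0 1)) {1..4}) (planets p3 p4)"
    by (auto simp: continuous_map_componentwise planets_def)
  moreover have "inj_on (planets p3 p4 t) {1..4}" for t
    unfolding inj_on_def using planets_apart[OF p4] by blast
  ultimately show ?thesis unfolding Conf_def continuous_map_in_subtopology by auto
qed

lemma planets_periodic:
  "planets p3 p4 (\<lambda>i. t i + (if i = m then 1 else 0)) = planets p3 p4 t"
  by (auto simp: planets_def inner_planet_def turn_add fun_eq_iff)

lemma edge_angle_circular_orbit:
  assumes "x j - x i = turn s / of_real \<rho>" "\<rho> > 0"
  shows "edge_angle i j x = turn s"
  using assms by (simp add: edge_angle_def norm_divide)

text \<open>The circle of radius \<open>1/\<rho>\<close> around \<open>A\<close> lies in a disk that does not contain the origin, and on that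
disk the direction has a continuous angle.\<close>

lemma small_circle_lift:
  assumes "0 < \<rho>" "1 / \<rho> < norm A"
  obtains L where "continuous_on {0..1} L" "L 1 = L (0::real)"
    "\<And>t. (A + turn t / of_real \<rho>) / of_real (norm (A + turn t / of_real \<rho>)) = turn (L t)"
proof -
  let ?B = "ball A (norm A)"
  have nz: "w \<noteq> 0" if "w \<in> ?B" for w using that by (auto simp: dist_norm)
  have "continuous_on ?B (\<lambda>w. w / of_real (norm w))" using nz by (auto intro!: continuous_intros)
  moreover have "norm (w / of_real (norm w)) = 1" if "w \<in> ?B" for w using nz[OF that] by (simp add: norm_divide)
  ultimately obtain M where M: "continuous_on ?B M" "\<And>w. w \<in> ?B \<Longrightarrow> w / of_real (norm w) = turn (M w)"
    using continuous_lift[of ?B "\<lambda>w. w / of_real (norm w)"] convex_ball by blast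
  have inB: "A + turn t / of_real \<rho> \<in> ?B" for t using assms by (simp add: dist_norm norm_divide)
  show ?thesis
  proof
    have "continuous_on {0..1} (\<lambda>t. A + turn t / of_real \<rho>)" using assms by (auto intro!: continuous_intros)
    then show "continuous_on {0..1} (\<lambda>t. M (A + turn t / of_real \<rho>))"
      using inB by (intro continuous_on_compose2[OF M(1)]) auto
    show "M (A + turn 1 / of_real \<rho>) = M (A + turn 0 / of_real \<rho>)" by simp
    show "(A + turn t / of_real \<rho>) / of_real (norm (A + turn t / of_real \<rho>)) = turn (M (A + turn t / of_real \<rho>))" for t
      by (rule M(2)[OF inB])
  qed
qed

lemma winding_small_circle:
  assumes "0 < \<rho>" "1 / \<rho> < norm A"
    and "\<And>t. t \<in> {0..1} \<Longrightarrow> edge_angle i j (E (\<lambda>m. p m * (1 - t) + q m * t)) =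
       (A + turn t / of_real \<rho>) / of_real (norm (A + turn t / of_real \<rho>))"
  shows "winding (edge_angle i j) (seg E p q) = 0"
proof -
  obtain L where L: "continuous_on {0..1} L" "L 1 = L (0::real)"
    "\<And>t. (A + turn t / of_real \<rho>) / of_real (norm (A + turn t / of_real \<rho>)) = turn (L t)"
    using small_circle_lift[OF assms(1,2)] by metis
  have "winding (edge_angle i j) (seg E p q) = \<lfloor>L 1\<rfloor> - \<lfloor>L 0\<rfloor>"
    by (rule winding_seg[OF L(1)]) (simp add: assms(3) L(3))
  then show ?thesis using L(2) by simp
qed

lemma winding_full_circle:
  assumes "\<And>t. t \<in> {0..1} \<Longrightarrow> u (E (\<lambda>m. p m * (1 - t) + q m * t)) = turn t"
  shows "winding u (seg E p q) = 1"
  using winding_seg[of "\<lambda>t. t" u E p q] assms by simp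

lemma winding_constant:
  assumes "norm z = 1" "\<And>t. t \<in> {0..1} \<Longrightarrow> u (E (\<lambda>m. p m * (1 - t) + q m * t)) = z"
  shows "winding u (seg E p q) = 0"
proof -
  obtain c where "turn c = z" using exists_turn[OF assms(1)] by blast
  then show ?thesis using winding_seg[of "\<lambda>t. c" u E p q] assms(2) by simp
qed

lemma torus_vertex_line [simp]:
  "torus_vertex x y z 0 = x" "torus_vertex x y z 1 = y" "torus_vertex x y z 2 = z"
  by (simp_all add: torus_vertex_def)

text \<open>The three angles depend on the first, the first two, and all three orbit parameters, so the matrix of
winding numbers is lower triangular and only the tetrahedron for the identity permutation contributes.
The angle of the edge into a vertex turns once along the orbit of this vertex if the edge starts at the
center of the orbit; otherwise the orbit is a small circle seen from a distant point.\<close>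

lemma torus_eval_forest:
  assumes p: "p3 \<in> {1, 2}" "p4 \<in> {1, 2, 3}" and q: "q3 \<in> {1, 2}" "q4 \<in> {1, 2, 3}"
  shows "torus_eval (planets p3 p4) (raw_cup 1 2 (winding (edge_angle 1 2)) (raw_cup 1 1 (winding (edge_angle q3 3)) (winding (edge_angle q4 4))))
    = (if p3 = q3 \<and> p4 = q4 then 1 else 0)"
proof -
  let ?E = "planets p3 p4"
  have norm1: "norm (edge_angle i j (?E t)) = 1" if "i \<in> {1..4}" "j \<in> {1..4}" "i \<noteq> j" for i j t
    using planets_apart[OF p(2) that(2,1) that(3)[symmetric], of p3 t] by (simp add: edge_angle_def norm_divide)
  have a12: "edge_angle 1 2 (?E t) = turn (t 0)" for t
    by (rule edge_angle_circular_orbit[of _ _ _ _ 2]) (simp_all add: planets_simps inner_planet_def)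
  have u0: "winding (edge_angle 1 2) (seg ?E (torus_vertex 0 0 0) (torus_vertex 1 0 0)) = 1"
    by (rule winding_full_circle) (simp add: a12)
  have u1: "winding (edge_angle 1 2) (seg ?E (torus_vertex 0 0 0) (torus_vertex 0 1 0)) = 0"
    "winding (edge_angle 1 2) (seg ?E (torus_vertex 0 0 0) (torus_vertex 0 0 1)) = 0"
    by (rule winding_constant[of 1]; simp add: a12)+
  have q3_inner: "?E t q3 = inner_planet p3 t q3" for t using q(1) by (auto simp: planets_simps)
  have diff3: "?E t 3 - ?E t q3 = (inner_planet p3 t p3 - inner_planet p3 t q3) + turn (t 1) / of_real 8" for t
    using p q by (auto simp: planets_simps inner_planet_def)
  have dep3: "inner_planet p3 t i = inner_planet p3 s i" if "t 0 = s 0" "t 1 = s 1" for t s i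
    using that by (simp add: inner_planet_def)
  have dep2: "inner_planet p3 t i = inner_planet p3 s i" if "t 0 = s 0" "i \<in> {1, 2}" for t s i
    using that by (auto simp: inner_planet_def)
  have v2: "winding (edge_angle q3 3) (seg ?E (torus_vertex 1 0 0) (torus_vertex 1 0 1)) = 0"
  proof (rule winding_constant[of "edge_angle q3 3 (?E (torus_vertex 1 0 0))"])
    show "norm (edge_angle q3 3 (?E (torus_vertex 1 0 0))) = 1" using q by (intro norm1) auto
    fix t :: real
    show "edge_angle q3 3 (?E (\<lambda>m. torus_vertex 1 0 0 m * (1 - t) + torus_vertex 1 0 1 m * t)) = edge_angle q3 3 (?E (torus_vertex 1 0 0))"
      unfolding edge_angle_def q3_inner planets_simps
      by (simp add: dep3[of "\<lambda>m. torus_vertex 1 0 0 m * (1 - t) + torus_vertex 1 0 1 m * t" "torus_vertex 1 0 0"])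
  qed
  have v1: "winding (edge_angle q3 3) (seg ?E (torus_vertex 1 0 0) (torus_vertex 1 1 0)) = (if p3 = q3 then 1 else 0)"
  proof (cases "p3 = q3")
    case True
    have "winding (edge_angle q3 3) (seg ?E (torus_vertex 1 0 0) (torus_vertex 1 1 0)) = 1"
    proof (rule winding_full_circle)
      fix t :: real
      let ?t = "\<lambda>m. torus_vertex 1 0 0 m * (1 - t) + torus_vertex 1 1 0 m * t"
      show "edge_angle q3 3 (?E ?t) = turn t"
      proof (rule edge_angle_circular_orbit[of _ _ _ _ 8])
        show "?E ?t 3 - ?E ?t q3 = turn t / of_real 8" unfolding diff3 by (simp add: True)
      qed simp
    qed
    then show ?thesis using True by simp
  next
    case False
    (* The center of the orbit, seen from the vertex at which the edge starts; it does not
       move along this orbit. *)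
    let ?A = "inner_planet p3 (torus_vertex 1 0 0) p3 - inner_planet p3 (torus_vertex 1 0 0) q3"
    have "winding (edge_angle q3 3) (seg ?E (torus_vertex 1 0 0) (torus_vertex 1 1 0)) = 0"
    proof (rule winding_small_circle[of 8 ?A])
      have "p3 = 1 \<and> q3 = 2 \<or> p3 = 2 \<and> q3 = 1" using p(1) q(1) False by blast
      then have "norm ?A = 1 / 2" by (elim disjE conjE) (simp_all add: inner_planet_def norm_divide)
      then show "1 / 8 < norm ?A" by simp
      fix t :: real
      let ?t = "\<lambda>m. torus_vertex 1 0 0 m * (1 - t) + torus_vertex 1 1 0 m * t"
      have "?E ?t 3 - ?E ?t q3 = ?A + turn t / of_real 8"
        unfolding diff3 using dep2[of ?t "torus_vertex 1 0 0" p3, OF _ p(1)] dep2[of ?t "torus_vertex 1 0 0" q3, OF _ q(1)] by simp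
      then show "edge_angle q3 3 (?E ?t) = (?A + turn t / of_real 8) / of_real (norm (?A + turn t / of_real 8))"
        unfolding edge_angle_def by (simp only:)
    qed simp
    then show ?thesis using False by simp
  qed
  have q4_inner: "?E t q4 = inner_planet p3 t q4" for t using q(2) by (auto simp: planets_simps)
  have diff4: "?E t 4 - ?E t q4 = (inner_planet p3 t p4 - inner_planet p3 t q4) + turn (t 2) / of_real 32" for t
    unfolding q4_inner planets_simps by simp
  have w: "winding (edge_angle q4 4) (seg ?E (torus_vertex 1 1 0) (torus_vertex 1 1 1)) = (if p4 = q4 then 1 else 0)"
  proof (cases "p4 = q4")
    case True
    have "winding (edge_angle q4 4) (seg ?E (torus_vertex 1 1 0) (torus_vertex 1 1 1)) = 1"
    proof (rule winding_full_circle)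
      fix t :: real
      let ?t = "\<lambda>m. torus_vertex 1 1 0 m * (1 - t) + torus_vertex 1 1 1 m * t"
      show "edge_angle q4 4 (?E ?t) = turn t"
      proof (rule edge_angle_circular_orbit[of _ _ _ _ 32])
        show "?E ?t 4 - ?E ?t q4 = turn t / of_real 32" unfolding diff4 by (simp add: True)
      qed simp
    qed
    then show ?thesis using True by simp
  next
    case False
    let ?A = "inner_planet p3 (torus_vertex 1 1 0) p4 - inner_planet p3 (torus_vertex 1 1 0) q4"
    have "winding (edge_angle q4 4) (seg ?E (torus_vertex 1 1 0) (torus_vertex 1 1 1)) = 0"
    proof (rule winding_small_circle[of 32 ?A])
      show "1 / 32 < norm ?A" using inner_planets_apart[OF p(2) q(2) False, of p3 "torus_vertex 1 1 0"] by simp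
      fix t :: real
      let ?t = "\<lambda>m. torus_vertex 1 1 0 m * (1 - t) + torus_vertex 1 1 1 m * t"
      have "?E ?t 4 - ?E ?t q4 = ?A + turn t / of_real 32"
        unfolding diff4 by (simp add: dep3[of ?t "torus_vertex 1 1 0"])
      then show "edge_angle q4 4 (?E ?t) = (?A + turn t / of_real 32) / of_real (norm (?A + turn t / of_real 32))"
        unfolding edge_angle_def by (simp only:)
    qed simp
    then show ?thesis using False by simp
  qed
  show ?thesis
    unfolding torus_eval_def cup3_tetra u0 u1 v1 v2 w by simp
qed

section \<open>The three-edge forests on four vertices\<close>

text \<open>The trees on \<open>{1..4}\<close> are given by the parents \<open>p\<close> of \<open>3\<close> and \<open>q\<close> of \<open>4\<close>. The edges are listed in increasing
order of their terminal endpoints.\<close>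

definition tree_edges :: "nat \<Rightarrow> nat \<Rightarrow> (nat \<times> nat) list" where
  "tree_edges p q = [(1, 2), (p, 3), (q, 4)]"

lemma tree_edges_ordered_forest:
  assumes "p \<in> {1, 2}" "q \<in> {1, 2, 3}"
  shows "ordered_forest 4 (set (tree_edges p q)) \<and> card (set (tree_edges p q)) = 3"
proof
  have "{i. (i, j) \<in> set (tree_edges p q)} \<subseteq> {if j = 2 then 1 else if j = 3 then p else q}" for j
    by (auto simp: tree_edges_def)
  from card_mono[OF _ this] have "card {i. (i, j) \<in> set (tree_edges p q)} \<le> 1" for j by (simp add: One_nat_def)
  then show "ordered_forest 4 (set (tree_edges p q))"
    using assms by (auto simp: ordered_forest_def tree_edges_def)
qed (simp add: tree_edges_def)

text \<open>The vertex \<open>1\<close> has no parent, so three edges mean that each of the other vertices has one.\<close>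

lemma ordered_forest_3_edges:
  assumes "ordered_forest 4 G" "card G = 3"
  obtains p q where "p \<in> {1, 2}" "q \<in> {1, 2, 3}" "G = set (tree_edges p q)"
proof -
  have sub: "G \<subseteq> {1..4} \<times> {1..4}" and less: "\<And>i j. (i, j) \<in> G \<Longrightarrow> i < j"
    and deg: "\<And>j. card {i. (i, j) \<in> G} \<le> 1"
    using assms(1) by (auto simp: ordered_forest_def)
  have fin: "finite G" using assms(2) card.infinite by fastforce
  have uniq: "i = i'" if "(i, j) \<in> G" "(i', j) \<in> G" for i i' j
  proof -
    have "finite {i. (i, j) \<in> G}" by (rule finite_subset[of _ "{1..4}"]) (use sub in auto)
    then show ?thesis using deg[of j] that by (auto simp: card_le_Suc0_iff_eq One_nat_def)
  qed
  have "inj_on snd G" using uniq by (auto simp: inj_on_def)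
  then have c: "card (snd ` G) = 3" using assms(2) by (simp add: card_image)
  have "snd ` G \<subseteq> {2, 3, 4}"
  proof
    fix j assume "j \<in> snd ` G"
    then obtain i where "(i, j) \<in> G" by auto
    then have "i \<ge> 1" "i < j" "j \<le> 4" using sub less by auto
    then show "j \<in> {2, 3, 4}" by auto
  qed
  then have img: "snd ` G = {2, 3, 4}" using c by (intro card_subset_eq) auto
  then have "2 \<in> snd ` G" "3 \<in> snd ` G" "4 \<in> snd ` G" by auto
  then obtain a p q where e: "(a, 2) \<in> G" "(p, 3) \<in> G" "(q, 4) \<in> G" by auto
  have "1 \<le> a" "a < 2" "1 \<le> p" "p < 3" "1 \<le> q" "q < 4" using e sub less by auto
  then have r: "a = 1" "p \<in> {1, 2}" "q \<in> {1, 2, 3}" by auto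
  have "G = {(a, 2), (p, 3), (q, 4)}"
  proof
    show "G \<subseteq> {(a, 2), (p, 3), (q, 4)}"
    proof
      fix x assume x: "x \<in> G"
      then have "snd x \<in> {2, 3, 4}" using img by blast
      then show "x \<in> {(a, 2), (p, 3), (q, 4)}" using x e uniq by (cases x) auto
    qed
  qed (use e in auto)
  then show ?thesis using that r by (simp add: tree_edges_def)
qed

lemma forests_eq:
  "{G. ordered_forest 4 G \<and> card G = 3} = (\<lambda>(p, q). set (tree_edges p q)) ` ({1, 2} \<times> {1, 2, 3})"
proof (intro equalityI subsetI)
  fix G assume "G \<in> {G. ordered_forest 4 G \<and> card G = 3}"
  then obtain p q where "p \<in> {1, 2}" "q \<in> {1, 2, 3}" "G = set (tree_edges p q)"
    using ordered_forest_3_edges by blast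
  then show "G \<in> (\<lambda>(p, q). set (tree_edges p q)) ` ({1, 2} \<times> {1, 2, 3})" by blast
next
  fix G assume "G \<in> (\<lambda>(p, q). set (tree_edges p q)) ` ({1, 2} \<times> {1, 2, 3})"
  then obtain p q where "p \<in> {1, 2}" "q \<in> {1, 2, 3}" "G = set (tree_edges p q)" by blast
  then show "G \<in> {G. ordered_forest 4 G \<and> card G = 3}" using tree_edges_ordered_forest by blast
qed

lemma tree_edges_inject: "set (tree_edges p q) = set (tree_edges p' q') \<longleftrightarrow> p = p' \<and> q = q'"
proof
  assume eq: "set (tree_edges p q) = set (tree_edges p' q')"
  have "(p, 3) \<in> set (tree_edges p q)" "(q, 4) \<in> set (tree_edges p q)" by (simp_all add: tree_edges_def)
  then have "(p, 3) \<in> set (tree_edges p' q')" "(q, 4) \<in> set (tree_edges p' q')" by (simp_all only: eq)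
  then show "p = p' \<and> q = q'" by (auto simp: tree_edges_def)
qed simp

lemma card_forests: "card {G. ordered_forest 4 G \<and> card G = 3} = 6"
proof -
  have "inj_on (\<lambda>(p, q). set (tree_edges p q)) ({1, 2} \<times> {1, 2, 3})"
    by (auto simp: inj_on_def tree_edges_inject)
  then show ?thesis unfolding forests_eq by (simp add: card_image card_cartesian_product)
qed

definition tree_cochain :: "nat \<Rightarrow> nat \<Rightarrow> (nat \<Rightarrow> complex) cochain" where
  "tree_cochain p q = raw_cup 1 2 (winding (edge_angle 1 2)) (raw_cup 1 1 (winding (edge_angle p 3)) (winding (edge_angle q 4)))"

definition subtree_cochain :: "nat \<Rightarrow> nat \<Rightarrow> (nat \<Rightarrow> complex) cochain" where
  "subtree_cochain p q = alt_cup (winding (edge_angle 1 2)) (winding (edge_angle p 3)) (winding (edge_angle q 4))"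

lemma is_cocycle_edge_angle:
  "i \<in> {1..n} \<Longrightarrow> j \<in> {1..n} \<Longrightarrow> i \<noteq> j \<Longrightarrow> is_cocycle 1 (Conf n) (winding (edge_angle i j))"
  by (intro is_cocycle_winding continuous_map_edge_angle)

lemma tree_edge_angle_cocycles:
  assumes "p \<in> {1, 2}" "q \<in> {1, 2, 3}"
  shows "is_cocycle 1 (Conf 4) (winding (edge_angle 1 2))" "is_cocycle 1 (Conf 4) (winding (edge_angle p 3))"
    "is_cocycle 1 (Conf 4) (winding (edge_angle q 4))"
  using assms by (auto intro!: is_cocycle_edge_angle)

lemma is_cocycle_tree:
  assumes "p \<in> {1, 2}" "q \<in> {1, 2, 3}"
  shows "is_cocycle 3 (Conf 4) (tree_cochain p q)"
proof -
  have "is_cocycle (1 + (1 + 1)) (Conf 4) (raw_cup 1 (1 + 1) (winding (edge_angle 1 2)) (raw_cup 1 1 (winding (edge_angle p 3)) (winding (edge_angle q 4))))"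
    by (intro is_cocycle_raw_cup tree_edge_angle_cocycles[OF assms])
  then show ?thesis by (simp add: tree_cochain_def)
qed

lemma is_cocycle_subtree:
  assumes "p \<in> {1, 2}" "q \<in> {1, 2, 3}"
  shows "is_cocycle 2 (Conf 4) (subtree_cochain p q)"
  unfolding subtree_cochain_def by (intro is_cocycle_alt_cup tree_edge_angle_cocycles[OF assms])

lemma forest_class_tree:
  assumes pq: "p \<in> {1, 2}" "q \<in> {1, 2, 3}"
  shows "forest_class (cohomology_class 1 circle (\<lambda>\<sigma>. k * wind \<sigma>)) 4 (set (tree_edges p q))
    = homogeneous 3 (Conf 4) (cohomology_class 3 (Conf 4) (\<lambda>\<sigma>. k ^ 3 * tree_cochain p q \<sigma>))"
proof -
  let ?es = "tree_edges p q"
  have edges: "i \<in> {1..4} \<and> j \<in> {1..4} \<and> i \<noteq> j" if "(i, j) \<in> set ?es" for i j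
  proof -
    have "(i, j) = (1, 2) \<or> (i, j) = (p, 3) \<or> (i, j) = (q, 4)" using that by (simp add: tree_edges_def)
    moreover have "1 \<le> p" "p < 3" "1 \<le> q" "q < 4" using pq by auto
    ultimately show ?thesis by (elim disjE) simp_all
  qed
  have "forest_class (cohomology_class 1 circle (\<lambda>\<sigma>. k * wind \<sigma>)) 4 (set ?es)
    = homogeneous (length ?es) (Conf 4) (cohomology_class (length ?es) (Conf 4)
        (cup_list (map (\<lambda>(i, j) \<sigma>. k * wind (simplex_map 1 (edge_angle i j) \<sigma>)) ?es)))"
    by (rule forest_class_eq[OF _ edges is_cocycle_cmul[OF is_cocycle_wind]]) (simp add: tree_edges_def)
  also have "length ?es = 3" by (simp add: tree_edges_def)
  also have "cohomology_class 3 (Conf 4) (cup_list (map (\<lambda>(i, j) \<sigma>. k * wind (simplex_map 1 (edge_angle i j) \<sigma>)) (tree_edges p q)))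
    = cohomology_class 3 (Conf 4) (\<lambda>\<sigma>. k ^ 3 * tree_cochain p q \<sigma>)"
    unfolding tree_edges_def list.map prod.case
    by (intro cohomology_class_eqI is_coboundary_zero, subst cup_list_3)
      (simp_all add: raw_cup_def tree_cochain_def winding_def power3_eq_cube)
  finally show ?thesis .
qed

lemma forest_class_pair:
  assumes "i \<in> {1..4}" "j \<in> {1..4}" "i \<noteq> j" "i' \<in> {1..4}" "j' \<in> {1..4}" "i' \<noteq> j'" "j < j'"
  shows "forest_class (cohomology_class 1 circle (\<lambda>\<sigma>. k * wind \<sigma>)) 4 {(i, j), (i', j')}
    = homogeneous 2 (Conf 4) (cohomology_class 2 (Conf 4) (\<lambda>\<sigma>. k\<^sup>2 * raw_cup 1 1 (winding (edge_angle i j)) (winding (edge_angle i' j')) \<sigma>))"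
proof -
  let ?es = "[(i, j), (i', j')]"
  have "forest_class (cohomology_class 1 circle (\<lambda>\<sigma>. k * wind \<sigma>)) 4 (set ?es)
    = homogeneous (length ?es) (Conf 4) (cohomology_class (length ?es) (Conf 4)
        (cup_list (map (\<lambda>(i, j) \<sigma>. k * wind (simplex_map 1 (edge_angle i j) \<sigma>)) ?es)))"
    by (rule forest_class_eq) (use assms is_cocycle_cmul[OF is_cocycle_wind] in auto)
  moreover have "length ?es = 2" by simp
  moreover have "cohomology_class 2 (Conf 4) (cup_list (map (\<lambda>(i, j) \<sigma>. k * wind (simplex_map 1 (edge_angle i j) \<sigma>)) ?es))
    = cohomology_class 2 (Conf 4) (\<lambda>\<sigma>. k\<^sup>2 * raw_cup 1 1 (winding (edge_angle i j)) (winding (edge_angle i' j')) \<sigma>)"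
    unfolding list.map prod.case
    by (intro cohomology_class_eqI is_coboundary_zero, subst cup_list_2)
      (simp_all add: raw_cup_def winding_def power2_eq_square)
  ultimately show ?thesis by (simp only: list.set)
qed

lemma subforest_sum_tree:
  assumes pq: "p \<in> {1, 2}" "q \<in> {1, 2, 3}"
  shows "subforest_sum (cohomology_class 1 circle (\<lambda>\<sigma>. k * wind \<sigma>)) 4 (set (tree_edges p q))
    = homogeneous 2 (Conf 4) (cohomology_class 2 (Conf 4) (\<lambda>\<sigma>. k\<^sup>2 * subtree_cochain p q \<sigma>))"
proof -
  let ?X = "Conf 4" and ?d = "cohomology_class 1 circle (\<lambda>\<sigma>. k * wind \<sigma>)"
  let ?T = "total_cohomology ?X" and ?H = "cohomology_group 2 ?X"
  define c where "c i j i' j' = (\<lambda>\<sigma>. k\<^sup>2 * raw_cup 1 1 (winding (edge_angle i j)) (winding (edge_angle i' j')) \<sigma>)" for i j i' j'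
  interpret h: group_hom ?H ?T "homogeneous 2 ?X"
    using comm_group_total_cohomology[of ?X]
    by (simp add: group_hom_def group_hom_axioms_def group_cohomology_group homogeneous_hom comm_group_def)
  have el: "edge_list (set (tree_edges p q)) = tree_edges p q"
    by (rule edge_list_set) (simp add: tree_edges_def)
  have cup: "is_cocycle 2 ?X (\<lambda>\<sigma>. k\<^sup>2 * raw_cup 1 1 a b \<sigma>)" if "is_cocycle 1 ?X a" "is_cocycle 1 ?X b" for a b
    using is_cocycle_cmul[OF is_cocycle_raw_cup[OF that]] by simp
  note coc = cup[OF tree_edge_angle_cocycles(2,3)[OF pq], folded c_def]
    cup[OF tree_edge_angle_cocycles(1,3)[OF pq], folded c_def] cup[OF tree_edge_angle_cocycles(1,2)[OF pq], folded c_def]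
  have neg: "is_cocycle 2 ?X (\<lambda>\<sigma>. - c 1 2 q 4 \<sigma>)" using is_cocycle_cmul[OF coc(2), of "-1"] by simp
  have r: "(1::nat) \<in> {1..4}" "(2::nat) \<in> {1..4}" "(3::nat) \<in> {1..4}" "(4::nat) \<in> {1..4}"
    "p \<in> {1..4}" "q \<in> {1..4}" "p \<noteq> 3" "q \<noteq> 4" using pq by auto
  have f: "forest_class ?d 4 {(p, 3), (q, 4)} = homogeneous 2 ?X (cohomology_class 2 ?X (c p 3 q 4))"
    "forest_class ?d 4 {(1, 2), (q, 4)} = homogeneous 2 ?X (cohomology_class 2 ?X (c 1 2 q 4))"
    "forest_class ?d 4 {(1, 2), (p, 3)} = homogeneous 2 ?X (cohomology_class 2 ?X (c 1 2 p 3))"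
    unfolding c_def by (rule forest_class_pair; use r in simp)+
  have "subforest_sum ?d 4 (set (tree_edges p q))
      = forest_class ?d 4 {(p, 3), (q, 4)} \<otimes>\<^bsub>?T\<^esub> inv\<^bsub>?T\<^esub> forest_class ?d 4 {(1, 2), (q, 4)}
        \<otimes>\<^bsub>?T\<^esub> forest_class ?d 4 {(1, 2), (p, 3)}"
    unfolding subforest_sum_def Let_def el by (simp add: tree_edges_def numeral_2_eq_2 One_nat_def)
  also have "\<dots> = homogeneous 2 ?X (cohomology_class 2 ?X (c p 3 q 4)
      \<otimes>\<^bsub>?H\<^esub> inv\<^bsub>?H\<^esub> cohomology_class 2 ?X (c 1 2 q 4) \<otimes>\<^bsub>?H\<^esub> cohomology_class 2 ?X (c 1 2 p 3))"
    unfolding f by (simp only: coc[THEN cohomology_class_closed] h.hom_mult h.hom_inv h.G.m_closed h.G.inv_closed)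
  also have "cohomology_class 2 ?X (c p 3 q 4)
      \<otimes>\<^bsub>?H\<^esub> inv\<^bsub>?H\<^esub> cohomology_class 2 ?X (c 1 2 q 4) \<otimes>\<^bsub>?H\<^esub> cohomology_class 2 ?X (c 1 2 p 3)
      = cohomology_class 2 ?X (\<lambda>\<sigma>. c p 3 q 4 \<sigma> + - c 1 2 q 4 \<sigma> + c 1 2 p 3 \<sigma>)"
    using coc neg by (simp only: inv_cohomology_group mult_cohomology_group is_cocycle_add)
  also have "(\<lambda>\<sigma>. c p 3 q 4 \<sigma> + - c 1 2 q 4 \<sigma> + c 1 2 p 3 \<sigma>) = (\<lambda>\<sigma>. k\<^sup>2 * subtree_cochain p q \<sigma>)"
    by (simp add: c_def subtree_cochain_def alt_cup_def fun_eq_iff algebra_simps)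
  finally show ?thesis .
qed

lemma homogeneous_in_kernel:
  assumes f: "continuous_map X Y f" and a: "is_cocycle p Y a"
    and zero: "is_coboundary p X (\<lambda>\<sigma>. a (simplex_map p f \<sigma>))"
  shows "homogeneous p Y (cohomology_class p Y a)
    \<in> kernel (total_cohomology Y) (total_cohomology X) (total_pullback X f)"
  using zero homogeneous_one[of p X]
  by (simp add: kernel_def homogeneous_closed cohomology_class_closed[OF a] total_pullback_homogeneous[OF f]
      cohomology_class_eq_one_iff[THEN iffD2])

lemma trees_in_kernel:
  assumes r: "r > 1/4" and pq: "p \<in> {1, 2}" "q \<in> {1, 2, 3}"
  shows "homogeneous 3 (Conf 4) (cohomology_class 3 (Conf 4) (\<lambda>\<sigma>. m * tree_cochain p q \<sigma>))
      \<in> kernel (total_cohomology (Conf 4)) (total_cohomology (disk_Conf 4 r)) (total_pullback (disk_Conf 4 r) id)"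
    and "homogeneous 2 (Conf 4) (cohomology_class 2 (Conf 4) (\<lambda>\<sigma>. m * subtree_cochain p q \<sigma>))
      \<in> kernel (total_cohomology (Conf 4)) (total_cohomology (disk_Conf 4 r)) (total_pullback (disk_Conf 4 r) id)"
proof -
  let ?X = "disk_Conf 4 r"
  have id: "continuous_map ?X (Conf 4) id"
    unfolding disk_Conf_def by (simp add: continuous_map_from_subtopology)
  have cont: "continuous_map ?X circle (edge_angle i j)" if "i \<in> {1..4}" "j \<in> {1..4}" "i \<noteq> j" for i j
    unfolding disk_Conf_def by (intro continuous_map_from_subtopology continuous_map_edge_angle that)
  have c: "continuous_map ?X circle (edge_angle 1 2)" "continuous_map ?X circle (edge_angle p 3)" "continuous_map ?X circle (edge_angle q 4)"
    using pq by (auto intro!: cont)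
  have ne: "\<not> (edge_angle 1 2 x = edge_angle p 3 x \<and> edge_angle p 3 x = edge_angle q 4 x)" if "x \<in> topspace ?X" for x
    by (rule no_collinear_disks[OF r that pq])
  have pull: "is_coboundary d ?X (\<lambda>\<sigma>. m * a (simplex_map d id \<sigma>))" if a: "is_coboundary d ?X a" for d a
    using is_coboundary_cmul[OF a, of m]
    by (rule is_coboundary_cong) (use simplex_map_id_gen[of d ?X _ id] in simp)
  show "homogeneous 3 (Conf 4) (cohomology_class 3 (Conf 4) (\<lambda>\<sigma>. m * tree_cochain p q \<sigma>))
      \<in> kernel (total_cohomology (Conf 4)) (total_cohomology ?X) (total_pullback ?X id)"
    by (rule homogeneous_in_kernel[OF id is_cocycle_cmul[OF is_cocycle_tree[OF pq]] pull])
      (unfold tree_cochain_def, rule cup3_winding_coboundary[OF c ne])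
  show "homogeneous 2 (Conf 4) (cohomology_class 2 (Conf 4) (\<lambda>\<sigma>. m * subtree_cochain p q \<sigma>))
      \<in> kernel (total_cohomology (Conf 4)) (total_cohomology ?X) (total_pullback ?X id)"
    by (rule homogeneous_in_kernel[OF id is_cocycle_cmul[OF is_cocycle_subtree[OF pq]] pull])
      (unfold subtree_cochain_def, rule alt_cup_winding_coboundary[OF c ne])
qed

text \<open>A functional on cohomology in degree \<open>d\<close>, composed with the projection to this degree.\<close>

lemma degree_functional:
  fixes \<phi> :: "'a cochain \<Rightarrow> int"
  assumes "\<And>a b. \<phi> (\<lambda>\<sigma>. a \<sigma> + b \<sigma>) = \<phi> a + \<phi> b" "\<And>a. is_coboundary d X a \<Longrightarrow> \<phi> a = 0"
  shows "\<exists>\<Phi>\<in>hom (total_cohomology X) integer_group.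
    (\<forall>a. is_cocycle d X a \<longrightarrow> \<Phi> (homogeneous d X (cohomology_class d X a)) = \<phi> a) \<and>
    (\<forall>e A. e \<noteq> d \<longrightarrow> \<Phi> (homogeneous e X A) = 0)"
proof -
  obtain \<Phi> where \<Phi>: "\<Phi> \<in> hom (cohomology_group d X) integer_group"
    "\<And>a. is_cocycle d X a \<Longrightarrow> \<Phi> (cohomology_class d X a) = \<phi> a"
    using cohomology_functional[of \<phi> d X] assms by blast
  show ?thesis
  proof (intro bexI[of _ "\<Phi> \<circ> (\<lambda>x. x d)"] conjI allI impI)
    show "\<Phi> \<circ> (\<lambda>x. x d) \<in> hom (total_cohomology X) integer_group"
      by (rule hom_compose[OF degree_projection_hom \<Phi>(1)])
    show "(\<Phi> \<circ> (\<lambda>x. x d)) (homogeneous d X (cohomology_class d X a)) = \<phi> a" if "is_cocycle d X a" for a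
      using \<Phi>(2)[OF that] by (simp add: homogeneous_def)
    have "\<Phi> \<one>\<^bsub>cohomology_group d X\<^esub> = 0"
      using hom_one[OF \<Phi>(1) group_cohomology_group group_integer_group] by simp
    then show "(\<Phi> \<circ> (\<lambda>x. x d)) (homogeneous e X A) = 0" if "e \<noteq> d" for e A
      using that by (simp add: homogeneous_def)
  qed
qed

lemma torus_eval_coboundary_planets:
  "p4 \<in> {1, 2, 3} \<Longrightarrow> is_coboundary 3 (Conf 4) a \<Longrightarrow> torus_eval (planets p3 p4) a = 0"
  by (rule torus_eval_coboundary[OF continuous_map_planets planets_periodic])

text \<open>Evaluation on the planetary torus of a tree.\<close>

lemma tree_functional:
  assumes pq: "p \<in> {1, 2}" "q \<in> {1, 2, 3}"
  shows "\<exists>\<Phi>\<in>hom (total_cohomology (Conf 4)) integer_group.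
    (\<forall>p' q' m. p' \<in> {1, 2} \<longrightarrow> q' \<in> {1, 2, 3} \<longrightarrow>
      \<Phi> (homogeneous 3 (Conf 4) (cohomology_class 3 (Conf 4) (\<lambda>\<sigma>. m * tree_cochain p' q' \<sigma>)))
        = (if p = p' \<and> q = q' then m else 0)) \<and>
    (\<forall>A. \<Phi> (homogeneous 2 (Conf 4) A) = 0)"
proof -
  let ?X = "Conf 4" and ?\<tau> = "torus_eval (planets p q)"
  obtain \<Phi> where \<Phi>: "\<Phi> \<in> hom (total_cohomology ?X) integer_group"
    "\<forall>a. is_cocycle 3 ?X a \<longrightarrow> \<Phi> (homogeneous 3 ?X (cohomology_class 3 ?X a)) = ?\<tau> a"
    "\<forall>e A. e \<noteq> 3 \<longrightarrow> \<Phi> (homogeneous e ?X A) = 0"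
    using degree_functional[of ?\<tau> 3 ?X, OF torus_eval_add torus_eval_coboundary_planets[OF pq(2)]] by blast
  have "\<Phi> (homogeneous 3 ?X (cohomology_class 3 ?X (\<lambda>\<sigma>. m * tree_cochain p' q' \<sigma>))) = (if p = p' \<and> q = q' then m else 0)"
    if pq': "p' \<in> {1, 2}" "q' \<in> {1, 2, 3}" for p' q' m
  proof -
    have "is_cocycle 3 ?X (\<lambda>\<sigma>. m * tree_cochain p' q' \<sigma>)" by (intro is_cocycle_cmul is_cocycle_tree[OF pq'])
    with \<Phi>(2) have "\<Phi> (homogeneous 3 ?X (cohomology_class 3 ?X (\<lambda>\<sigma>. m * tree_cochain p' q' \<sigma>)))
        = m * ?\<tau> (tree_cochain p' q')" unfolding torus_eval_cmul[symmetric] by blast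
    then show ?thesis unfolding tree_cochain_def torus_eval_forest[OF pq pq'] by simp
  qed
  then show ?thesis using \<Phi>(1,3) by (intro bexI[of _ \<Phi>]) auto
qed

text \<open>Multiplication by the class of the common edge \<open>1 \<rightarrow> 2\<close> sends the signed sum of every tree to the class of
that tree, so evaluation on the planetary torus after this multiplication is dual to the signed
sums.\<close>

lemma subtree_functional:
  assumes pq: "p \<in> {1, 2}" "q \<in> {1, 2, 3}"
  shows "\<exists>\<Phi>\<in>hom (total_cohomology (Conf 4)) integer_group.
    (\<forall>p' q' m. p' \<in> {1, 2} \<longrightarrow> q' \<in> {1, 2, 3} \<longrightarrow>
      \<Phi> (homogeneous 2 (Conf 4) (cohomology_class 2 (Conf 4) (\<lambda>\<sigma>. m * subtree_cochain p' q' \<sigma>)))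
        = (if p = p' \<and> q = q' then m else 0)) \<and>
    (\<forall>A. \<Phi> (homogeneous 3 (Conf 4) A) = 0)"
proof -
  let ?X = "Conf 4" and ?\<tau> = "torus_eval (planets p q)"
  let ?w = "winding (edge_angle 1 2) :: (nat \<Rightarrow> complex) cochain"
  define \<psi> where "\<psi> a = ?\<tau> (raw_cup 1 2 ?w a)" for a
  note zero = torus_eval_coboundary_planets[OF pq(2)]
  have add: "\<psi> (\<lambda>\<sigma>. a \<sigma> + b \<sigma>) = \<psi> a + \<psi> b" for a b
    unfolding \<psi>_def torus_eval_add[symmetric] by (simp add: raw_cup_def[abs_def] distrib_left)
  have cob: "\<psi> a = 0" if "is_coboundary 2 ?X a" for a
    using is_coboundary_raw_cup_right[OF tree_edge_angle_cocycles(1)[OF pq] that] unfolding \<psi>_def by (intro zero) simp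
  obtain \<Phi> where \<Phi>: "\<Phi> \<in> hom (total_cohomology ?X) integer_group"
    "\<forall>a. is_cocycle 2 ?X a \<longrightarrow> \<Phi> (homogeneous 2 ?X (cohomology_class 2 ?X a)) = \<psi> a"
    "\<forall>e A. e \<noteq> 2 \<longrightarrow> \<Phi> (homogeneous e ?X A) = 0"
    using degree_functional[of \<psi> 2 ?X, OF add cob] by blast
  have "\<Phi> (homogeneous 2 ?X (cohomology_class 2 ?X (\<lambda>\<sigma>. m * subtree_cochain p' q' \<sigma>))) = (if p = p' \<and> q = q' then m else 0)"
    if pq': "p' \<in> {1, 2}" "q' \<in> {1, 2, 3}" for p' q' m
  proof -
    let ?s = "subtree_cochain p' q'" and ?t = "tree_cochain p' q'"
    have "is_cocycle 2 ?X (\<lambda>\<sigma>. m * ?s \<sigma>)" by (intro is_cocycle_cmul is_cocycle_subtree[OF pq'])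
    with \<Phi>(2) have "\<Phi> (homogeneous 2 ?X (cohomology_class 2 ?X (\<lambda>\<sigma>. m * ?s \<sigma>))) = \<psi> (\<lambda>\<sigma>. m * ?s \<sigma>)" by blast
    also have "\<dots> = m * \<psi> ?s"
      unfolding \<psi>_def torus_eval_cmul[symmetric] by (simp add: raw_cup_def[abs_def] mult.left_commute)
    also have "\<psi> ?s = ?\<tau> ?t"
    proof -
      have "?\<tau> (\<lambda>\<sigma>. raw_cup 1 2 ?w ?s \<sigma> - ?t \<sigma>) = 0"
        unfolding subtree_cochain_def tree_cochain_def
        by (rule zero[OF cup_first_alt_cup[OF tree_edge_angle_cocycles[OF pq']]])
      then show ?thesis
        using torus_eval_add[of "planets p q" "\<lambda>\<sigma>. raw_cup 1 2 ?w ?s \<sigma> - ?t \<sigma>" ?t] by (simp add: \<psi>_def)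
    qed
    finally show ?thesis unfolding tree_cochain_def torus_eval_forest[OF pq pq'] by simp
  qed
  then show ?thesis using \<Phi>(1,3) by (intro bexI[of _ \<Phi>]) auto
qed

theorem lemma21:
  fixes r :: real and d\<theta> :: "complex cochain set" and F :: "(nat \<times> nat) set set"
  assumes "r > 1/4"
    and "circle_generator d\<theta>"
    and "F = {G. ordered_forest 4 G \<and> card G = 3}"
  shows "card F = 6
    \<and> (\<forall>G\<in>F.
          forest_class d\<theta> 4 G \<in>
            kernel (total_cohomology (Conf 4)) (total_cohomology (disk_Conf 4 r))
              (total_pullback (disk_Conf 4 r) id)
        \<and> subforest_sum d\<theta> 4 G \<in>
            kernel (total_cohomology (Conf 4)) (total_cohomology (disk_Conf 4 r))
              (total_pullback (disk_Conf 4 r) id))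
    \<and> int_independent (total_cohomology (Conf 4)) (F <+> F)
        (case_sum (forest_class d\<theta> 4) (subforest_sum d\<theta> 4))"
proof -
  let ?T = "total_cohomology (Conf 4)"
  let ?K = "kernel ?T (total_cohomology (disk_Conf 4 r)) (total_pullback (disk_Conf 4 r) id)"
  obtain k where k: "k \<noteq> 0" and d: "d\<theta> = cohomology_class 1 circle (\<lambda>\<sigma>. k * wind \<sigma>)"
    by (rule circle_generator_wind[OF assms(2)])
  have treeE: "\<exists>p q. p \<in> {1, 2} \<and> q \<in> {1, 2, 3} \<and> G = set (tree_edges p q)" if "G \<in> F" for G
    using that unfolding assms(3) forests_eq by auto
  have ker: "forest_class d\<theta> 4 G \<in> ?K" "subforest_sum d\<theta> 4 G \<in> ?K" if "G \<in> F" for G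
  proof -
    obtain p q where pq: "p \<in> {1, 2}" "q \<in> {1, 2, 3}" and G: "G = set (tree_edges p q)"
      using treeE[OF \<open>G \<in> F\<close>] by blast
    show "forest_class d\<theta> 4 G \<in> ?K"
      unfolding G d forest_class_tree[OF pq] by (rule trees_in_kernel(1)[OF assms(1) pq])
    show "subforest_sum d\<theta> 4 G \<in> ?K"
      unfolding G d subforest_sum_tree[OF pq] by (rule trees_in_kernel(2)[OF assms(1) pq])
  qed
  let ?f = "case_sum (forest_class d\<theta> 4) (subforest_sum d\<theta> 4)"
  let ?dual = "\<lambda>\<Phi> i. \<Phi> \<in> hom ?T integer_group \<and> \<Phi> (?f i) \<noteq> 0 \<and> (\<forall>j\<in>F <+> F. i \<noteq> j \<longrightarrow> \<Phi> (?f j) = 0)"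
  have dual_Inl: "\<exists>\<Phi>. ?dual \<Phi> (Inl G)" if "G \<in> F" for G
  proof -
    obtain p q where pq: "p \<in> {1, 2}" "q \<in> {1, 2, 3}" and G: "G = set (tree_edges p q)"
      using treeE[OF \<open>G \<in> F\<close>] by blast
    obtain \<Phi> where hom: "\<Phi> \<in> hom ?T integer_group"
      and val: "\<forall>p' q' m. p' \<in> {1, 2} \<longrightarrow> q' \<in> {1, 2, 3} \<longrightarrow>
        \<Phi> (homogeneous 3 (Conf 4) (cohomology_class 3 (Conf 4) (\<lambda>\<sigma>. m * tree_cochain p' q' \<sigma>)))
          = (if p = p' \<and> q = q' then m else 0)"
      and off: "\<forall>A. \<Phi> (homogeneous 2 (Conf 4) A) = 0"
      using tree_functional[OF pq] by blast
    have top: "\<Phi> (forest_class d\<theta> 4 H) = (if G = H then k ^ 3 else 0)" if "H \<in> F" for H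
    proof -
      obtain p' q' where pq': "p' \<in> {1, 2}" "q' \<in> {1, 2, 3}" and H: "H = set (tree_edges p' q')"
        using treeE[OF \<open>H \<in> F\<close>] by blast
      show ?thesis
        using val[rule_format, OF pq', of "k ^ 3"] unfolding G H d forest_class_tree[OF pq'] tree_edges_inject .
    qed
    have sub: "\<Phi> (subforest_sum d\<theta> 4 H) = 0" if "H \<in> F" for H
    proof -
      obtain p' q' where pq': "p' \<in> {1, 2}" "q' \<in> {1, 2, 3}" and H: "H = set (tree_edges p' q')"
        using treeE[OF \<open>H \<in> F\<close>] by blast
      show ?thesis unfolding H d subforest_sum_tree[OF pq'] using off by blast
    qed
    have "\<Phi> (?f j) = 0" if "j \<in> F <+> F" "Inl G \<noteq> j" for j
      using that by (elim PlusE) (auto simp: top sub)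
    then show ?thesis using hom top[OF \<open>G \<in> F\<close>] k by (intro exI[of _ \<Phi>]) auto
  qed
  have dual_Inr: "\<exists>\<Phi>. ?dual \<Phi> (Inr G)" if "G \<in> F" for G
  proof -
    obtain p q where pq: "p \<in> {1, 2}" "q \<in> {1, 2, 3}" and G: "G = set (tree_edges p q)"
      using treeE[OF \<open>G \<in> F\<close>] by blast
    obtain \<Phi> where hom: "\<Phi> \<in> hom ?T integer_group"
      and val: "\<forall>p' q' m. p' \<in> {1, 2} \<longrightarrow> q' \<in> {1, 2, 3} \<longrightarrow>
        \<Phi> (homogeneous 2 (Conf 4) (cohomology_class 2 (Conf 4) (\<lambda>\<sigma>. m * subtree_cochain p' q' \<sigma>)))
          = (if p = p' \<and> q = q' then m else 0)"
      and off: "\<forall>A. \<Phi> (homogeneous 3 (Conf 4) A) = 0"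
      using subtree_functional[OF pq] by blast
    have sub: "\<Phi> (subforest_sum d\<theta> 4 H) = (if G = H then k\<^sup>2 else 0)" if "H \<in> F" for H
    proof -
      obtain p' q' where pq': "p' \<in> {1, 2}" "q' \<in> {1, 2, 3}" and H: "H = set (tree_edges p' q')"
        using treeE[OF \<open>H \<in> F\<close>] by blast
      show ?thesis
        using val[rule_format, OF pq', of "k\<^sup>2"] unfolding G H d subforest_sum_tree[OF pq'] tree_edges_inject .
    qed
    have top: "\<Phi> (forest_class d\<theta> 4 H) = 0" if "H \<in> F" for H
    proof -
      obtain p' q' where pq': "p' \<in> {1, 2}" "q' \<in> {1, 2, 3}" and H: "H = set (tree_edges p' q')"
        using treeE[OF \<open>H \<in> F\<close>] by blast
      show ?thesis unfolding H d forest_class_tree[OF pq'] using off by blast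
    qed
    have "\<Phi> (?f j) = 0" if "j \<in> F <+> F" "Inr G \<noteq> j" for j
      using that by (elim PlusE) (auto simp: top sub)
    then show ?thesis using hom sub[OF \<open>G \<in> F\<close>] k by (intro exI[of _ \<Phi>]) auto
  qed
  have "\<exists>\<Phi>. ?dual \<Phi> i" if "i \<in> F <+> F" for i
    using that dual_Inl dual_Inr by (elim PlusE) simp_all
  then obtain \<Phi> where \<Phi>: "\<And>i. i \<in> F <+> F \<Longrightarrow> ?dual (\<Phi> i) i" by metis
  have "int_independent ?T (F <+> F) ?f"
  proof (rule int_independent_if_dual[OF comm_group_total_cohomology, of _ _ _ \<Phi>])
    show "?f \<in> F <+> F \<rightarrow> carrier ?T"
      using ker by (auto simp: kernel_def Plus_def)
  qed (use \<Phi> in blast)+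
  moreover have "card F = 6" unfolding assms(3) by (rule card_forests)
  ultimately show ?thesis using ker by blast
qed

end
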